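(* Let $\Lambda=A\mathbb{Z}^d$ ($A\in\mathbb{R}^{d\times d}$ regular) be a $d$-dimensional lattice, let $\bm\alpha\in\mathbb{N}^d$, let $\bm x,\bm y\in\mathbb{R}^d$ and let $\nu\in\mathbb{C}$ be such that $\nu\neq d+|\bm\alpha|$ if both $\bm y\in\Lambda^*$ and $\chi(\bm\alpha)=1$. Then for any $\lambda>0$ it holds that $$ Z_{\Lambda,\nu,\bm\alpha}(\bm x,\bm y) = \sum_{k=0}^{\lfloor |\bm\alpha|/2\rfloor} \frac{(\pi/\lambda^2)^{\nu/2-k}}{\Gamma(\nu/2-k)} \Bigg[ \sum_{\bm z\in \Lambda-\bm x} h_{k,\bm\alpha}(\bm z)\,G_{\nu-2k}(\bm z/\lambda)\,e^{-2\pi i\bm y\cdot (\bm z+\bm x)} +(-1)^k \frac{\lambda^{d+2|\bm\alpha|-4k}}{i^{|\bm\alpha|}V_{\Lambda}} \sum_{\bm p\in \Lambda^{*}+\bm y} h_{k,\bm\alpha}(\bm p)\,G_{d-\nu+2(|\bm\alpha|-k)}(\lambda\bm p)\,e^{-2\pi i\bm x\cdot \bm p} \Bigg], $$ where each summand in which $h_{k,\bm\alpha}$ vanishes is understood to be zero, irrespective of the other factors.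
   Context: $\mathbb{N}=\{0,1,2,\dots\}$, $d\ge 1$ is an integer, $0^0=1$. For a multi-index $\bm\alpha\in\mathbb{N}^d$, $|\bm\alpha|=\alpha^{(1)}+\dots+\alpha^{(d)}$ and $\bm z^{\bm\alpha}=\prod_j (z^{(j)})^{\alpha^{(j)}}$; for vectors $|\cdot|$ is the Euclidean norm. $\chi(\bm\alpha)=1$ if all components of $\bm\alpha$ are even and $\chi(\bm\alpha)=0$ otherwise. For a lattice $\Lambda=A\mathbb{Z}^d$: $V_\Lambda=|\det A|$, and $\Lambda^*=A^{-T}\mathbb{Z}^d$ is the reciprocal lattice. Anisotropic Epstein zeta function: for $\bm x,\bm y\in\mathbb{R}^d$, $Z_{\Lambda,\nu,\bm\alpha}(\bm x,\bm y)$ is the meromorphic continuation in $\nu$ to $\mathbb{C}$ of $$\sum_{\bm z\in\Lambda,\ \bm z\ne\bm x} e^{-2\pi i\bm y\cdot\bm z}\,\frac{(\bm z-\bm x)^{\bm\alpha}}{|\bm z-\bm x|^{\nu}},\qquad \mathrm{Re}(\nu)>d+|\bm\alpha|.$$ Upper Crandall function: for $\nu\in\mathbb{C}$ and $\bm z\in\mathbb{R}^d\setminus\{\bm 0\}$, $G_\nu(\bm z)=\Gamma(\nu/2,\pi\bm z^2)/(\pi\bm z^2)^{\nu/2}$ with $\bm z^2=\sum_j (z^{(j)})^2$ and $\Gamma(s,x)$ the upper incomplete Gamma function ($\int_x^\infty t^{s-1}e^{-t}\,dt$, continued holomorphically in $s$); and $G_\nu(\bm 0)=-2/\nu$. $1/\Gamma$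 is the entire reciprocal Gamma function (zero at non-positive integers); if $\nu=2k$ the product $G_{\nu-2k}(\bm 0)/\Gamma(\nu/2-k)$ is understood as its limit $-1$ (since $G_{\nu-2k}(\bm 0)/\Gamma(\nu/2-k)=-1/\Gamma(\nu/2-k+1)$). Harmonic polynomials $h_{k,\bm\alpha}$: for $0\le k\le\lfloor|\bm\alpha|/2\rfloor$, $h_{k,\bm\alpha}$ are the uniquely determined polynomials on $\mathbb{R}^d$ that are harmonic ($\Delta h_{k,\bm\alpha}=0$) and homogeneous of degree $|\bm\alpha|-2k$ with $\bm y^{\bm\alpha}=\sum_{k=0}^{\lfloor|\bm\alpha|/2\rfloor}|\bm y|^{2k}h_{k,\bm\alpha}(\bm y)$ for all $\bm y\in\mathbb{R}^d$. *)

theory Defs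
  imports "HOL-Complex_Analysis.Complex_Analysis"
begin

text \<open>The dimension d is \<open>CARD('n)\<close>, and a multi-index is a vector of type \<open>nat ^ 'n\<close>.\<close>

definition mi_abs :: "nat ^ 'n \<Rightarrow> nat" where
  "mi_abs \<alpha> = (\<Sum>j\<in>UNIV. \<alpha> $ j)"

definition mi_pow :: "real ^ 'n \<Rightarrow> nat ^ 'n \<Rightarrow> real" where
  "mi_pow z \<alpha> = (\<Prod>j\<in>UNIV. (z $ j) ^ (\<alpha> $ j))"

definition lattice_of :: "real ^ 'n ^ 'n \<Rightarrow> (real ^ 'n) set" where
  "lattice_of A = {A *v m | m. \<forall>j. m $ j \<in> \<int>}"

definition reciprocal_lattice :: "real ^ 'n ^ 'n \<Rightarrow> (real ^ 'n) set" where
  "reciprocal_lattice A = lattice_of (transpose (matrix_inv A))"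

definition covolume :: "real ^ 'n ^ 'n \<Rightarrow> real" where
  "covolume A = \<bar>det A\<bar>"

text \<open>
  A meromorphic function on the complex plane is represented by its normal form: removable
  singularities are removed and the value at a pole is 0. This makes the continuation unique as
  a function. Convergence of the Dirichlet series is part of the predicate, because \<open>has_sum\<close>
  is used instead of \<open>infsum\<close>.
\<close>
definition is_epstein_continuation ::
  "(real ^ 'n) set \<Rightarrow> nat ^ 'n \<Rightarrow> real ^ 'n \<Rightarrow> real ^ 'n \<Rightarrow> (complex \<Rightarrow> complex) \<Rightarrow> bool" where
  "is_epstein_continuation L \<alpha> x y F \<longleftrightarrow>
     F nicely_meromorphic_on UNIV \<and>
     (\<forall>\<nu>. Re \<nu> > real (CARD('n) + mi_abs \<alpha>) \<longrightarrow>
        ((\<lambda>z. exp (- 2 * of_real pi * \<i> * of_real (y \<bullet> z)) *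
               (of_real (mi_pow (z - x) \<alpha>) / of_real (norm (z - x)) powr \<nu>))
           has_sum F \<nu>) (L - {x}))"

definition epstein_zeta ::
  "(real ^ 'n) set \<Rightarrow> complex \<Rightarrow> nat ^ 'n \<Rightarrow> real ^ 'n \<Rightarrow> real ^ 'n \<Rightarrow> complex" where
  "epstein_zeta L \<nu> \<alpha> x y = (THE F. is_epstein_continuation L \<alpha> x y F) \<nu>"

text \<open>
  Only used for \<open>x > 0\<close>, where the integral converges absolutely for every complex \<open>s\<close> and is
  entire in \<open>s\<close>, so that no continuation is needed.
\<close>
definition upper_Gamma :: "complex \<Rightarrow> real \<Rightarrow> complex" where
  "upper_Gamma s x = integral {x..} (\<lambda>t. of_real t powr (s - 1) / of_real (exp t))"

definition upper_crandall :: "complex \<Rightarrow> real ^ 'n \<Rightarrow> complex" where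
  "upper_crandall \<nu> z =
     (if z = 0 then - 2 / \<nu>
      else upper_Gamma (\<nu> / 2) (pi * (z \<bullet> z)) / of_real (pi * (z \<bullet> z)) powr (\<nu> / 2))"

text \<open>
  The quotient of \<open>upper_crandall \<mu> z\<close> by \<open>Gamma (\<mu> / 2)\<close>. At \<open>z = 0\<close> it equals
  \<open>- rGamma (\<mu> / 2 + 1)\<close> for \<open>\<mu> \<noteq> 0\<close>, and the value at \<open>\<mu> = 0\<close> is the limit.
\<close>
definition upper_crandall_over_Gamma :: "complex \<Rightarrow> real ^ 'n \<Rightarrow> complex" where
  "upper_crandall_over_Gamma \<mu> z =
     (if z = 0 \<and> \<mu> = 0 then - 1 else upper_crandall \<mu> z * rGamma (\<mu> / 2))"

definition partial_deriv :: "'n \<Rightarrow> (real ^ 'n \<Rightarrow> real) \<Rightarrow> real ^ 'n \<Rightarrow> real" where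
  "partial_deriv j f x = deriv (\<lambda>t. f (x + t *\<^sub>R axis j 1)) 0"

definition laplacian :: "(real ^ 'n \<Rightarrow> real) \<Rightarrow> real ^ 'n \<Rightarrow> real" where
  "laplacian f x = (\<Sum>j\<in>UNIV. partial_deriv j (partial_deriv j f) x)"

definition homogeneous_of_degree :: "nat \<Rightarrow> (real ^ 'n \<Rightarrow> real) \<Rightarrow> bool" where
  "homogeneous_of_degree m f \<longleftrightarrow> (\<forall>c x. f (c *\<^sub>R x) = c ^ m * f x)"

definition harmonic_decomposition :: "nat ^ 'n \<Rightarrow> (nat \<Rightarrow> real ^ 'n \<Rightarrow> real) \<Rightarrow> bool" where
  "harmonic_decomposition \<alpha> h \<longleftrightarrow>
     (\<forall>k \<le> mi_abs \<alpha> div 2.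
        real_polynomial_function (h k) \<and>
        (\<forall>y. laplacian (h k) y = 0) \<and>
        homogeneous_of_degree (mi_abs \<alpha> - 2 * k) (h k)) \<and>
     (\<forall>y. mi_pow y \<alpha> = (\<Sum>k\<le>mi_abs \<alpha> div 2. norm y ^ (2 * k) * h k y))"

text \<open>
  Uniqueness is taken componentwise since a decomposition does not constrain \<open>h k\<close>
  for \<open>k > mi_abs \<alpha> div 2\<close>.
\<close>
definition harmonic_part :: "nat \<Rightarrow> nat ^ 'n \<Rightarrow> real ^ 'n \<Rightarrow> real" where
  "harmonic_part k \<alpha> = (THE p. \<exists>h. harmonic_decomposition \<alpha> h \<and> h k = p)"

end

(*
  Split the monomial z^alpha into |z|^(2k) h_k(z) with h_k harmonic and homogeneous of degree
  |alpha| - 2k.  Each component gives a Dirichlet series sum h_k(z) |z|^(-2s) (with phases), which is the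
  Mellin transform of the theta series sum h_k(z) exp(-pi t |z|^2).  Because h_k is harmonic, h_k times a
  Gaussian is an eigenfunction of the Fourier transform, so Poisson summation maps this theta series at
  t to the one of the dual lattice at 1/t.  Splitting the Mellin integral at t = 1/lambda^2 and
  inverting t on the lower part (Riemann) turns both halves into sums of upper incomplete Gamma
  functions.  These halves are entire in s; the only poles come from the constant terms of the two
  theta series.
*)
theory Submission
  imports Defs "HOL-Probability.Characteristic_Functions"
begin

no_notation fps_nth (infixl "$" 75)

section \<open>Harmonic polynomials\<close>

text \<open>The k-th component enters with s = \<nu>/2 - k, so the analysis is done once per
  component in a single variable s, and the zeta function is a finite sum of shifted copies. Of the
  two constant terms, the one of \<Lambda> - x would give a pole at s = 0, which the factor 1 /
  Gamma s removes. The one of \<Lambda>* + y gives a pole at s = d/2 + m and is present only if h_k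
  does not vanish at the origin. By homogeneity this forces m = 0, that is |\<alpha>| = 2k, and by
  reflecting coordinates it forces all exponents to be even; the pole sits at \<nu> = d +
  |\<alpha>|, exactly the excluded case. The parameter lam is absorbed into the theta variable, so
  that the integral always splits at 1, and every interchange of a lattice sum with an integral is
  Fubini for the counting measure. Poisson summation rests on Stone-Weierstrass: a continuous
  periodic function with vanishing Fourier coefficients is zero.\<close>

lemmas rpf_linear = real_polynomial_function.intros(1)
  and rpf_const = real_polynomial_function.intros(2)
  and rpf_add = real_polynomial_function.intros(3)
  and rpf_mult = real_polynomial_function.intros(4)

text \<open>The statement only claims that some polynomial partials exist:
  \<open>partial_deriv\<close> is built on \<open>deriv\<close> and carries no information before
  differentiability is known. The total derivative passes through the induction over linear maps,
  constants, sums and products, and \<open>partial_deriv\<close> is identified with the witnesses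
  afterwards.\<close>

lemma has_derivative_partials:
  fixes f :: "real ^ 'n \<Rightarrow> real"
  assumes "real_polynomial_function f"
  shows "\<exists>g. (\<forall>j. real_polynomial_function (g j)) \<and>
             (\<forall>x. (f has_derivative (\<lambda>v. \<Sum>j\<in>UNIV. v $ j * g j x)) (at x))"
  using assms
proof induction
  case (linear f)
  show ?case
  proof (intro exI[of _ "\<lambda>j x. f (axis j 1)"] conjI allI)
    fix x :: "real ^ 'n"
    have "f v = (\<Sum>j\<in>UNIV. v $ j * f (axis j 1))" for v
    proof -
      have "f v = f (\<Sum>j\<in>UNIV. v $ j *\<^sub>R axis j 1)"
        by (simp add: basis_expansion flip: scalar_mult_eq_scaleR)
      also have "\<dots> = (\<Sum>j\<in>UNIV. v $ j * f (axis j 1))"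
        using linear by (simp add: linear_sum bounded_linear.linear linear_scale)
      finally show ?thesis .
    qed
    hence "f = (\<lambda>v. \<Sum>j\<in>UNIV. v $ j * f (axis j 1))" by (rule ext)
    thus "(f has_derivative (\<lambda>v. \<Sum>j\<in>UNIV. v $ j * f (axis j 1))) (at x)"
      using bounded_linear_imp_has_derivative[OF linear] by simp
  qed (rule rpf_const)
next
  case (const c)
  show ?case
    by (rule exI[of _ "\<lambda>j x. 0"]) (simp add: rpf_const)
next
  case (add f g)
  then obtain a b where "\<forall>j. real_polynomial_function (a j)" "\<forall>j. real_polynomial_function (b j)"
    and d: "\<And>x. (f has_derivative (\<lambda>v. \<Sum>j\<in>UNIV. v $ j * a j x)) (at x)"
      "\<And>x. (g has_derivative (\<lambda>v. \<Sum>j\<in>UNIV. v $ j * b j x)) (at x)" by blast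
  moreover have "((\<lambda>x. f x + g x) has_derivative (\<lambda>v. \<Sum>j\<in>UNIV. v $ j * (a j x + b j x))) (at x)" for x
    using has_derivative_add[OF d, of x] by (simp add: algebra_simps sum.distrib)
  ultimately show ?case
    by (intro exI[of _ "\<lambda>j x. a j x + b j x"]) auto
next
  case (mult f g)
  then obtain a b where "\<forall>j. real_polynomial_function (a j)" "\<forall>j. real_polynomial_function (b j)"
    and d: "\<And>x. (f has_derivative (\<lambda>v. \<Sum>j\<in>UNIV. v $ j * a j x)) (at x)"
      "\<And>x. (g has_derivative (\<lambda>v. \<Sum>j\<in>UNIV. v $ j * b j x)) (at x)" by blast
  moreover have "((\<lambda>x. f x * g x) has_derivative (\<lambda>v. \<Sum>j\<in>UNIV. v $ j * (f x * b j x + a j x * g x))) (at x)" for x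
    by (rule has_derivative_eq_rhs[OF has_derivative_mult[OF d]])
       (simp add: algebra_simps sum.distrib sum_distrib_left)
  ultimately show ?case using mult.hyps
    by (intro exI[of _ "\<lambda>j x. f x * b j x + a j x * g x"]) (simp add: rpf_add rpf_mult)
qed

lemma has_field_derivative_axis_partial:
  fixes f :: "real ^ 'n \<Rightarrow> real"
  assumes "(f has_derivative (\<lambda>v. \<Sum>j\<in>UNIV. v $ j * g j)) (at (x + t *\<^sub>R axis j 1))"
  shows "((\<lambda>t. f (x + t *\<^sub>R axis j 1)) has_field_derivative g j) (at t)"
proof -
  have "((\<lambda>t. f (x + t *\<^sub>R axis j 1)) has_derivative
          (\<lambda>s. \<Sum>i\<in>UNIV. (s *\<^sub>R axis j (1::real)) $ i * g i)) (at t)"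
    by (rule has_derivative_compose[of "\<lambda>t. x + t *\<^sub>R axis j 1", OF _ assms]) (auto intro!: derivative_eq_intros)
  also have "(\<lambda>s. \<Sum>i\<in>UNIV. (s *\<^sub>R axis j (1::real)) $ i * g i) = (\<lambda>s. s * g j)"
    by (simp add: axis_def if_distrib if_distribR cong: if_cong)
  finally show ?thesis by (simp add: has_field_derivative_def mult_commute_abs)
qed

lemma
  fixes f :: "real ^ 'n \<Rightarrow> real"
  assumes f: "real_polynomial_function f"
  shows real_polynomial_function_partial_deriv: "real_polynomial_function (partial_deriv j f)"
    and has_derivative_partial_deriv:
      "(f has_derivative (\<lambda>v. \<Sum>j\<in>UNIV. v $ j * partial_deriv j f x)) (at x)"
proof -
  obtain g where g: "\<And>j. real_polynomial_function (g j)"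
    and d: "\<And>x. (f has_derivative (\<lambda>v. \<Sum>j\<in>UNIV. v $ j * g j x)) (at x)"
    using has_derivative_partials[OF f] by blast
  have "partial_deriv j f x = g j x" for j x
    unfolding partial_deriv_def
    using has_field_derivative_axis_partial[of f "\<lambda>j. g j x" x 0 j] d[of x]
    by (intro DERIV_imp_deriv) simp
  hence "partial_deriv j f = g j" for j by (rule ext)
  with g d show "real_polynomial_function (partial_deriv j f)"
    "(f has_derivative (\<lambda>v. \<Sum>j\<in>UNIV. v $ j * partial_deriv j f x)) (at x)" by auto
qed

lemma partial_deriv_DERIV:
  fixes f :: "real ^ 'n \<Rightarrow> real"
  assumes "real_polynomial_function f"
  shows "((\<lambda>t. f (x + t *\<^sub>R axis j 1)) has_field_derivative partial_deriv j f (x + t *\<^sub>R axis j 1)) (at t)"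
  by (rule has_field_derivative_axis_partial[OF has_derivative_partial_deriv[OF assms]])

lemma partial_derivI:
  assumes "((\<lambda>t. f (x + t *\<^sub>R axis j 1)) has_field_derivative D) (at 0)"
  shows "partial_deriv j f x = D"
  unfolding partial_deriv_def using assms by (rule DERIV_imp_deriv)

lemma partial_deriv_const [simp]: "partial_deriv j (\<lambda>x. c) = (\<lambda>x. 0)"
  by (rule ext, rule partial_derivI) simp

lemma partial_deriv_linear:
  assumes "bounded_linear f"
  shows "partial_deriv j f = (\<lambda>x. f (axis j 1))"
proof (rule ext, rule partial_derivI)
  fix x
  interpret bounded_linear f by fact
  show "((\<lambda>t. f (x + t *\<^sub>R axis j 1)) has_field_derivative f (axis j 1)) (at 0)"
    unfolding add scaleR by (auto intro!: derivative_eq_intros)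
qed

context
  fixes f g :: "real ^ 'n \<Rightarrow> real"
  assumes f: "real_polynomial_function f" and g: "real_polynomial_function g"
begin

lemma partial_deriv_add:
  "partial_deriv j (\<lambda>x. f x + g x) = (\<lambda>x. partial_deriv j f x + partial_deriv j g x)"
proof (rule ext, rule partial_derivI)
  fix x
  show "((\<lambda>t. f (x + t *\<^sub>R axis j 1) + g (x + t *\<^sub>R axis j 1)) has_field_derivative
          partial_deriv j f x + partial_deriv j g x) (at 0)"
    using DERIV_add[OF partial_deriv_DERIV[OF f, of x j 0] partial_deriv_DERIV[OF g, of x j 0]] by simp
qed

lemma partial_deriv_mult:
  "partial_deriv j (\<lambda>x. f x * g x) = (\<lambda>x. partial_deriv j f x * g x + f x * partial_deriv j g x)"
proof (rule ext, rule partial_derivI)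
  fix x
  show "((\<lambda>t. f (x + t *\<^sub>R axis j 1) * g (x + t *\<^sub>R axis j 1)) has_field_derivative
          partial_deriv j f x * g x + f x * partial_deriv j g x) (at 0)"
    using DERIV_mult[OF partial_deriv_DERIV[OF f, of x j 0] partial_deriv_DERIV[OF g, of x j 0]]
    by (simp add: algebra_simps)
qed

end

lemma partial_deriv_cmult:
  fixes f :: "real ^ 'n \<Rightarrow> real"
  assumes "real_polynomial_function f"
  shows "partial_deriv j (\<lambda>x. c * f x) = (\<lambda>x. c * partial_deriv j f x)"
  using partial_deriv_mult[OF rpf_const assms] by simp

text \<open>Induction over the generators replaces Schwarz's theorem: linear functions have constant
  partials, and in the product case both orders give the same four Leibniz terms.\<close>

lemma partial_deriv_commute:
  fixes f :: "real ^ 'n \<Rightarrow> real"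
  assumes "real_polynomial_function f"
  shows "partial_deriv i (partial_deriv j f) = partial_deriv j (partial_deriv i f)"
  using assms
proof induction
  case (mult f g)
  show ?case using mult
    by (simp add: partial_deriv_mult partial_deriv_add real_polynomial_function_partial_deriv
          rpf_mult algebra_simps)
qed (simp_all add: partial_deriv_linear partial_deriv_add real_polynomial_function_partial_deriv)

lemma real_polynomial_function_laplacian:
  fixes f :: "real ^ 'n \<Rightarrow> real"
  assumes "real_polynomial_function f"
  shows "real_polynomial_function (laplacian f)"
  unfolding laplacian_def[abs_def] using assms
  by (intro real_polynomial_function_sum real_polynomial_function_partial_deriv) auto

lemma partial_deriv_sum:
  fixes f :: "'a \<Rightarrow> real ^ 'n \<Rightarrow> real"
  assumes "finite I" "\<And>i. i \<in> I \<Longrightarrow> real_polynomial_function (f i)"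
  shows "partial_deriv j (\<lambda>x. \<Sum>i\<in>I. f i x) = (\<lambda>x. \<Sum>i\<in>I. partial_deriv j (f i) x)"
  using assms
  by (induction rule: finite_induct) (simp_all add: partial_deriv_add real_polynomial_function_sum)

lemma laplacian_add:
  fixes f g :: "real ^ 'n \<Rightarrow> real"
  assumes "real_polynomial_function f" "real_polynomial_function g"
  shows "laplacian (\<lambda>x. f x + g x) = (\<lambda>x. laplacian f x + laplacian g x)"
  using assms
  by (simp add: laplacian_def fun_eq_iff partial_deriv_add real_polynomial_function_partial_deriv sum.distrib)

lemma laplacian_cmult:
  fixes f :: "real ^ 'n \<Rightarrow> real"
  assumes "real_polynomial_function f"
  shows "laplacian (\<lambda>x. c * f x) = (\<lambda>x. c * laplacian f x)"
  using assms
  by (simp add: laplacian_def fun_eq_iff partial_deriv_cmult real_polynomial_function_partial_deriv sum_distrib_left)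

lemma laplacian_diff:
  fixes f g :: "real ^ 'n \<Rightarrow> real"
  assumes "real_polynomial_function f" "real_polynomial_function g"
  shows "laplacian (\<lambda>x. f x - g x) = (\<lambda>x. laplacian f x - laplacian g x)"
  using laplacian_add[OF assms(1), of "\<lambda>x. (-1) * g x"] laplacian_cmult[OF assms(2), of "-1"] assms
  by (simp add: real_polynomial_function_minus)

lemma laplacian_zero [simp]: "laplacian (\<lambda>x. 0) = (\<lambda>x. 0)"
  by (simp add: laplacian_def fun_eq_iff)

lemma laplacian_sum:
  fixes f :: "'a \<Rightarrow> real ^ 'n \<Rightarrow> real"
  assumes "finite I" "\<And>i. i \<in> I \<Longrightarrow> real_polynomial_function (f i)"
  shows "laplacian (\<lambda>x. \<Sum>i\<in>I. f i x) = (\<lambda>x. \<Sum>i\<in>I. laplacian (f i) x)"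
  using assms
  by (induction rule: finite_induct) (simp_all add: laplacian_add real_polynomial_function_sum)

lemma laplacian_partial_deriv:
  fixes f :: "real ^ 'n \<Rightarrow> real"
  assumes "real_polynomial_function f"
  shows "laplacian (partial_deriv j f) = partial_deriv j (laplacian f)"
proof -
  have "partial_deriv i (partial_deriv i (partial_deriv j f)) = partial_deriv j (partial_deriv i (partial_deriv i f))" for i
    using partial_deriv_commute[OF assms, of i j]
      partial_deriv_commute[OF real_polynomial_function_partial_deriv[OF assms, of i], of i j] by simp
  thus ?thesis
    using assms by (simp add: laplacian_def[abs_def] partial_deriv_sum real_polynomial_function_partial_deriv)
qed

text \<open>Euler's identity, from two ways of differentiating c \<mapsto> f (c x) at c = 1.\<close>

lemma homogeneous_sum_partial_deriv:
  fixes f :: "real ^ 'n \<Rightarrow> real"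
  assumes "real_polynomial_function f" "homogeneous_of_degree n f"
  shows "(\<Sum>j\<in>UNIV. x $ j * partial_deriv j f x) = n * f x"
proof -
  have "((\<lambda>c. f (c *\<^sub>R x)) has_derivative (\<lambda>s. \<Sum>j\<in>UNIV. (s *\<^sub>R x) $ j * partial_deriv j f x)) (at 1)"
    by (rule has_derivative_compose[of "\<lambda>c. c *\<^sub>R x"])
       (use has_derivative_partial_deriv[OF assms(1), of x] in \<open>auto intro!: derivative_eq_intros\<close>)
  also have "(\<lambda>s. \<Sum>j\<in>UNIV. (s *\<^sub>R x) $ j * partial_deriv j f x) =
             (\<lambda>s. (\<Sum>j\<in>UNIV. x $ j * partial_deriv j f x) * s)"
    by (simp add: fun_eq_iff sum_distrib_left mult_ac)
  finally have 1: "((\<lambda>c. f (c *\<^sub>R x)) has_field_derivative (\<Sum>j\<in>UNIV. x $ j * partial_deriv j f x)) (at 1)"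
    by (simp add: has_field_derivative_def)
  have "(\<lambda>c. f (c *\<^sub>R x)) = (\<lambda>c. c ^ n * f x)"
    using assms(2) by (simp add: homogeneous_of_degree_def)
  moreover have "((\<lambda>c. c ^ n * f x) has_field_derivative (n * f x)) (at 1)"
    by (auto intro!: derivative_eq_intros)
  ultimately show ?thesis using 1 DERIV_unique by metis
qed

lemma continuous_on_real_polynomial_function:
  fixes f :: "'a::euclidean_space \<Rightarrow> real"
  shows "real_polynomial_function f \<Longrightarrow> continuous_on S f"
  by (simp add: real_polynomial_function_eq continuous_on_polymonial_function)

lemma homogeneous_partial_deriv:
  fixes f :: "real ^ 'n \<Rightarrow> real"
  assumes f: "real_polynomial_function f" and h: "homogeneous_of_degree (Suc n) f"
  shows "homogeneous_of_degree n (partial_deriv j f)"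
proof -
  have *: "partial_deriv j f (c *\<^sub>R x) = c ^ n * partial_deriv j f x" if "c \<noteq> 0" for c x
  proof -
    have "(\<lambda>t. f (c *\<^sub>R (x + t *\<^sub>R axis j 1))) = (\<lambda>t. c ^ Suc n * f (x + t *\<^sub>R axis j 1))"
      using h by (simp add: homogeneous_of_degree_def)
    moreover have "((\<lambda>t. c ^ Suc n * f (x + t *\<^sub>R axis j 1)) has_field_derivative c ^ Suc n * partial_deriv j f x) (at 0)"
      using DERIV_cmult[OF partial_deriv_DERIV[OF f, of x j 0], of "c ^ Suc n"] by simp
    moreover have "((\<lambda>t. f (c *\<^sub>R (x + t *\<^sub>R axis j 1))) has_field_derivative partial_deriv j f (c *\<^sub>R x) * c) (at 0)"
      using DERIV_chain2[where f="\<lambda>s. f (c *\<^sub>R x + s *\<^sub>R axis j 1)" and g="\<lambda>t. c * t",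
          OF partial_deriv_DERIV[OF f, of "c *\<^sub>R x" j "c * 0"] DERIV_cmult_Id]
      by (simp add: scaleR_add_right)
    ultimately have "partial_deriv j f (c *\<^sub>R x) * c = c ^ Suc n * partial_deriv j f x"
      by (metis DERIV_unique)
    with that show ?thesis by (simp add: mult_ac)
  qed
  have "partial_deriv j f (c *\<^sub>R x) = c ^ n * partial_deriv j f x" for c x
  proof (cases "c = 0")
    \<comment> \<open>The factor c cannot be cancelled here. Both sides are continuous in c, so the
      value at 0 is a limit of the nonzero case; for n = 0 this is consistent with
      \<open>0 ^ 0 = 1\<close>.\<close>
    case True
    have cont: "continuous_on UNIV (\<lambda>c. partial_deriv j f (c *\<^sub>R x))"
      by (rule continuous_on_compose2[OF continuous_on_real_polynomial_function[OF real_polynomial_function_partial_deriv[OF f]]])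
         (auto intro!: continuous_intros)
    have "((\<lambda>c. partial_deriv j f (c *\<^sub>R x)) \<longlongrightarrow> partial_deriv j f (0 *\<^sub>R x)) (at 0)"
      using cont by (metis continuous_on_eq_continuous_at isCont_def open_UNIV UNIV_I)
    moreover have "((\<lambda>c. c ^ n * partial_deriv j f x) \<longlongrightarrow> 0 ^ n * partial_deriv j f x) (at 0)"
      by (intro tendsto_intros)
    hence "((\<lambda>c. partial_deriv j f (c *\<^sub>R x)) \<longlongrightarrow> 0 ^ n * partial_deriv j f x) (at 0)"
      by (rule Lim_transform_eventually) (auto simp: eventually_at_filter *)
    ultimately show ?thesis using True LIM_unique by metis
  qed (rule *)
  thus ?thesis by (simp add: homogeneous_of_degree_def)
qed

lemma homogeneous_0_const:
  assumes "homogeneous_of_degree 0 f"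
  shows "f = (\<lambda>x. f 0)"
  using assms by (metis homogeneous_of_degree_def power_0 mult_1 scaleR_zero_left)

lemma homogeneous_laplacian:
  fixes f :: "real ^ 'n \<Rightarrow> real"
  assumes f: "real_polynomial_function f" and h: "homogeneous_of_degree (Suc (Suc n)) f"
  shows "homogeneous_of_degree n (laplacian f)"
  using homogeneous_partial_deriv[OF real_polynomial_function_partial_deriv[OF f] homogeneous_partial_deriv[OF f h]]
  by (simp add: homogeneous_of_degree_def laplacian_def sum_distrib_left)

text \<open>Base of the induction on the degree: below degree 2 a homogeneous polynomial is its own
  decomposition. Two differentiations annihilate it, since homogeneity of degree 0 means
  constancy.\<close>

lemma laplacian_low_degree:
  fixes f :: "real ^ 'n \<Rightarrow> real"
  assumes f: "real_polynomial_function f" and h: "homogeneous_of_degree n f" and "n < 2"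
  shows "laplacian f = (\<lambda>x. 0)"
proof -
  have "partial_deriv j (partial_deriv j f) = (\<lambda>x. 0)" for j
  proof (cases n)
    case 0
    hence "f = (\<lambda>x. f 0)" using homogeneous_0_const[of f] h by simp
    hence "partial_deriv j f = (\<lambda>x. 0)" by (metis partial_deriv_const)
    thus ?thesis by simp
  next
    case (Suc k)
    hence "homogeneous_of_degree 0 (partial_deriv j f)"
      using homogeneous_partial_deriv[OF f, of 0] h \<open>n < 2\<close> by auto
    from homogeneous_0_const[OF this] show ?thesis
      by (metis partial_deriv_const)
  qed
  thus ?thesis by (simp add: laplacian_def fun_eq_iff)
qed

section \<open>The Laplacian and multiplication by powers of the norm\<close>

lemma real_polynomial_function_inner_self: "real_polynomial_function (\<lambda>x::'a::euclidean_space. x \<bullet> x)"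
proof -
  have "(\<lambda>x::'a. x \<bullet> x) = (\<lambda>x. \<Sum>b\<in>Basis. (x \<bullet> b) * (x \<bullet> b))"
    by (rule ext, rule euclidean_inner)
  moreover have "real_polynomial_function (\<lambda>x::'a. \<Sum>b\<in>Basis. (x \<bullet> b) * (x \<bullet> b))"
    by (intro real_polynomial_function_sum rpf_mult rpf_linear bounded_linear_inner_left) auto
  ultimately show ?thesis by simp
qed

lemma real_polynomial_function_norm_power:
  "real_polynomial_function (\<lambda>x::'a::euclidean_space. norm x ^ (2 * k))"
  unfolding power_mult dot_square_norm[symmetric]
  by (rule real_polynomial_function_power[OF real_polynomial_function_inner_self])

lemma partial_deriv_inner_self: "partial_deriv j (\<lambda>x. x \<bullet> x) = (\<lambda>x. 2 * x $ j)"
proof (rule ext, rule partial_derivI)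
  fix x :: "real ^ 'a"
  have "(\<lambda>t. (x + t *\<^sub>R axis j 1) \<bullet> (x + t *\<^sub>R axis j 1)) = (\<lambda>t. x \<bullet> x + 2 * t * x $ j + t\<^sup>2)"
    by (simp add: fun_eq_iff inner_add_left inner_add_right inner_axis inner_commute[of "axis j 1"] power2_eq_square
          algebra_simps)
  thus "((\<lambda>t. (x + t *\<^sub>R axis j 1) \<bullet> (x + t *\<^sub>R axis j 1)) has_field_derivative 2 * x $ j) (at 0)"
    by (auto intro!: derivative_eq_intros)
qed

lemma real_polynomial_function_nth: "real_polynomial_function (\<lambda>x::real^'n. x $ j)"
  by (intro rpf_linear bounded_linear_vec_nth)

text \<open>The mixed terms add up to four times \<Sum> x_j \<partial>_j f, which Euler's identity
  turns into 4 n f; the rest is the Laplacian 2 d of |x|^2 and the term with the Laplacian of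
  f.\<close>

lemma laplacian_inner_self_mult:
  fixes f :: "real ^ 'n \<Rightarrow> real"
  assumes f: "real_polynomial_function f" and h: "homogeneous_of_degree n f"
  shows "laplacian (\<lambda>x. (x \<bullet> x) * f x) = (\<lambda>x. (2 * CARD('n) + 4 * n) * f x + (x \<bullet> x) * laplacian f x)"
proof
  fix x :: "real ^ 'n"
  note P = real_polynomial_function_partial_deriv[OF f] real_polynomial_function_inner_self
    real_polynomial_function_nth rpf_mult rpf_const
  have lin: "partial_deriv j (\<lambda>x. 2 * x $ j) = (\<lambda>x. 2)" for j :: 'n
    by (subst partial_deriv_linear) (auto intro!: bounded_linear_intros bounded_linear_vec_nth)
  have 1: "partial_deriv j (\<lambda>x. (x \<bullet> x) * f x) = (\<lambda>x. 2 * x $ j * f x + (x \<bullet> x) * partial_deriv j f x)" for j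
    using f by (simp add: partial_deriv_mult P partial_deriv_inner_self)
  have "partial_deriv j (\<lambda>x. 2 * x $ j * f x + (x \<bullet> x) * partial_deriv j f x) x =
        2 * f x + 4 * (x $ j * partial_deriv j f x) + (x \<bullet> x) * partial_deriv j (partial_deriv j f) x" for j
    using f by (simp add: partial_deriv_add partial_deriv_mult P partial_deriv_inner_self lin)
  hence "laplacian (\<lambda>x. (x \<bullet> x) * f x) x =
     (\<Sum>j\<in>UNIV. 2 * f x + 4 * (x $ j * partial_deriv j f x) + (x \<bullet> x) * partial_deriv j (partial_deriv j f) x)"
    by (simp add: laplacian_def 1)
  also have "\<dots> = 2 * CARD('n) * f x + 4 * (\<Sum>j\<in>UNIV. x $ j * partial_deriv j f x) + (x \<bullet> x) * laplacian f x"
    by (simp add: sum.distrib laplacian_def sum_distrib_left[symmetric])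
  finally show "laplacian (\<lambda>x. (x \<bullet> x) * f x) x =
       (2 * CARD('n) + 4 * n) * f x + (x \<bullet> x) * laplacian f x"
    using homogeneous_sum_partial_deriv[OF f h, of x] by (simp add: algebra_simps)
qed

lemma homogeneous_norm_power_mult:
  assumes "homogeneous_of_degree n f"
  shows "homogeneous_of_degree (n + 2 * k) (\<lambda>x. norm x ^ (2 * k) * f x)"
  using assms by (simp add: homogeneous_of_degree_def power_add power_mult_distrib power_mult mult_ac
    flip: power_abs)

text \<open>Each multiplication by |x|^2 adds 2 d + 4 (n + 2 i), where n + 2 i is the degree reached
  so far; summing over i = 0..k gives the factor 2 (k + 1) (2 k + d + 2 n). It is nonzero, so the
  Laplacian can be inverted on these products.\<close>

lemma laplacian_norm_power_mult:
  fixes f :: "real ^ 'n \<Rightarrow> real"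
  assumes f: "real_polynomial_function f" and h: "homogeneous_of_degree n f"
    and harm: "\<And>x. laplacian f x = 0"
  shows "laplacian (\<lambda>x. norm x ^ (2 * Suc k) * f x) =
           (\<lambda>x. (2 * Suc k * (2 * k + CARD('n) + 2 * n)) * (norm x ^ (2 * k) * f x))"
proof (induction k)
  case 0
  show ?case using laplacian_inner_self_mult[OF f h] by (simp add: dot_square_norm harm power2_eq_square)
next
  case (Suc k)
  have P: "real_polynomial_function (\<lambda>x. norm x ^ (2 * Suc k) * f x)"
    by (intro rpf_mult f real_polynomial_function_norm_power)
  have "(\<lambda>x. norm x ^ (2 * Suc (Suc k)) * f x) = (\<lambda>x. (x \<bullet> x) * (norm x ^ (2 * Suc k) * f x))"
    by (simp add: dot_square_norm power2_eq_square mult_ac)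
  hence "laplacian (\<lambda>x. norm x ^ (2 * Suc (Suc k)) * f x) =
      (\<lambda>x. (2 * CARD('n) + 4 * (n + 2 * Suc k)) * (norm x ^ (2 * Suc k) * f x) +
        (x \<bullet> x) * laplacian (\<lambda>x. norm x ^ (2 * Suc k) * f x) x)"
    using laplacian_inner_self_mult[OF P homogeneous_norm_power_mult[OF h]] by simp
  also have "\<dots> = (\<lambda>x. (2 * CARD('n) + 4 * (n + 2 * Suc k)) * (norm x ^ (2 * Suc k) * f x) +
        (2 * Suc k * (2 * k + CARD('n) + 2 * n)) * (norm x ^ (2 * Suc k) * f x))"
    unfolding Suc by (simp add: dot_square_norm power2_eq_square fun_eq_iff)
  also have "\<dots> = (\<lambda>x. (2 * Suc (Suc k) * (2 * Suc k + CARD('n) + 2 * n)) * (norm x ^ (2 * Suc k) * f x))"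
    unfolding ring_distribs(2)[symmetric] of_nat_add[symmetric]
    by (rule ext, rule arg_cong2[where f="(*)"], rule arg_cong[where f=real]) (simp_all add: algebra_simps)
  finally show ?case .
qed

section \<open>Existence and uniqueness of the harmonic decomposition\<close>

definition harmonic_homogeneous :: "nat \<Rightarrow> (real ^ 'n \<Rightarrow> real) \<Rightarrow> bool" where
  "harmonic_homogeneous n f \<longleftrightarrow>
     real_polynomial_function f \<and> (\<forall>x. laplacian f x = 0) \<and> homogeneous_of_degree n f"

lemma harmonic_homogeneous_partial_deriv:
  "harmonic_homogeneous (Suc n) f \<Longrightarrow> harmonic_homogeneous n (partial_deriv j f)"
  unfolding harmonic_homogeneous_def fun_eq_iff[of "laplacian _" "\<lambda>x. 0", symmetric]
  by (simp add: homogeneous_partial_deriv laplacian_partial_deriv real_polynomial_function_partial_deriv)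

lemma harmonic_homogeneous_cmult:
  "harmonic_homogeneous n f \<Longrightarrow> harmonic_homogeneous n (\<lambda>x. c * f x)"
  by (auto simp: harmonic_homogeneous_def laplacian_cmult homogeneous_of_degree_def
        intro: rpf_mult rpf_const)

lemma harmonic_homogeneous_add:
  "harmonic_homogeneous n f \<Longrightarrow> harmonic_homogeneous n g \<Longrightarrow> harmonic_homogeneous n (\<lambda>x. f x + g x)"
  by (auto simp: harmonic_homogeneous_def laplacian_add homogeneous_of_degree_def algebra_simps
        intro: rpf_add)

lemma harmonic_decomposition_alt:
  "harmonic_decomposition \<alpha> h \<longleftrightarrow>
     (\<forall>k \<le> mi_abs \<alpha> div 2. harmonic_homogeneous (mi_abs \<alpha> - 2 * k) (h k)) \<and>
     (\<forall>y. mi_pow y \<alpha> = (\<Sum>k\<le>mi_abs \<alpha> div 2. norm y ^ (2 * k) * h k y))"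
  by (simp add: harmonic_decomposition_def harmonic_homogeneous_def)

text \<open>The Laplacian maps the decomposition of degree \<open>m\<close> to the one of degree \<open>m - 2\<close>, with
  nonzero factors on all components but the first; this gives existence and uniqueness by induction.\<close>
lemma harmonic_decomposition_exists:
  fixes f :: "real ^ 'n \<Rightarrow> real"
  assumes "real_polynomial_function f" "homogeneous_of_degree m f"
  shows "\<exists>h. (\<forall>k \<le> m div 2. harmonic_homogeneous (m - 2 * k) (h k)) \<and>
             (\<forall>y. f y = (\<Sum>k\<le>m div 2. norm y ^ (2 * k) * h k y))"
  using assms
proof (induction m arbitrary: f rule: less_induct)
  case (less m)
  show ?case
  proof (cases "m < 2")
    case True
    hence "harmonic_homogeneous m f"
      using less.prems laplacian_low_degree[OF less.prems True] by (simp add: harmonic_homogeneous_def)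
    thus ?thesis using True by (intro exI[of _ "\<lambda>_. f"]) auto
  next
    case False
    then obtain n where m: "m = Suc (Suc n)" by (metis add_2_eq_Suc le_Suc_ex not_less)
    have "real_polynomial_function (laplacian f)" "homogeneous_of_degree n (laplacian f)"
      using less.prems real_polynomial_function_laplacian homogeneous_laplacian by (auto simp: m)
    from less.IH[OF _ this] obtain g where
      g: "\<And>k. k \<le> n div 2 \<Longrightarrow> harmonic_homogeneous (n - 2 * k) (g k)" and
      sum: "\<And>y. laplacian f y = (\<Sum>k\<le>n div 2. norm y ^ (2 * k) * g k y)" by (auto simp: m)
    \<comment> \<open>The reciprocal of the factor in \<open>laplacian_norm_power_mult\<close> for
      degree n - 2 k. Weighted with it, the components of \<open>laplacian f\<close> lift to a
      polynomial \<open>q\<close> with the same Laplacian as f.\<close>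
    define b where "b k = 1 / real (2 * Suc k * (2 * k + CARD('n) + 2 * (n - 2 * k)))" for k
    define q where "q = (\<lambda>y. \<Sum>k\<le>n div 2. norm y ^ (2 * Suc k) * (b k * g k y))"
    have bg: "harmonic_homogeneous (n - 2 * k) (\<lambda>y. b k * g k y)" if "k \<le> n div 2" for k
      using harmonic_homogeneous_cmult g that by blast
    have P: "real_polynomial_function (\<lambda>y. norm y ^ (2 * Suc k) * (b k * g k y))" if "k \<le> n div 2" for k
      using bg[OF that] unfolding harmonic_homogeneous_def
      by (intro rpf_mult[OF real_polynomial_function_norm_power]) auto
    have q: "real_polynomial_function q"
      unfolding q_def by (intro real_polynomial_function_sum P) auto
    have hq: "homogeneous_of_degree m q"
    proof -
      have "homogeneous_of_degree m (\<lambda>y. norm y ^ (2 * Suc k) * (b k * g k y))" if "k \<le> n div 2" for k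
        using homogeneous_norm_power_mult[of "n - 2 * k" "\<lambda>y. b k * g k y" "Suc k"] bg[OF that] that
        by (auto simp: harmonic_homogeneous_def m)
      thus ?thesis by (auto simp: q_def homogeneous_of_degree_def sum_distrib_left intro!: sum.cong)
    qed
    have "laplacian q = (\<lambda>y. \<Sum>k\<le>n div 2. laplacian (\<lambda>y. norm y ^ (2 * Suc k) * (b k * g k y)) y)"
      unfolding q_def by (rule laplacian_sum) (use P in auto)
    also have "\<dots> = laplacian f"
    proof
      fix y
      have "laplacian (\<lambda>y. norm y ^ (2 * Suc k) * (b k * g k y)) y = norm y ^ (2 * k) * g k y"
        if "k \<le> n div 2" for k
      proof -
        define c where "c = 2 * Suc k * (2 * k + CARD('n) + 2 * (n - 2 * k))"
        have "c \<noteq> 0" by (simp add: c_def)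
        moreover have "b k = 1 / real c" unfolding b_def c_def ..
        ultimately have "real c * b k = 1" by simp
        moreover have "laplacian (\<lambda>y. norm y ^ (2 * Suc k) * (b k * g k y)) y =
            real c * (norm y ^ (2 * k) * (b k * g k y))"
          unfolding c_def
          using laplacian_norm_power_mult[of "\<lambda>y. b k * g k y" "n - 2 * k" k] bg[OF that]
          unfolding harmonic_homogeneous_def fun_eq_iff by blast
        moreover have "c * (N * (d * e)) = (c * d) * (N * e)" for c N d e :: real by simp
        ultimately show ?thesis by simp
      qed
      thus "(\<Sum>k\<le>n div 2. laplacian (\<lambda>y. norm y ^ (2 * Suc k) * (b k * g k y)) y) = laplacian f y"
        by (simp add: sum)
    qed
    finally have lq: "laplacian q = laplacian f" .
    \<comment> \<open>The remainder after removing \<open>q\<close> is harmonic and becomes the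
      component with k = 0.\<close>
    have 0: "harmonic_homogeneous m (\<lambda>y. f y - q y)"
      using less.prems q hq
      by (auto simp: harmonic_homogeneous_def laplacian_diff lq homogeneous_of_degree_def algebra_simps
            intro!: real_polynomial_function_diff)
    show ?thesis
    \<comment> \<open>Raising the index by one matches the degrees: m - 2 (k + 1) = n - 2 k.\<close>
    proof (intro exI[of _ "\<lambda>k. case k of 0 \<Rightarrow> (\<lambda>y. f y - q y) | Suc k \<Rightarrow> (\<lambda>y. b k * g k y)"] conjI allI impI)
      fix k assume "k \<le> m div 2"
      thus "harmonic_homogeneous (m - 2 * k)
             (case k of 0 \<Rightarrow> (\<lambda>y. f y - q y) | Suc k \<Rightarrow> (\<lambda>y. b k * g k y))"
        using 0 bg by (auto split: nat.split simp: m)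
    next
      fix y
      show "f y = (\<Sum>k\<le>m div 2. norm y ^ (2 * k) *
             (case k of 0 \<Rightarrow> (\<lambda>y. f y - q y) | Suc k \<Rightarrow> (\<lambda>y. b k * g k y)) y)"
        by (simp add: m sum.atMost_Suc_shift q_def del: sum.atMost_Suc)
    qed
  qed
qed

lemma harmonic_decomposition_zero:
  fixes h :: "nat \<Rightarrow> real ^ 'n \<Rightarrow> real"
  assumes "\<And>k. k \<le> m div 2 \<Longrightarrow> harmonic_homogeneous (m - 2 * k) (h k)"
    and "\<And>y. (\<Sum>k\<le>m div 2. norm y ^ (2 * k) * h k y) = 0" and "k \<le> m div 2"
  shows "h k = (\<lambda>x. 0)"
  using assms
proof (induction m arbitrary: h k rule: less_induct)
  case (less m)
  show ?case
  proof (cases "m < 2")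
    case True
    thus ?thesis using less.prems(2,3) by auto
  next
    case False
    then obtain n where m: "m = Suc (Suc n)" by (metis add_2_eq_Suc le_Suc_ex not_less)
    define a where "a k = real (2 * Suc k * (2 * k + CARD('n) + 2 * (n - 2 * k)))" for k
    have a: "a k \<noteq> 0" for k
      unfolding a_def of_nat_eq_0_iff by simp
    have H: "harmonic_homogeneous m (h 0)" "k \<le> n div 2 \<Longrightarrow> harmonic_homogeneous (n - 2 * k) (h (Suc k))" for k
      using less.prems(1)[of 0] less.prems(1)[of "Suc k"] by (auto simp: m)
    have P: "real_polynomial_function (\<lambda>y. norm y ^ (2 * k) * h k y)" if "k \<le> m div 2" for k
      using less.prems(1)[OF that] unfolding harmonic_homogeneous_def
      by (intro rpf_mult[OF real_polynomial_function_norm_power]) auto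
    have "(\<Sum>k\<le>n div 2. norm y ^ (2 * k) * (a k * h (Suc k) y)) = 0" for y
    proof -
      have "0 = laplacian (\<lambda>y. \<Sum>k\<le>m div 2. norm y ^ (2 * k) * h k y) y"
        using less.prems(2) by simp
      also have "\<dots> = (\<Sum>k\<le>m div 2. laplacian (\<lambda>y. norm y ^ (2 * k) * h k y) y)"
        using P by (subst laplacian_sum) auto
      also have "\<dots> = laplacian (h 0) y + (\<Sum>k\<le>n div 2. laplacian (\<lambda>y. norm y ^ (2 * Suc k) * h (Suc k) y) y)"
        by (simp add: m sum.atMost_Suc_shift del: mult_Suc_right sum.atMost_Suc)
      also have "laplacian (h 0) y = 0"
        using H(1) by (simp add: harmonic_homogeneous_def)
      also have "(\<Sum>k\<le>n div 2. laplacian (\<lambda>y. norm y ^ (2 * Suc k) * h (Suc k) y) y) =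
                 (\<Sum>k\<le>n div 2. norm y ^ (2 * k) * (a k * h (Suc k) y))"
      proof (rule sum.cong)
        fix k assume "k \<in> {..n div 2}"
        hence "laplacian (\<lambda>y. norm y ^ (2 * Suc k) * h (Suc k) y) y = a k * (norm y ^ (2 * k) * h (Suc k) y)"
          unfolding a_def atMost_iff
          using laplacian_norm_power_mult[of "h (Suc k)" "n - 2 * k" k] H(2)[of k]
          unfolding harmonic_homogeneous_def fun_eq_iff by blast
        thus "laplacian (\<lambda>y. norm y ^ (2 * Suc k) * h (Suc k) y) y = norm y ^ (2 * k) * (a k * h (Suc k) y)"
          by simp
      qed simp
      finally show ?thesis by simp
    qed
    hence "(\<lambda>y. a k * h (Suc k) y) = (\<lambda>x. 0)" if "k \<le> n div 2" for k
      by (rule less.IH[of n "\<lambda>k y. a k * h (Suc k) y", rotated 2])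
         (use that H(2) in \<open>auto simp: m intro: harmonic_homogeneous_cmult\<close>)
    hence hS: "h (Suc k) = (\<lambda>x. 0)" if "k \<le> n div 2" for k
      using that a by (simp add: fun_eq_iff)
    have h0: "h 0 = (\<lambda>x. 0)"
    proof
      fix y
      have "0 = h 0 y + (\<Sum>k\<le>n div 2. norm y ^ (2 * Suc k) * h (Suc k) y)"
        using less.prems(2)[of y] by (simp add: m sum.atMost_Suc_shift del: sum.atMost_Suc)
      thus "h 0 y = 0" by (simp add: hS)
    qed
    show ?thesis using h0 hS less.prems(3) by (cases k) (auto simp: m)
  qed
qed

lemma harmonic_decomposition_unique:
  assumes "harmonic_decomposition \<alpha> h" "harmonic_decomposition \<alpha> g" "k \<le> mi_abs \<alpha> div 2"
  shows "h k = g k"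
proof -
  have "(\<Sum>k\<le>mi_abs \<alpha> div 2. norm y ^ (2 * k) * (h k y + (-1) * g k y)) = 0" for y
  proof -
    have "(\<Sum>k\<le>mi_abs \<alpha> div 2. norm y ^ (2 * k) * (h k y + (-1) * g k y)) =
          (\<Sum>k\<le>mi_abs \<alpha> div 2. norm y ^ (2 * k) * h k y) - (\<Sum>k\<le>mi_abs \<alpha> div 2. norm y ^ (2 * k) * g k y)"
      by (simp add: right_diff_distrib sum_subtractf)
    also have "\<dots> = mi_pow y \<alpha> - mi_pow y \<alpha>"
      using assms(1)[unfolded harmonic_decomposition_alt, THEN conjunct2, rule_format, of y]
        assms(2)[unfolded harmonic_decomposition_alt, THEN conjunct2, rule_format, of y] by simp
    finally show ?thesis by simp
  qed
  moreover have "harmonic_homogeneous (mi_abs \<alpha> - 2 * k) (\<lambda>y. h k y + (-1) * g k y)"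
    if "k \<le> mi_abs \<alpha> div 2" for k
  proof (rule harmonic_homogeneous_add[OF _ harmonic_homogeneous_cmult])
    show "harmonic_homogeneous (mi_abs \<alpha> - 2 * k) (h k)" "harmonic_homogeneous (mi_abs \<alpha> - 2 * k) (g k)"
      using assms(1,2) that unfolding harmonic_decomposition_alt by blast+
  qed
  ultimately have "(\<lambda>y. h k y + (-1) * g k y) = (\<lambda>x. 0)"
    by (rule harmonic_decomposition_zero[where m="mi_abs \<alpha>" and h="\<lambda>k y. h k y + (-1) * g k y", OF _ _ assms(3), rotated])
  thus ?thesis by (simp add: fun_eq_iff)
qed

lemma real_polynomial_function_mi_pow: "real_polynomial_function (\<lambda>y. mi_pow y \<alpha>)"
  unfolding mi_pow_def
  by (rule real_polynomial_function_prod, simp, rule real_polynomial_function_power, rule real_polynomial_function_nth)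

lemma homogeneous_mi_pow: "homogeneous_of_degree (mi_abs \<alpha>) (\<lambda>y. mi_pow y \<alpha>)"
  unfolding homogeneous_of_degree_def mi_pow_def mi_abs_def power_sum prod.distrib[symmetric]
  by (simp add: power_mult_distrib)

text \<open>The description picks each component separately, so it must be checked that the picks
  belong to one and the same decomposition; uniqueness for each index provides this.\<close>

lemma harmonic_decomposition_harmonic_part: "harmonic_decomposition \<alpha> (\<lambda>k. harmonic_part k \<alpha>)"
proof -
  obtain h where h: "harmonic_decomposition \<alpha> h"
    using harmonic_decomposition_exists[OF real_polynomial_function_mi_pow homogeneous_mi_pow]
    unfolding harmonic_decomposition_alt by blast
  have *: "harmonic_part k \<alpha> = h k" if "k \<le> mi_abs \<alpha> div 2" for k
    unfolding harmonic_part_def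
  proof (rule the_equality)
    show "\<exists>g. harmonic_decomposition \<alpha> g \<and> g k = h k" using h by blast
    show "p = h k" if "\<exists>g. harmonic_decomposition \<alpha> g \<and> g k = p" for p
    proof -
      from that obtain g where g: "harmonic_decomposition \<alpha> g" "g k = p" by blast
      show ?thesis using harmonic_decomposition_unique[OF g(1) h \<open>k \<le> mi_abs \<alpha> div 2\<close>] g(2) by simp
    qed
  qed
  hence eq: "(\<Sum>k\<le>mi_abs \<alpha> div 2. norm y ^ (2 * k) * harmonic_part k \<alpha> y) =
         (\<Sum>k\<le>mi_abs \<alpha> div 2. norm y ^ (2 * k) * h k y)" for y
    by (intro sum.cong) auto
  show ?thesis unfolding harmonic_decomposition_alt eq
    using h[unfolded harmonic_decomposition_alt] by (simp add: *)
qed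

lemma harmonic_part_eqI:
  "harmonic_decomposition \<alpha> h \<Longrightarrow> k \<le> mi_abs \<alpha> div 2 \<Longrightarrow> harmonic_part k \<alpha> = h k"
  by (rule harmonic_decomposition_unique[OF harmonic_decomposition_harmonic_part])

lemma harmonic_homogeneous_harmonic_part:
  "k \<le> mi_abs \<alpha> div 2 \<Longrightarrow> harmonic_homogeneous (mi_abs \<alpha> - 2 * k) (harmonic_part k \<alpha>)"
  using harmonic_decomposition_harmonic_part unfolding harmonic_decomposition_alt by blast

section \<open>Parity of the harmonic components under coordinate reflections\<close>

definition reflect :: "'n \<Rightarrow> real ^ 'n \<Rightarrow> real ^ 'n" where
  "reflect i x = (\<chi> j. if j = i then - x $ j else x $ j)"

lemma norm_reflect [simp]: "norm (reflect i x) = norm x"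
  unfolding norm_vec_def L2_set_def by (intro arg_cong[where f=sqrt] sum.cong) (auto simp: reflect_def)

lemma reflect_scaleR: "reflect i (c *\<^sub>R x) = c *\<^sub>R reflect i x"
  by (simp add: reflect_def vec_eq_iff)

lemma partial_deriv_reflect:
  fixes f :: "real ^ 'n \<Rightarrow> real"
  assumes f: "real_polynomial_function f"
  shows "partial_deriv j (\<lambda>x. f (reflect i x)) = (\<lambda>x. (if j = i then -1 else 1) * partial_deriv j f (reflect i x))"
proof (rule ext, rule partial_derivI)
  fix x
  define s :: real where "s = (if j = i then -1 else 1)"
  have "reflect i (x + t *\<^sub>R axis j 1) = reflect i x + (s * t) *\<^sub>R axis j 1" for t
    by (auto simp: s_def reflect_def vec_eq_iff axis_def)
  moreover have "((\<lambda>t. f (reflect i x + (s * t) *\<^sub>R axis j 1)) has_field_derivative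
      partial_deriv j f (reflect i x + (s * 0) *\<^sub>R axis j 1) * s) (at 0)"
    by (rule DERIV_chain2[OF partial_deriv_DERIV[OF f]]) (auto intro!: derivative_eq_intros)
  ultimately show "((\<lambda>t. f (reflect i (x + t *\<^sub>R axis j 1))) has_field_derivative
      (if j = i then -1 else 1) * partial_deriv j f (reflect i x)) (at 0)"
    by (simp add: s_def split: if_splits)
qed

text \<open>A reflection puts a sign on the i-th partial derivative, and the Laplacian takes that
  derivative twice.\<close>

lemma harmonic_homogeneous_reflect:
  fixes f :: "real ^ 'n \<Rightarrow> real"
  assumes "harmonic_homogeneous n f"
  shows "harmonic_homogeneous n (\<lambda>x. f (reflect i x))"
proof -
  have f: "real_polynomial_function f" using assms by (simp add: harmonic_homogeneous_def)
  have lin: "polynomial_function (reflect i)"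
    by (intro polynomial_function_bounded_linear linear_conv_bounded_linear[THEN iffD1] linearI)
       (auto simp: reflect_def vec_eq_iff)
  have P: "real_polynomial_function (\<lambda>x. g (reflect i x))" if "real_polynomial_function g" for g :: "_ \<Rightarrow> real"
    using real_polynomial_function_compose[OF lin that] by (simp add: o_def)
  have "laplacian (\<lambda>x. f (reflect i x)) x = laplacian f (reflect i x)" for x
    unfolding laplacian_def using f
    by (auto intro!: sum.cong simp: partial_deriv_reflect partial_deriv_cmult P real_polynomial_function_partial_deriv)
  with assms P[OF f] show ?thesis
    by (auto simp: harmonic_homogeneous_def homogeneous_of_degree_def reflect_scaleR)
qed

text \<open>The monomial is odd in a coordinate with odd exponent, hence so is each component; but a
  constant component is even.\<close>
lemma harmonic_part_0_eq_0:
  fixes \<alpha> :: "nat ^ 'n"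
  assumes "\<not> (\<forall>j. even (\<alpha> $ j))" "k \<le> mi_abs \<alpha> div 2"
  shows "harmonic_part k \<alpha> 0 = 0"
proof -
  obtain i where i: "odd (\<alpha> $ i)" using assms by blast
  \<comment> \<open>Reflecting and negating every component gives a second decomposition of the same
    monomial, which is odd in coordinate i; uniqueness then yields h(0) = - h(0).\<close>
  let ?h = "\<lambda>k x. (-1) * harmonic_part k \<alpha> (reflect i x)"
  have "mi_pow (reflect i y) \<alpha> = - mi_pow y \<alpha>" for y
    using i by (simp add: mi_pow_def reflect_def prod.remove[of UNIV i] cong: prod.cong_simp)
  hence "mi_pow y \<alpha> = (\<Sum>k\<le>mi_abs \<alpha> div 2. norm y ^ (2 * k) * ?h k y)" for y
    using harmonic_decomposition_harmonic_part[of \<alpha>, unfolded harmonic_decomposition_alt, THEN conjunct2, rule_format, of "reflect i y"]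
    by (simp add: sum_negf)
  moreover have "harmonic_homogeneous (mi_abs \<alpha> - 2 * k) (?h k)" if "k \<le> mi_abs \<alpha> div 2" for k
    by (rule harmonic_homogeneous_cmult[OF harmonic_homogeneous_reflect[OF harmonic_homogeneous_harmonic_part[OF that]]])
  ultimately have "harmonic_decomposition \<alpha> ?h"
    unfolding harmonic_decomposition_alt by blast
  from harmonic_part_eqI[OF this assms(2)] have "harmonic_part k \<alpha> 0 = - harmonic_part k \<alpha> (reflect i 0)"
    by (metis mult_minus1)
  also have "reflect i 0 = 0" by (simp add: reflect_def vec_eq_iff)
  finally show ?thesis by simp
qed

section \<open>Product integrals and linear change of variables\<close>

lemma Basis_vec_real: "(Basis :: (real ^ 'n) set) = (\<lambda>j. axis j 1) ` UNIV"
  by (auto simp: Basis_vec_def)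

lemma inj_axis: "inj (\<lambda>j. axis j (1::real))"
  by (auto simp: inj_on_def axis_eq_axis)

lemma sum_Basis_nth:
  fixes g :: "real ^ 'n \<Rightarrow> real"
  shows "(\<Sum>b\<in>Basis. g b *\<^sub>R b) $ j = g (axis j 1)"
  unfolding cart_eq_inner_axis by (rule inner_sum_left_Basis) (simp add: Basis_vec_real)

text \<open>Lebesgue measure on vectors is the image of a product measure indexed by
  \<open>Basis\<close>, so the factors must be relabelled from coordinates to basis vectors;
  \<open>idx\<close> undoes \<open>axis\<close>.\<close>

lemma integral_prod_nth:
  fixes f :: "'n::finite \<Rightarrow> real \<Rightarrow> complex"
  assumes f: "\<And>j. integrable lborel (f j)"
  shows "(\<integral>x. (\<Prod>j\<in>UNIV. f j (x $ j)) \<partial>(lborel :: (real ^ 'n) measure)) = (\<Prod>j\<in>UNIV. \<integral>t. f j t \<partial>lborel)"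
proof -
  interpret product_sigma_finite "\<lambda>_::real^'n. lborel :: real measure" ..
  define idx :: "real ^ 'n \<Rightarrow> 'n" where "idx = the_inv (\<lambda>j. axis j 1)"
  have idx [simp]: "idx (axis j 1) = j" for j
    unfolding idx_def by (rule the_inv_f_f[OF inj_axis])
  have [measurable]: "f j \<in> borel_measurable borel" for j
    using f[of j] by (simp add: integrable_iff_bounded)
  have m: "(\<lambda>x::real^'n. \<Prod>j\<in>UNIV. f j (x $ j)) \<in> borel_measurable borel"
    by measurable
  have eq: "(\<Prod>j\<in>UNIV. f j ((\<Sum>b\<in>Basis. g b *\<^sub>R b) $ j)) = (\<Prod>b\<in>Basis. f (idx b) (g b))" for g
    unfolding sum_Basis_nth unfolding Basis_vec_real by (subst prod.reindex[OF inj_axis]) simp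
  have m2: "(\<lambda>g. \<Sum>b\<in>Basis. g b *\<^sub>R b :: real^'n) \<in> (\<Pi>\<^sub>M b\<in>Basis. lborel) \<rightarrow>\<^sub>M borel"
    by measurable
  have "(\<integral>x. (\<Prod>j\<in>UNIV. f j (x $ j)) \<partial>(lborel :: (real ^ 'n) measure)) =
        (\<Prod>b\<in>Basis. \<integral>t. f (idx b) t \<partial>lborel)"
    unfolding lborel_eq[where 'a="real^'n"] integral_distr[OF m2 m] eq
    by (rule product_integral_prod) (use f in auto)
  also have "\<dots> = (\<Prod>j\<in>UNIV. \<integral>t. f j t \<partial>lborel)"
    unfolding Basis_vec_real by (subst prod.reindex[OF inj_axis]) simp
  finally show "(\<integral>x. (\<Prod>j\<in>UNIV. f j (x $ j)) \<partial>(lborel :: (real ^ 'n) measure)) = (\<Prod>j\<in>UNIV. \<integral>t. f j t \<partial>lborel)" .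
qed

section \<open>Lebesgue measure under invertible linear maps\<close>

lemma measurable_matrix_vector_mult [measurable]:
  "(\<lambda>x. (A :: real ^ 'n ^ 'm) *v x) \<in> borel_measurable borel"
  by (intro borel_measurable_continuous_onI linear_continuous_on matrix_vector_mul_bounded_linear)

text \<open>Fix all coordinates but the m-th: on the remaining line the shear is a translation, by
  an amount that depends on the n-th coordinate only. Integrating along that line first reduces the
  claim to translation invariance in one dimension.\<close>

lemma emeasure_vimage_shear:
  fixes m n :: "'n::finite" and c :: real
  assumes "m \<noteq> n" and S: "S \<in> sets borel"
  shows "emeasure lborel ((\<lambda>x::real^'n. x + (c * x $ n) *\<^sub>R axis m 1) -` S) = emeasure lborel S"
proof -
  interpret product_sigma_finite "\<lambda>_::real^'n. lborel :: real measure" ..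
  define T where "T = (\<lambda>x::real^'n. x + (c * x $ n) *\<^sub>R axis m 1)"
  define E where "E = (\<lambda>g. \<Sum>b\<in>Basis. g b *\<^sub>R b :: real^'n)"
  define I where "I = (Basis :: (real^'n) set) - {axis m 1}"
  have I: "finite I" "axis m 1 \<notin> I" "insert (axis m 1) I = Basis"
    by (auto simp: I_def Basis_vec_real)
  have [measurable]: "E \<in> (\<Pi>\<^sub>M b\<in>Basis. lborel) \<rightarrow>\<^sub>M borel" "T \<in> borel \<rightarrow>\<^sub>M borel"
    unfolding E_def T_def by measurable
  have [measurable]: "S \<in> sets borel" by fact
  have *: "integral\<^sup>N lborel f = (\<integral>\<^sup>+x. (\<integral>\<^sup>+t. f (E (x(axis m 1 := t))) \<partial>lborel) \<partial>(\<Pi>\<^sub>M b\<in>I. lborel))"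
    if [measurable]: "f \<in> borel_measurable borel" for f :: "real^'n \<Rightarrow> ennreal"
  proof -
    have "integral\<^sup>N lborel f = (\<integral>\<^sup>+x. f (E x) \<partial>(\<Pi>\<^sub>M b\<in>Basis. lborel))"
      unfolding lborel_eq[where 'a="real^'n"] E_def[symmetric] by (rule nn_integral_distr) measurable
    also have "\<dots> = (\<integral>\<^sup>+x. (\<integral>\<^sup>+t. f (E (x(axis m 1 := t))) \<partial>lborel) \<partial>(\<Pi>\<^sub>M b\<in>I. lborel))"
      unfolding I(3)[symmetric] by (rule product_nn_integral_insert[OF I(1,2)]) (simp add: I(3))
    finally show ?thesis .
  qed
  have ET: "T (E (x(axis m 1 := t))) = E (x(axis m 1 := c * x (axis n 1) + 1 * t))" for x t
  proof -
    have E: "E g $ j = g (axis j 1)" for g j unfolding E_def by (rule sum_Basis_nth)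
    have ax: "axis m (1::real) $ j = (if j = m then 1 else 0)" for j by (simp add: axis_def)
    show ?thesis
      unfolding T_def vec_eq_iff vector_add_component vector_scaleR_component E ax
      using assms(1) by (auto simp: axis_eq_axis)
  qed
  have upd: "(\<lambda>t. E (x(axis m 1 := t))) \<in> borel \<rightarrow>\<^sub>M borel" if "x \<in> space (\<Pi>\<^sub>M b\<in>I. lborel)" for x
  proof -
    have "E (x(axis m 1 := t)) = (\<Sum>b\<in>I. x b *\<^sub>R b) + t *\<^sub>R axis m 1" for t
    proof -
      have "E (x(axis m 1 := t)) = (\<Sum>b\<in>insert (axis m 1) I. (x(axis m 1 := t)) b *\<^sub>R b)"
        unfolding E_def I(3) ..
      also have "\<dots> = t *\<^sub>R axis m 1 + (\<Sum>b\<in>I. (x(axis m 1 := t)) b *\<^sub>R b)"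
        using I(1,2) by simp
      also have "(\<Sum>b\<in>I. (x(axis m 1 := t)) b *\<^sub>R b) = (\<Sum>b\<in>I. x b *\<^sub>R b)"
        using I(2) by (intro sum.cong) auto
      finally show ?thesis by (simp only: add.commute)
    qed
    thus ?thesis by simp
  qed
  have "emeasure lborel (T -` S) = (\<integral>\<^sup>+x. indicator S (T x) \<partial>lborel)"
  proof -
    have "T -` S \<in> sets borel" using S by (intro measurable_sets_borel[of T borel]) auto
    hence "emeasure lborel (T -` S) = (\<integral>\<^sup>+x. indicator (T -` S) x \<partial>lborel)" by simp
    also have "\<dots> = (\<integral>\<^sup>+x. indicator S (T x) \<partial>lborel)"
      by (rule nn_integral_cong) (simp split: split_indicator)
    finally show ?thesis .
  qed
  also have "\<dots> = (\<integral>\<^sup>+x. (\<integral>\<^sup>+t. indicator S (T (E (x(axis m 1 := t)))) \<partial>lborel) \<partial>(\<Pi>\<^sub>M b\<in>I. lborel))"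
    by (rule *) measurable
  also have "\<dots> = (\<integral>\<^sup>+x. (\<integral>\<^sup>+t. indicator S (E (x(axis m 1 := t))) \<partial>lborel) \<partial>(\<Pi>\<^sub>M b\<in>I. lborel))"
  proof (rule nn_integral_cong)
    fix x :: "real^'n \<Rightarrow> real" assume x: "x \<in> space (\<Pi>\<^sub>M b\<in>I. lborel)"
    have [measurable]: "(\<lambda>t. indicator S (E (x(axis m 1 := t))) :: ennreal) \<in> borel_measurable borel"
      using upd[OF x] by measurable
    show "(\<integral>\<^sup>+t. indicator S (T (E (x(axis m 1 := t)))) \<partial>lborel) = (\<integral>\<^sup>+t. indicator S (E (x(axis m 1 := t))) \<partial>lborel)"
      unfolding ET using nn_integral_real_affine[of "\<lambda>t. indicator S (E (x(axis m 1 := t)))" 1 "c * x (axis n 1)"]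
      by simp
  qed
  also have "\<dots> = (\<integral>\<^sup>+x. indicator S x \<partial>lborel)"
    by (rule *[symmetric]) measurable
  also have "\<dots> = emeasure lborel S" by simp
  finally show ?thesis by (simp add: T_def)
qed

lemma emeasure_vimage_diagonal:
  fixes A :: "real ^ 'n ^ 'n"
  assumes A: "\<And>i j. i \<noteq> j \<Longrightarrow> A $ i $ j = 0" and "det A \<noteq> 0" and S: "S \<in> sets borel"
  shows "emeasure lborel S = ennreal \<bar>det A\<bar> * emeasure lborel ((*v) A -` S)"
proof -
  have d: "det A = (\<Prod>i\<in>UNIV. A $ i $ i)" using A by (rule det_diagonal)
  define c where "c = (\<lambda>b. b \<bullet> (A *v b))"
  have comp: "(A *v x) $ i = A $ i $ i * x $ i" for x i
  proof -
    have "(\<Sum>j\<in>UNIV. A $ i $ j * x $ j) = (\<Sum>j\<in>UNIV. if j = i then A $ i $ i * x $ i else 0)"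
      by (rule sum.cong) (auto simp: A)
    thus ?thesis by (simp add: matrix_vector_mult_def)
  qed
  have c: "c (axis i 1) = A $ i $ i" for i
    by (simp add: c_def inner_commute[of "axis i 1"] comp flip: cart_eq_inner_axis)
  have eq: "(\<lambda>x. 0 + (\<Sum>b\<in>Basis. (c b * (x \<bullet> b)) *\<^sub>R b)) = (*v) A"
    unfolding fun_eq_iff vec_eq_iff vector_add_component zero_index sum_Basis_nth c comp
    by (simp flip: cart_eq_inner_axis)
  have nz: "c b \<noteq> 0" if "b \<in> Basis" for b
    using that assms(2) by (auto simp: Basis_vec_real c d)
  have "(\<Prod>b\<in>Basis. \<bar>c b\<bar>) = \<bar>det A\<bar>"
    unfolding Basis_vec_real d abs_prod by (subst prod.reindex[OF inj_axis]) (simp add: c)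
  hence "lborel = density (distr lborel borel ((*v) A)) (\<lambda>_. ennreal \<bar>det A\<bar>)"
    using lborel_affine_euclidean[where c=c and t=0, OF nz] unfolding eq by simp
  hence "emeasure lborel S = emeasure (density (distr lborel borel ((*v) A)) (\<lambda>_. ennreal \<bar>det A\<bar>)) S"
    by simp
  also have "\<dots> = ennreal \<bar>det A\<bar> * emeasure lborel ((*v) A -` S)"
    using S by (subst emeasure_density) (auto simp: emeasure_distr nn_integral_cmult_indicator)
  finally show ?thesis .
qed

text \<open>Boxes go to boxes with the same side lengths in another order, and the volumes of boxes
  determine Lebesgue measure.\<close>

lemma emeasure_vimage_swap:
  fixes P :: "real ^ 'n ^ 'n"
  assumes P: "P = (\<chi> i j. mat 1 $ i $ Transposition.transpose m n j)" and S: "S \<in> sets borel"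
  shows "emeasure lborel S = ennreal \<bar>det P\<bar> * emeasure lborel ((*v) P -` S)"
proof -
  let ?t = "Transposition.transpose m n"
  have comp: "(P *v x) $ i = x $ ?t i" for x i
  proof -
    have "(\<Sum>j\<in>UNIV. P $ i $ j * x $ j) = (\<Sum>j\<in>UNIV. if j = ?t i then x $ j else 0)"
      by (rule sum.cong) (auto simp: P mat_def)
    thus ?thesis by (simp add: matrix_vector_mult_def)
  qed
  \<comment> \<open>An involution has determinant 1 or -1.\<close>
  have "(P ** P) *v x = mat 1 *v x" for x
    by (simp add: matrix_vector_mul_assoc[symmetric] vec_eq_iff comp)
  hence "P ** P = mat 1" unfolding matrix_eq by blast
  hence "det P * det P = 1" by (metis det_mul det_I)
  hence d: "\<bar>det P\<bar> = 1" by (metis abs_mult abs_mult_self_eq abs_one mult_cancel_right1 abs_eq_0 power2_eq_1_iff power2_eq_square abs_minus_cancel)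
  have bij: "bij ?t" by simp
  have "lborel = distr lborel borel ((*v) P)"
  proof (rule lborel_eqI)
    fix l u :: "real^'n"
    assume le: "\<And>b. b \<in> Basis \<Longrightarrow> l \<bullet> b \<le> u \<bullet> b"
    hence le': "l $ i \<le> u $ i" for i
      by (simp add: cart_eq_inner_axis Basis_vec_real)
    have pr: "(\<Prod>b\<in>Basis. v \<bullet> b) = (\<Prod>i\<in>UNIV. v $ i)" for v :: "real^'n"
      unfolding Basis_vec_real by (subst prod.reindex[OF inj_axis]) (simp add: cart_eq_inner_axis)
    have "(*v) P -` box l u = box (P *v l) (P *v u)"
    proof (intro set_eqI iffI)
      fix x assume "x \<in> (*v) P -` box l u"
      hence *: "l $ i < x $ ?t i \<and> x $ ?t i < u $ i" for i by (auto simp: mem_box_cart comp)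
      show "x \<in> box (P *v l) (P *v u)" unfolding mem_box_cart comp
      proof
        fix i show "l $ ?t i < x $ i \<and> x $ i < u $ ?t i" using *[of "?t i"] by simp
      qed
    next
      fix x assume "x \<in> box (P *v l) (P *v u)"
      hence *: "l $ ?t i < x $ i \<and> x $ i < u $ ?t i" for i by (auto simp: mem_box_cart comp)
      have "l $ i < x $ ?t i \<and> x $ ?t i < u $ i" for i using *[of "?t i"] by simp
      thus "x \<in> (*v) P -` box l u" by (simp add: mem_box_cart comp)
    qed
    hence "emeasure (distr lborel borel ((*v) P)) (box l u) = emeasure lborel (box (P *v l) (P *v u))"
      by (simp add: emeasure_distr)
    also have "\<dots> = (\<Prod>b\<in>Basis. (P *v u - P *v l) \<bullet> b)"
      by (rule emeasure_lborel_box) (use le' in \<open>auto simp: Basis_vec_real comp simp flip: cart_eq_inner_axis\<close>)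
    also have "\<dots> = (\<Prod>i\<in>UNIV. (u - l) $ ?t i)" unfolding pr by (simp add: comp)
    also have "\<dots> = (\<Prod>i\<in>UNIV. (u - l) $ i)"
      by (rule arg_cong[where f=ennreal], rule prod.reindex_bij_betw[OF bij])
    also have "\<dots> = (\<Prod>b\<in>Basis. (u - l) \<bullet> b)" unfolding pr ..
    finally show "emeasure (distr lborel borel ((*v) P)) (box l u) = (\<Prod>b\<in>Basis. (u - l) \<bullet> b)" .
  qed simp
  hence "emeasure lborel S = emeasure (distr lborel borel ((*v) P)) S" by simp
  also have "\<dots> = emeasure lborel ((*v) P -` S)" using S by (simp add: emeasure_distr)
  finally show ?thesis by (simp add: d)
qed

text \<open>The library's change of variables formula needs a well-ordered index type; this version does not.\<close>
lemma emeasure_vimage_matrix: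
  fixes A :: "real ^ 'n ^ 'n"
  assumes "det A \<noteq> 0" "S \<in> sets borel"
  shows "emeasure lborel S = ennreal \<bar>det A\<bar> * emeasure lborel ((*v) A -` S)"
proof -
  \<comment> \<open>Keeping the determinant condition inside the induction makes the zero-row
    generator vacuous, and the multiplicativity of det passes the condition to both factors of a
    product.\<close>
  have "\<forall>S\<in>sets borel. det A \<noteq> 0 \<longrightarrow> emeasure lborel S = ennreal \<bar>det A\<bar> * emeasure lborel ((*v) A -` S)"
  proof (rule induct_matrix_elementary[of _ A], goal_cases)
    case (1 A B)
    show ?case
    proof safe
      fix S :: "(real^'n) set" assume S: "S \<in> sets borel" and "det (A ** B) \<noteq> 0"
      hence d: "det A \<noteq> 0" "det B \<noteq> 0" by (auto simp: det_mul)
      have S': "(*v) A -` S \<in> sets borel" using S by (intro measurable_sets_borel[of _ borel]) auto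
      have "emeasure lborel S = ennreal \<bar>det A\<bar> * emeasure lborel ((*v) A -` S)" using 1 d S by blast
      also have "emeasure lborel ((*v) A -` S) = ennreal \<bar>det B\<bar> * emeasure lborel ((*v) B -` ((*v) A -` S))"
        using 1 d S' by blast
      also have "(*v) B -` ((*v) A -` S) = (*v) (A ** B) -` S"
        by (auto simp: matrix_vector_mul_assoc)
      finally show "emeasure lborel S = ennreal \<bar>det (A ** B)\<bar> * emeasure lborel ((*v) (A ** B) -` S)"
        by (simp add: det_mul abs_mult ennreal_mult mult.assoc)
    qed
  next
    case (2 A i)
    thus ?case by (simp add: det_zero_row)
  next
    case (3 A)
    thus ?case using emeasure_vimage_diagonal by blast
  next
    case (4 m n)
    thus ?case using emeasure_vimage_swap[OF refl] by blast
  next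
    case (5 m n c)
    let ?M = "(\<chi> i j. if i = m \<and> j = n then c else of_bool (i = j)) :: real^'n^'n"
    have "?M = (\<chi> k. if k = m then row m (mat 1) + c *s row n (mat 1) else row k (mat 1))"
      using 5 by (auto simp: vec_eq_iff row_def mat_def)
    hence d: "det ?M = 1" using det_row_operation[OF 5, of "mat 1" c] by simp
    have "?M *v x = x + (c * x $ n) *\<^sub>R axis m 1" for x
    proof -
      have "(?M *v x) $ i = (\<Sum>j\<in>UNIV. (if j = i then x $ j else 0) + (if j = n then (if i = m then c * x $ j else 0) else 0))" for i
        unfolding matrix_vector_mult_def using 5 by (auto intro!: sum.cong)
      hence "(?M *v x) $ i = x $ i + (if i = m then c * x $ n else 0)" for i
        by (simp add: sum.distrib)
      thus ?thesis by (simp add: vec_eq_iff axis_def)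
    qed
    hence "(*v) ?M = (\<lambda>x. x + (c * x $ n) *\<^sub>R axis m 1)" by (rule ext)
    thus ?case unfolding d using emeasure_vimage_shear[OF 5, of _ c] by simp
  qed
  with assms show ?thesis by blast
qed

lemma lborel_eq_density_matrix:
  fixes A :: "real ^ 'n ^ 'n"
  assumes "det A \<noteq> 0"
  shows "lborel = density (distr lborel borel ((*v) A)) (\<lambda>_. ennreal \<bar>det A\<bar>)"
proof (rule measure_eqI)
  fix S :: "(real^'n) set" assume "S \<in> sets lborel"
  hence S: "S \<in> sets borel" by simp
  show "emeasure lborel S = emeasure (density (distr lborel borel ((*v) A)) (\<lambda>_. ennreal \<bar>det A\<bar>)) S"
    using S emeasure_vimage_matrix[OF assms S]
    by (subst emeasure_density) (auto simp: emeasure_distr nn_integral_cmult_indicator)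
qed simp

lemma integral_matrix_vector:
  fixes A :: "real ^ 'n ^ 'n" and f :: "real ^ 'n \<Rightarrow> complex"
  assumes "det A \<noteq> 0" and f [measurable]: "f \<in> borel_measurable borel"
  shows "(\<integral>x. f (A *v x) \<partial>lborel) = (\<integral>x. f x \<partial>lborel) / of_real \<bar>det A\<bar>"
proof -
  have "(\<integral>x. f x \<partial>lborel) = (\<integral>x. \<bar>det A\<bar> *\<^sub>R f x \<partial>distr lborel borel ((*v) A))"
    by (subst lborel_eq_density_matrix[OF assms(1)], subst integral_density) auto
  also have "\<dots> = \<bar>det A\<bar> *\<^sub>R (\<integral>x. f (A *v x) \<partial>lborel)"
    by (subst integral_distr) auto
  finally show "(\<integral>x. f (A *v x) \<partial>lborel) = (\<integral>x. f x \<partial>lborel) / of_real \<bar>det A\<bar>"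
    using assms(1) by (simp add: scaleR_conv_of_real)
qed

section \<open>Lattice sums\<close>

definition int_vec :: "(real ^ 'n) set" where
  "int_vec = {m. \<forall>j. m $ j \<in> \<int>}"

lemma lattice_of_int_vec: "lattice_of A = (\<lambda>m. A *v m) ` int_vec"
  by (auto simp: lattice_of_def int_vec_def)

lemma matrix_inv_mult_vector:
  fixes A :: "real ^ 'n ^ 'n"
  assumes "invertible A"
  shows "matrix_inv A *v (A *v m) = m" "A *v (matrix_inv A *v m) = m"
  using someI_ex[OF assms[unfolded invertible_def]]
  by (simp_all add: matrix_vector_mul_assoc matrix_inv_def)

lemma summable_on_Ints_powr:
  fixes p :: real
  assumes "p > 1"
  shows "(\<lambda>t. (1 + \<bar>t\<bar>) powr (-p)) summable_on (\<int> :: real set)"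
proof -
  let ?f = "\<lambda>t::real. (1 + \<bar>t\<bar>) powr (-p)"
  have "summable (\<lambda>n. of_nat (Suc n) powr (-p) :: real)"
    using assms by (subst summable_Suc_iff) (simp add: summable_real_powr_iff)
  hence *: "(\<lambda>n::nat. (1 + real n) powr (-p)) summable_on UNIV"
    by (subst summable_on_UNIV_nonneg_real_iff) (auto simp: add_ac)
  have 1: "?f summable_on (range (\<lambda>n::nat. real n))"
    using * by (subst summable_on_reindex) (auto simp: inj_on_def o_def)
  have 2: "?f summable_on (range (\<lambda>n::nat. - real n))"
    using * by (subst summable_on_reindex) (auto simp: inj_on_def o_def)
  have "(\<int> :: real set) = range (\<lambda>n::nat. real n) \<union> range (\<lambda>n::nat. - real n)"
  proof (intro equalityI subsetI)
    fix x :: real assume "x \<in> \<int>"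
    then obtain n where n: "x = of_int n" by (auto elim: Ints_cases)
    show "x \<in> range (\<lambda>n::nat. real n) \<union> range (\<lambda>n::nat. - real n)"
    proof (cases "n \<ge> 0")
      case True
      hence "x = real (nat n)" using n by simp
      thus ?thesis by blast
    next
      case False
      hence "x = - real (nat (-n))" using n by simp
      thus ?thesis by blast
    qed
  qed auto
  thus ?thesis using summable_on_union[OF 1 2] by simp
qed

text \<open>A finite set of integer vectors lies in a finite box, over which the sum of products is
  a product of one-dimensional sums, each at most the full sum over \<open>\<int>\<close>.\<close>

lemma summable_on_int_vec_prod:
  fixes f :: "real \<Rightarrow> real"
  assumes f: "f summable_on \<int>" and nonneg: "\<And>t. f t \<ge> 0"
  shows "(\<lambda>m::real^'n. \<Prod>j\<in>UNIV. f (m $ j)) summable_on int_vec"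
proof (rule nonneg_bdd_above_summable_on)
  show "bdd_above (sum (\<lambda>m::real^'n. \<Prod>j\<in>UNIV. f (m $ j)) ` {F. F \<subseteq> int_vec \<and> finite F})"
  proof (rule bdd_aboveI2)
    fix F :: "(real^'n) set" assume "F \<in> {F. F \<subseteq> int_vec \<and> finite F}"
    hence F: "F \<subseteq> int_vec" "finite F" by auto
    define B where "B = (\<lambda>j::'n. (\<lambda>m. m $ j) ` F)"
    have B: "finite (B j)" "B j \<subseteq> \<int>" for j using F by (auto simp: B_def int_vec_def)
    have "(\<Sum>m\<in>F. \<Prod>j\<in>UNIV. f (m $ j)) = (\<Sum>g\<in>vec_nth ` F. \<Prod>j\<in>UNIV. f (g j))"
      by (subst sum.reindex) (auto simp: inj_on_def vec_eq_iff fun_eq_iff)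
    also have "\<dots> \<le> (\<Sum>g\<in>Pi\<^sub>E UNIV B. \<Prod>j\<in>UNIV. f (g j))"
    proof (rule sum_mono2)
      show "finite (Pi\<^sub>E UNIV B)" by (rule finite_PiE) (auto intro: B)
    qed (auto intro!: prod_nonneg nonneg simp: B_def)
    also have "\<dots> = (\<Prod>j\<in>(UNIV::'n set). \<Sum>t\<in>B j. f t)"
      by (rule prod_sum_PiE[symmetric]) (auto intro: B)
    also have "\<dots> \<le> (\<Prod>j\<in>(UNIV::'n set). infsum f \<int>)"
      by (intro prod_mono conjI sum_nonneg nonneg finite_sum_le_infsum f B)
    finally show "(\<Sum>m\<in>F. \<Prod>j\<in>UNIV. f (m $ j)) \<le> (\<Prod>j\<in>(UNIV::'n set). infsum f \<int>)" .
  qed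
qed (auto intro: prod_nonneg nonneg)

text \<open>Since A has a bounded inverse, each 1 + |m_j| is at most a constant times 1 + |A m + v|.
  Giving each of the d coordinates the share \<sigma> / d of the exponent turns decay in the norm
  into a product. Uniformity over |v| \<le> R serves the locally uniform convergence of
  periodisations.\<close>

lemma lattice_powr_bound:
  fixes A :: "real ^ 'n ^ 'n" and \<sigma> :: real
  assumes A: "invertible A" and "\<sigma> \<ge> 0"
  shows "\<exists>C\<ge>0. \<forall>m v. norm v \<le> R \<longrightarrow>
    (1 + norm (A *v m + v)) powr (-\<sigma>) \<le> C * (\<Prod>j\<in>UNIV. (1 + \<bar>m $ j\<bar>) powr (-(\<sigma> / CARD('n))))"
proof -
  define B where "B = matrix_inv A"
  have BA: "B *v (A *v m) = m" for m
    using A by (simp add: B_def matrix_inv_mult_vector)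
  obtain K where K: "K > 0" "\<And>w. norm (B *v w) \<le> norm w * K"
    using bounded_linear.pos_bounded[OF matrix_vector_mul_bounded_linear[of B]] by auto
  \<comment> \<open>With N = 1 + |A m + v| one has |m_j| \<le> K (N - 1 + |R|), and \<open>c\<close>
    is large enough for 1 + |m_j| \<le> c N when N \<ge> 1. The absolute value keeps
    \<open>c\<close> positive for negative R.\<close>
  define c where "c = 1 + K + K * \<bar>R\<bar>"
  have c: "c > 0" using K by (simp add: c_def add_pos_nonneg)
  show ?thesis
  proof (intro exI[of _ "c powr \<sigma>"] conjI allI impI)
    fix m v :: "real^'n" assume v: "norm v \<le> R"
    define N where "N = 1 + norm (A *v m + v)"
    have N: "N \<ge> 1" by (simp add: N_def)
    have comp: "1 + \<bar>m $ j\<bar> \<le> c * N" for j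
    proof -
      have "\<bar>m $ j\<bar> \<le> norm m" by (rule component_le_norm_cart)
      also have "\<dots> \<le> norm (A *v m) * K" using K(2)[of "A *v m"] by (simp add: BA)
      also have "norm (A *v m) \<le> (N - 1) + \<bar>R\<bar>"
        using norm_triangle_ineq4[of "A *v m + v" v] v by (simp add: N_def)
      finally have "\<bar>m $ j\<bar> \<le> ((N - 1) + \<bar>R\<bar>) * K" using K by (simp add: mult_right_mono)
      moreover have "c * N = N + K * N + K * \<bar>R\<bar> * N" by (simp add: c_def algebra_simps)
      moreover have "K * \<bar>R\<bar> * 1 \<le> K * \<bar>R\<bar> * N" using N K by (intro mult_left_mono) auto
      moreover have "((N - 1) + \<bar>R\<bar>) * K = K * N - K + K * \<bar>R\<bar>" by (simp add: algebra_simps)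
      ultimately show ?thesis using N K(1) by linarith
    qed
    have "N powr (-\<sigma>) = c powr \<sigma> * (c * N) powr (-\<sigma>)"
      using c N by (simp add: powr_mult powr_minus field_simps)
    also have "(c * N) powr (-\<sigma>) = (\<Prod>j\<in>(UNIV::'n set). (c * N) powr (-(\<sigma> / CARD('n))))"
    proof -
      have "(\<Prod>j\<in>(UNIV::'n set). (c * N) powr (-(\<sigma> / CARD('n)))) = ((c * N) powr (-(\<sigma> / CARD('n)))) ^ CARD('n)"
        by simp
      also have "\<dots> = ((c * N) powr (-(\<sigma> / CARD('n)))) powr real CARD('n)"
        using c N by (subst powr_realpow) auto
      also have "\<dots> = (c * N) powr (-\<sigma>)"
        by (simp add: powr_powr)
      finally show ?thesis ..
    qed
    also have "\<dots> \<le> (\<Prod>j\<in>UNIV. (1 + \<bar>m $ j\<bar>) powr (-(\<sigma> / CARD('n))))"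
      using comp \<open>\<sigma> \<ge> 0\<close> by (intro prod_mono conjI powr_mono2') auto
    finally show "N powr (-\<sigma>) \<le> c powr \<sigma> * (\<Prod>j\<in>UNIV. (1 + \<bar>m $ j\<bar>) powr (-(\<sigma> / CARD('n))))"
      using c by (simp add: mult_left_mono)
  qed auto
qed

lemma lattice_summable:
  fixes A :: "real ^ 'n ^ 'n" and \<sigma> :: real
  assumes A: "invertible A" and \<sigma>: "\<sigma> > CARD('n)"
  shows "(\<lambda>m. (1 + norm (A *v m + v)) powr (-\<sigma>)) summable_on int_vec"
proof -
  obtain C where "C \<ge> 0" and C: "\<And>m. (1 + norm (A *v m + v)) powr (-\<sigma>) \<le> C * (\<Prod>j\<in>UNIV. (1 + \<bar>m $ j\<bar>) powr (-(\<sigma> / CARD('n))))"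
    using lattice_powr_bound[OF A, of \<sigma> "norm v"] \<sigma> by auto
  have "(\<lambda>m::real^'n. C * (\<Prod>j\<in>UNIV. (1 + \<bar>m $ j\<bar>) powr (-(\<sigma> / CARD('n))))) summable_on int_vec"
    using \<sigma> by (intro summable_on_cmult_right summable_on_int_vec_prod[of "\<lambda>t. (1 + \<bar>t\<bar>) powr (-(\<sigma> / CARD('n)))"] summable_on_Ints_powr) auto
  thus ?thesis by (rule summable_on_comparison_test) (use C in auto)
qed

text \<open>Each such element contributes at least c to a sum of finite value, so their number is
  bounded by the quotient. For lattice cosets this is the source of discreteness.\<close>

lemma finite_ge_of_summable_on:
  fixes f :: "'a \<Rightarrow> real"
  assumes f: "f summable_on S" and nonneg: "\<And>x. x \<in> S \<Longrightarrow> f x \<ge> 0" and "c > 0"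
  shows "finite {x \<in> S. f x \<ge> c}"
proof -
  have "card G \<le> nat \<lfloor>infsum f S / c\<rfloor>" if "G \<subseteq> {x \<in> S. f x \<ge> c}" "finite G" for G
  proof -
    have "card G * c = (\<Sum>x\<in>G. c)" by simp
    also have "\<dots> \<le> sum f G" using that by (intro sum_mono) auto
    also have "\<dots> \<le> infsum f S" using that by (intro finite_sum_le_infsum f nonneg) auto
    finally show ?thesis using \<open>c > 0\<close> by (simp add: le_nat_floor field_simps)
  qed
  thus ?thesis using finite_if_finite_subsets_card_bdd by blast
qed

text \<open>The only property of lattice cosets that the analytic arguments need.\<close>
definition zeta_summable :: "(real ^ 'n) set \<Rightarrow> bool" where
  "zeta_summable S \<longleftrightarrow> (\<forall>\<sigma> > real CARD('n). (\<lambda>z. norm z powr (-\<sigma>)) summable_on (S - {0}))"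

lemma zeta_summable_coset:
  fixes A :: "real ^ 'n ^ 'n"
  assumes A: "invertible A"
  shows "zeta_summable ((\<lambda>m. A *v m + v) ` int_vec)" (is "zeta_summable ?S")
  unfolding zeta_summable_def
proof (intro allI impI)
  fix \<sigma> :: real assume \<sigma>: "\<sigma> > CARD('n)"
  let ?f = "\<lambda>z. (1 + norm z) powr (-\<sigma>)"
  have inj: "inj_on (\<lambda>m. A *v m + v) int_vec"
  proof (rule inj_on_inverseI[where g="\<lambda>w. matrix_inv A *v (w - v)"])
    show "matrix_inv A *v (A *v m + v - v) = m" for m
      using A by (simp add: matrix_inv_mult_vector)
  qed
  have f: "?f summable_on ?S"
    using lattice_summable[OF A \<sigma>, of v] by (subst summable_on_reindex[OF inj]) (simp add: o_def)
  \<comment> \<open>Near the origin |z|^(-\<sigma>) is not bounded by a multiple of (1 +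
    |z|)^(-\<sigma>), so the unit ball is treated apart: each of its points contributes at least
    2^(-\<sigma>) to the convergent sum, hence there are only finitely many.\<close>
  have fin: "finite {z \<in> ?S. ?f z \<ge> 2 powr (-\<sigma>)}"
    by (rule finite_ge_of_summable_on[OF f]) auto
  have "?f z \<ge> 2 powr (-\<sigma>)" if "norm z \<le> 1" for z :: "real^'n"
    using that \<sigma> by (intro powr_mono2') (auto intro: add_pos_nonneg)
  hence fin2: "finite {z \<in> ?S - {0}. norm z \<le> 1}"
    by (intro finite_subset[OF _ fin]) auto
  have "(\<lambda>z. 2 powr \<sigma> * ?f z) summable_on ?S"
    by (intro summable_on_cmult_right f)
  hence "(\<lambda>z. 2 powr \<sigma> * ?f z) summable_on {z \<in> ?S - {0}. norm z > 1}"
    by (rule summable_on_subset_banach) auto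
  hence big: "(\<lambda>z. norm z powr (-\<sigma>)) summable_on {z \<in> ?S - {0}. norm z > 1}"
  proof (rule summable_on_comparison_test)
    fix z assume "z \<in> {z \<in> ?S - {0}. norm z > 1}"
    hence z: "norm z > 1" by auto
    have "norm z powr (-\<sigma>) = 2 powr \<sigma> * (2 * norm z) powr (-\<sigma>)"
      using z by (simp add: powr_mult powr_minus field_simps)
    also have "(2 * norm z) powr (-\<sigma>) \<le> ?f z"
      using z \<sigma> by (intro powr_mono2') auto
    finally show "norm z powr (-\<sigma>) \<le> 2 powr \<sigma> * ?f z" by simp
  qed auto
  have "?S - {0} = {z \<in> ?S - {0}. norm z > 1} \<union> {z \<in> ?S - {0}. norm z \<le> 1}" by auto
  from subst[OF this[symmetric], where P="\<lambda>X. (\<lambda>z. norm z powr (-\<sigma>)) summable_on X",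
      OF summable_on_union[OF big summable_on_finite[OF fin2]]]
  show "(\<lambda>z. norm z powr (-\<sigma>)) summable_on (?S - {0})" .
qed

section \<open>Poisson summation\<close>

text \<open>Summability of complex families is absolute, so it coincides with integrability for the
  counting measure, and otherwise both sides default to 0. This makes sums accessible to
  Fubini.\<close>

lemma infsum_eq_integral_count_space:
  fixes f :: "'a \<Rightarrow> complex"
  shows "infsum f I = (\<integral>i. f i \<partial>count_space I)"
proof (cases "f summable_on I")
  case True
  hence "(\<lambda>i. norm (f i)) summable_on I" by (simp add: summable_on_iff_abs_summable_on_complex)
  from infsetsum_infsum[OF abs_summable_equivalent[THEN iffD1, OF this]] show ?thesis by (simp add: infsetsum_def)
next
  case False
  hence "\<not> integrable (count_space I) f"
    unfolding summable_on_iff_abs_summable_on_complex abs_summable_equivalent abs_summable_on_def .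
  thus ?thesis using False by (simp add: infsum_not_exists not_integrable_integral_eq)
qed

text \<open>Fubini for the counting measure on I and M; countability of I gives sigma-finiteness and
  joint measurability. Every exchange of an infinite sum with an integral below goes through this
  pair.\<close>

lemma
  fixes f :: "'i \<Rightarrow> 'a \<Rightarrow> complex"
  assumes M: "sigma_finite_measure M" and I: "countable I"
    and int: "\<And>i. i \<in> I \<Longrightarrow> integrable M (f i)"
    and sum: "(\<lambda>i. \<integral>x. norm (f i x) \<partial>M) summable_on I"
  shows integrable_infsum: "integrable M (\<lambda>x. \<Sum>\<^sub>\<infinity>i\<in>I. f i x)"
    and integral_infsum: "(\<integral>x. (\<Sum>\<^sub>\<infinity>i\<in>I. f i x) \<partial>M) = (\<Sum>\<^sub>\<infinity>i\<in>I. \<integral>x. f i x \<partial>M)"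
proof -
  interpret sigma_finite_measure M by fact
  interpret C: sigma_finite_measure "count_space I"
    by (rule sigma_finite_measure_count_space_countable[OF I])
  interpret P: pair_sigma_finite "count_space I" M ..
  have "integrable (count_space I) (\<lambda>i. \<integral>x. norm (f i x) \<partial>M)"
    using sum by (simp add: abs_summable_equivalent[unfolded abs_summable_on_def, symmetric])
  hence int: "integrable (count_space I \<Otimes>\<^sub>M M) (case_prod f)"
    using int by (intro P.Fubini_integrable)
      (auto intro!: measurable_pair_measure_countable1 I AE_I2)
  show "integrable M (\<lambda>x. \<Sum>\<^sub>\<infinity>i\<in>I. f i x)"
    unfolding infsum_eq_integral_count_space by (rule P.integrable_snd[OF int])
  show "(\<integral>x. (\<Sum>\<^sub>\<infinity>i\<in>I. f i x) \<partial>M) = (\<Sum>\<^sub>\<infinity>i\<in>I. \<integral>x. f i x \<partial>M)"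
    unfolding infsum_eq_integral_count_space by (rule P.Fubini_integral[OF int])
qed

lemma
  fixes f :: "'a::euclidean_space \<Rightarrow> 'b::{banach, second_countable_topology}"
  assumes [measurable]: "f \<in> borel_measurable borel"
  shows integrable_translate: "integrable lborel (\<lambda>x. f (c + x)) \<longleftrightarrow> integrable lborel f"
    and integral_translate: "(\<integral>x. f (c + x) \<partial>lborel) = (\<integral>x. f x \<partial>lborel)"
proof -
  show "integrable lborel (\<lambda>x. f (c + x)) \<longleftrightarrow> integrable lborel f"
    using integrable_distr_eq[of "(+) c" lborel borel f] by (simp add: lborel_distr_plus)
  show "(\<integral>x. f (c + x) \<partial>lborel) = (\<integral>x. f x \<partial>lborel)"
    using integral_distr[of "(+) c" lborel borel f] by (simp add: lborel_distr_plus)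
qed

section \<open>The half-open unit cube as a fundamental domain of the integer lattice\<close>

definition unit_cube :: "(real ^ 'n) set" where
  "unit_cube = {x. \<forall>j. 0 \<le> x $ j \<and> x $ j < 1}"

lemma unit_cube_borel [measurable]: "unit_cube \<in> sets borel"
proof -
  have "{x \<in> space borel. \<forall>j. 0 \<le> x $ j \<and> x $ j < 1} \<in> sets (borel :: (real^'n) measure)"
    by measurable
  thus ?thesis by (simp add: unit_cube_def)
qed

lemma unit_cube_subset: "unit_cube \<subseteq> cbox 0 1"
  by (auto simp: unit_cube_def mem_box_cart less_imp_le)

lemma integrable_unit_cube:
  fixes f :: "real ^ 'n \<Rightarrow> complex"
  assumes "continuous_on UNIV f"
  shows "integrable lborel (\<lambda>x. indicator unit_cube x *\<^sub>R f x)"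
proof -
  have "integrable lborel (\<lambda>x. indicator unit_cube x *\<^sub>R (indicator (cbox 0 1) x *\<^sub>R f x))"
    by (intro integrable_mult_indicator borel_integrable_compact continuous_on_subset[OF assms]) auto
  also have "(\<lambda>x. indicator unit_cube x *\<^sub>R (indicator (cbox 0 1) x *\<^sub>R f x)) = (\<lambda>x. indicator unit_cube x *\<^sub>R f x)"
    using unit_cube_subset by (auto simp: indicator_def fun_eq_iff)
  finally show ?thesis .
qed

lemma int_vec_add: "m \<in> int_vec \<Longrightarrow> k \<in> int_vec \<Longrightarrow> m + k \<in> int_vec"
  and int_vec_minus: "m \<in> int_vec \<Longrightarrow> - m \<in> int_vec"
  and int_vec_diff: "m \<in> int_vec \<Longrightarrow> k \<in> int_vec \<Longrightarrow> m - k \<in> int_vec"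
  and int_vec_0: "0 \<in> int_vec"
  and int_vec_axis: "axis j 1 \<in> int_vec"
  by (auto simp: int_vec_def axis_def)

lemma inner_int_vec: "m \<in> int_vec \<Longrightarrow> k \<in> int_vec \<Longrightarrow> m \<bullet> k \<in> \<int>"
  by (auto simp: int_vec_def inner_vec_def intro!: Ints_mult Ints_sum)

lemma countable_int_vec: "countable (int_vec :: (real ^ 'n) set)"
proof (rule countable_subset)
  show "(int_vec :: (real ^ 'n) set) \<subseteq> vec_lambda ` (Pi\<^sub>E UNIV (\<lambda>_. \<int>))"
  proof
    fix m :: "real^'n" assume "m \<in> int_vec"
    hence "vec_nth m \<in> Pi\<^sub>E UNIV (\<lambda>_. \<int>)" by (auto simp: int_vec_def)
    thus "m \<in> vec_lambda ` (Pi\<^sub>E UNIV (\<lambda>_. \<int>))" by (metis image_eqI vec_nth_inverse)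
  qed
  show "countable (vec_lambda ` (Pi\<^sub>E UNIV (\<lambda>_. \<int>)) :: (real ^ 'n) set)"
    by (intro countable_image countable_PiE) (auto simp: Ints_def)
qed

section \<open>Characters of the torus and their orthogonality\<close>

definition wave :: "real ^ 'n \<Rightarrow> real ^ 'n \<Rightarrow> complex" where
  "wave k x = cis (2 * pi * (k \<bullet> x))"

lemma norm_wave [simp]: "norm (wave k x) = 1"
  by (simp add: wave_def)

lemma wave_0 [simp]: "wave 0 x = 1"
  by (simp add: wave_def)

lemma wave_add: "wave (k + l) x = wave k x * wave l x"
  by (simp add: wave_def cis_mult inner_add_left algebra_simps)

lemma wave_add_right: "wave k (x + y) = wave k x * wave k y"
  by (simp add: wave_def cis_mult inner_add_right algebra_simps)

lemma wave_int: "k \<in> int_vec \<Longrightarrow> m \<in> int_vec \<Longrightarrow> wave k m = 1"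
  unfolding wave_def by (rule cis_multiple_2pi[OF inner_int_vec])

lemma continuous_on_wave [continuous_intros]: "continuous_on S (wave k)"
  unfolding wave_def cis_conv_exp by (intro continuous_intros)

lemma measurable_wave [measurable]: "wave k \<in> borel_measurable borel"
  by (intro borel_measurable_continuous_onI continuous_intros)

lemma
  fixes k :: real
  assumes "k \<in> \<int>"
  shows integrable_cis_unit: "integrable lborel (\<lambda>t. indicator {0..<1} t *\<^sub>R cis (2 * pi * (k * t)))"
    and integral_cis_unit: "(\<integral>t. indicator {0..<1} t *\<^sub>R cis (2 * pi * (k * t)) \<partial>lborel) = (if k = 0 then 1 else 0)"
proof -
  let ?f = "\<lambda>t. cis (2 * pi * (k * t))"
  have cont: "continuous_on S ?f" for S
    unfolding cis_conv_exp by (intro continuous_intros)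
  \<comment> \<open>The half-open interval differs from the closed one by a null set; the
    fundamental theorem is applied on the latter.\<close>
  have AE: "AE t in lborel. indicator {0..1} t *\<^sub>R ?f t = indicator {0..<1} t *\<^sub>R ?f t"
    using AE_lborel_singleton[of "1::real"] by eventually_elim (auto simp: indicator_def)
  have m: "?f \<in> borel_measurable borel" by (intro borel_measurable_continuous_onI cont)
  have int: "integrable lborel (\<lambda>t. indicator {0..1} t *\<^sub>R ?f t)"
    by (intro borel_integrable_compact cont) auto
  show "integrable lborel (\<lambda>t. indicator {0..<1} t *\<^sub>R ?f t)"
    using int by (rule integrable_cong_AE_imp) (use m AE in \<open>auto\<close>)
  have eq: "(\<integral>t. indicator {0..<1} t *\<^sub>R ?f t \<partial>lborel) = (\<integral>t. indicator {0..1} t *\<^sub>R ?f t \<partial>lborel)"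
    by (rule integral_cong_AE) (use m AE in \<open>auto\<close>)
  show "(\<integral>t. indicator {0..<1} t *\<^sub>R ?f t \<partial>lborel) = (if k = 0 then 1 else 0)"
  proof (cases "k = 0")
    case True
    thus ?thesis unfolding eq by (simp flip: scaleR_conv_of_real)
  next
    case False
    let ?c = "\<i> * of_real (2 * pi * k)"
    have c: "?c \<noteq> 0" using False by simp
    have d: "((\<lambda>t. exp (?c * of_real t) / ?c) has_vector_derivative ?f t) (at t within {0..1})" for t
    proof -
      have "((\<lambda>z. exp (?c * z) / ?c) has_field_derivative exp (?c * of_real t)) (at (of_real t))"
        using c by (auto intro!: derivative_eq_intros)
      from has_vector_derivative_real_field[OF this] show ?thesis
        by (simp add: cis_conv_exp mult_ac)
    qed
    have "(\<integral>t. indicator {0..1} t *\<^sub>R ?f t \<partial>lborel) = exp (?c * of_real 1) / ?c - exp (?c * of_real 0) / ?c"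
      by (rule integral_FTC_Icc[where F="\<lambda>t. exp (?c * of_real t) / ?c"]) (use d cont in auto)
    also have "exp (?c * of_real 1) = 1"
      using cis_multiple_2pi[OF assms] by (simp add: cis_conv_exp)
    finally show ?thesis using False by (simp add: eq)
  qed
qed

lemma cis_sum: "finite A \<Longrightarrow> cis (\<Sum>j\<in>A. f j) = (\<Prod>j\<in>A. cis (f j))"
  by (induction A rule: finite_induct) (auto simp: cis_mult[symmetric])

lemma integral_wave_unit_cube:
  fixes k :: "real ^ 'n"
  assumes "k \<in> int_vec"
  shows "(\<integral>x. indicator unit_cube x *\<^sub>R wave k x \<partial>lborel) = (if k = 0 then 1 else 0)"
proof -
  have "indicator unit_cube x *\<^sub>R wave k x = (\<Prod>j\<in>UNIV. indicator {0..<1} (x $ j) *\<^sub>R cis (2 * pi * (k $ j * x $ j)))" for x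
  proof (cases "x \<in> unit_cube")
    case True
    hence "indicator {0..<1} (x $ j) = (1::real)" for j by (auto simp: unit_cube_def)
    thus ?thesis using True
      by (simp add: wave_def inner_vec_def sum_distrib_left cis_sum)
  next
    case False
    then obtain j where "x $ j \<notin> {0..<1}" by (auto simp: unit_cube_def)
    hence "\<exists>j\<in>UNIV. indicator {0..<1} (x $ j) *\<^sub>R cis (2 * pi * (k $ j * x $ j)) = 0" by (auto intro!: exI[of _ j])
    hence "(\<Prod>j\<in>UNIV. indicator {0..<1} (x $ j) *\<^sub>R cis (2 * pi * (k $ j * x $ j))) = 0"
      by (intro prod_zero) auto
    thus ?thesis using False by simp
  qed
  hence "(\<integral>x. indicator unit_cube x *\<^sub>R wave k x \<partial>lborel) =
      (\<Prod>j\<in>UNIV. \<integral>t. indicator {0..<1} t *\<^sub>R cis (2 * pi * (k $ j * t)) \<partial>lborel)"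
    using assms by (simp only:) (rule integral_prod_nth, auto simp: int_vec_def intro: integrable_cis_unit)
  also have "\<dots> = (\<Prod>j\<in>UNIV. if k $ j = 0 then 1 else 0)"
    using assms by (intro prod.cong integral_cis_unit) (auto simp: int_vec_def)
  also have "\<dots> = (if k = 0 then 1 else 0)"
    by (auto simp: vec_eq_iff intro!: prod_zero)
  finally show ?thesis .
qed

lemma integral_unit_cube: "(\<integral>x. indicator unit_cube x \<partial>(lborel :: (real^'n) measure)) = (1::real)"
proof -
  have "complex_of_real (\<integral>x. indicator unit_cube x \<partial>(lborel :: (real^'n) measure)) =
      (\<integral>x. complex_of_real (indicator unit_cube x) \<partial>(lborel :: (real^'n) measure))"
    by (rule integral_complex_of_real[symmetric])
  also have "\<dots> = (\<integral>x. indicator unit_cube x *\<^sub>R wave (0::real^'n) x \<partial>lborel)"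
    by (simp only: wave_0 scaleR_conv_of_real mult_1_right)
  also have "\<dots> = 1" using integral_wave_unit_cube[OF int_vec_0] by (simp only: if_True refl)
  finally show ?thesis by (simp only: of_real_eq_1_iff)
qed

lemma integrable_indicator_unit_cube: "integrable lborel (indicator unit_cube :: real^'n \<Rightarrow> real)"
  using integral_unit_cube not_integrable_integral_eq[of lborel "indicator unit_cube :: real^'n \<Rightarrow> real"] by (metis zero_neq_one)

text \<open>The half-open cube contains exactly one integer translate of x, reached by the
  componentwise floor, so a single term survives.\<close>

lemma infsum_tiling:
  fixes g :: "real ^ 'n \<Rightarrow> complex"
  shows "(\<Sum>\<^sub>\<infinity>m\<in>int_vec. indicator unit_cube (- m + x) *\<^sub>R g x) = g x"
proof -
  define F :: "real^'n" where "F = (\<chi> j. of_int \<lfloor>x $ j\<rfloor>)"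
  have F: "F \<in> int_vec" by (simp add: F_def int_vec_def)
  have 1: "- F + x \<in> unit_cube" by (auto simp: unit_cube_def F_def) linarith+
  have 2: "m = F" if "m \<in> int_vec" "- m + x \<in> unit_cube" for m
  proof -
    have "m $ j = of_int \<lfloor>x $ j\<rfloor>" for j
    proof -
      from that(1) obtain n where n: "m $ j = of_int n" by (auto simp: int_vec_def elim: Ints_cases)
      have "0 \<le> - m $ j + x $ j" "- m $ j + x $ j < 1" using that(2) by (auto simp: unit_cube_def)
      hence "\<lfloor>x $ j\<rfloor> = n" unfolding n by (intro floor_unique) linarith+
      thus ?thesis by (simp add: n)
    qed
    thus ?thesis by (simp add: F_def vec_eq_iff)
  qed
  have "((\<lambda>m. indicator unit_cube (- m + x) *\<^sub>R g x) has_sum g x) int_vec"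
  proof (rule has_sum_finite_neutralI[of "{F}"])
    fix m assume "m \<in> int_vec - {F}"
    hence "- m + x \<notin> unit_cube" using 2 by blast
    thus "indicator unit_cube (- m + x) *\<^sub>R g x = 0" by simp
  next
    show "g x = (\<Sum>m\<in>{F}. indicator unit_cube (- m + x) *\<^sub>R g x)"
      using 1 by (simp del: uminus_add_conv_diff)
  qed (use F in auto)
  thus ?thesis by (rule infsumI)
qed

text \<open>The translates of the half-open cube cut g into disjoint pieces \<open>f m\<close>; each
  piece is moved back to the cube by translation invariance, and the pieces are summed.\<close>

lemma
  fixes g :: "real ^ 'n \<Rightarrow> complex"
  assumes [measurable]: "g \<in> borel_measurable borel"
    and int: "\<And>m. m \<in> int_vec \<Longrightarrow> integrable lborel (\<lambda>x. indicator unit_cube x *\<^sub>R g (m + x))"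
    and sum: "(\<lambda>m. \<integral>x. norm (indicator unit_cube x *\<^sub>R g (m + x)) \<partial>lborel) summable_on int_vec"
  shows integrable_unfold: "integrable lborel g"
    and integral_unfold: "(\<integral>x. g x \<partial>lborel) = (\<Sum>\<^sub>\<infinity>m\<in>int_vec. \<integral>x. indicator unit_cube x *\<^sub>R g (m + x) \<partial>lborel)"
proof -
  define f where "f = (\<lambda>m x. indicator unit_cube (- m + x) *\<^sub>R g x)"
  have [measurable]: "f m \<in> borel_measurable borel" for m unfolding f_def by measurable
  have f: "f m (m + x) = indicator unit_cube x *\<^sub>R g (m + x)" for m x by (simp add: f_def)
  have 1: "integrable lborel (f m)" if "m \<in> int_vec" for m
    using int[OF that] integrable_translate[of "f m" m] by (simp add: f)
  have 2: "(\<integral>x. norm (f m x) \<partial>lborel) = (\<integral>x. norm (indicator unit_cube x *\<^sub>R g (m + x)) \<partial>lborel)" for m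
    using integral_translate[of "\<lambda>x. norm (f m x)" m] by (simp add: f)
  have 3: "(\<integral>x. f m x \<partial>lborel) = (\<integral>x. indicator unit_cube x *\<^sub>R g (m + x) \<partial>lborel)" for m
    using integral_translate[of "f m" m] by (simp add: f)
  have tile: "(\<Sum>\<^sub>\<infinity>m\<in>int_vec. f m x) = g x" for x
    unfolding f_def by (rule infsum_tiling)
  note * = sigma_finite_lborel countable_int_vec 1 sum[folded 2]
  show "integrable lborel g"
    using integrable_infsum[OF *] by (simp only: tile)
  show "(\<integral>x. g x \<partial>lborel) = (\<Sum>\<^sub>\<infinity>m\<in>int_vec. \<integral>x. indicator unit_cube x *\<^sub>R g (m + x) \<partial>lborel)"
    using integral_infsum[OF *] by (simp only: tile 3)
qed

section \<open>Uniqueness of Fourier coefficients for continuous periodic functions\<close>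

definition zero_coeffs :: "(real ^ 'n \<Rightarrow> complex) \<Rightarrow> bool" where
  "zero_coeffs D \<longleftrightarrow> continuous_on UNIV D \<and> (\<forall>x. \<forall>m\<in>int_vec. D (x + m) = D x) \<and>
     (\<forall>k\<in>int_vec. (\<integral>x. indicator unit_cube x *\<^sub>R (D x * wave k x) \<partial>lborel) = 0)"

text \<open>The multipliers form an algebra, which therefore contains all trigonometric polynomials.\<close>
definition multiplier :: "(real ^ 'n \<Rightarrow> complex) \<Rightarrow> bool" where
  "multiplier p \<longleftrightarrow> (\<forall>D. zero_coeffs D \<longrightarrow> zero_coeffs (\<lambda>x. D x * p x))"

lemma multiplier_const: "multiplier (\<lambda>x::real^'n. c)"
proof -
  have "(\<integral>x. indicator unit_cube x *\<^sub>R (D x * c * wave k x) \<partial>lborel) =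
        (\<integral>x. indicator unit_cube x *\<^sub>R (D x * wave k x) \<partial>lborel) * c" for D and k :: "real^'n"
    unfolding integral_mult_left_zero[symmetric]
    by (intro Bochner_Integration.integral_cong) auto
  thus ?thesis
    by (auto simp: multiplier_def zero_coeffs_def intro!: continuous_intros)
qed

lemma multiplier_add:
  fixes p q :: "real^'n \<Rightarrow> complex"
  assumes "multiplier p" "multiplier q"
  shows "multiplier (\<lambda>x. p x + q x)"
  unfolding multiplier_def
proof (intro allI impI)
  fix D :: "real^'n \<Rightarrow> complex" assume "zero_coeffs D"
  hence pq: "zero_coeffs (\<lambda>x. D x * p x)" "zero_coeffs (\<lambda>x. D x * q x)"
    using assms by (auto simp: multiplier_def)
  have int: "integrable lborel (\<lambda>x. indicator unit_cube x *\<^sub>R (D x * p x * wave k x))"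
    "integrable lborel (\<lambda>x. indicator unit_cube x *\<^sub>R (D x * q x * wave k x))" for k
    using pq by (auto intro!: integrable_unit_cube continuous_on_mult[OF _ continuous_on_wave] simp: zero_coeffs_def)
  have "(\<integral>x. indicator unit_cube x *\<^sub>R (D x * (p x + q x) * wave k x) \<partial>lborel) =
        (\<integral>x. indicator unit_cube x *\<^sub>R (D x * p x * wave k x) + indicator unit_cube x *\<^sub>R (D x * q x * wave k x) \<partial>lborel)" for k
    by (intro Bochner_Integration.integral_cong) (auto simp: algebra_simps)
  also have "\<dots> k = (\<integral>x. indicator unit_cube x *\<^sub>R (D x * p x * wave k x) \<partial>lborel) +
      (\<integral>x. indicator unit_cube x *\<^sub>R (D x * q x * wave k x) \<partial>lborel)" for k
    by (rule Bochner_Integration.integral_add[OF int])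
  finally have "(\<integral>x. indicator unit_cube x *\<^sub>R (D x * (p x + q x) * wave k x) \<partial>lborel) = 0" if "k \<in> int_vec" for k
    using pq that by (simp add: zero_coeffs_def)
  moreover have "continuous_on UNIV (\<lambda>x. D x * (p x + q x))"
    using pq unfolding distrib_left zero_coeffs_def by (intro continuous_on_add) auto
  moreover have "D (x + m) * (p (x + m) + q (x + m)) = D x * (p x + q x)" if "m \<in> int_vec" for x m
    using pq that unfolding distrib_left by (auto simp: zero_coeffs_def)
  ultimately show "zero_coeffs (\<lambda>x. D x * (p x + q x))"
    by (auto simp: zero_coeffs_def)
qed

lemma multiplier_mult:
  assumes "multiplier p" "multiplier q"
  shows "multiplier (\<lambda>x. p x * q x)"
  using assms by (auto simp: multiplier_def mult.assoc[symmetric])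

lemma multiplier_sum:
  "finite S \<Longrightarrow> (\<And>i. i \<in> S \<Longrightarrow> multiplier (p i)) \<Longrightarrow> multiplier (\<lambda>x. \<Sum>i\<in>S. p i x)"
  by (induction S rule: finite_induct) (auto intro: multiplier_add multiplier_const)

lemma multiplier_wave:
  assumes "l \<in> int_vec"
  shows "multiplier (wave l)"
  unfolding multiplier_def
proof (intro allI impI)
  fix D :: "real^'a \<Rightarrow> complex" assume D: "zero_coeffs D"
  have "(\<integral>x. indicator unit_cube x *\<^sub>R (D x * wave l x * wave k x) \<partial>lborel) = 0" if "k \<in> int_vec" for k
  proof -
    have "(\<lambda>x. indicator unit_cube x *\<^sub>R (D x * wave l x * wave k x)) = (\<lambda>x. indicator unit_cube x *\<^sub>R (D x * wave (l + k) x))"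
      by (simp add: wave_add mult.assoc)
    thus ?thesis using D int_vec_add[OF assms that] by (simp add: zero_coeffs_def)
  qed
  with D assms show "zero_coeffs (\<lambda>x. D x * wave l x)"
    by (auto simp: zero_coeffs_def wave_add_right wave_int intro!: continuous_intros)
qed

text \<open>Integer-periodic functions become functions on a compact subset of a Euclidean space,
  where polynomial approximation is available.\<close>

definition torus_embedding :: "real ^ 'n \<Rightarrow> complex ^ 'n" where
  "torus_embedding x = (\<chi> j. cis (2 * pi * x $ j))"

lemma torus_embedding_eq_imp:
  assumes "torus_embedding x = torus_embedding y"
  shows "x - y \<in> int_vec"
proof -
  have "(x - y) $ j \<in> \<int>" for j
  proof -
    have "cis (2 * pi * x $ j) = cis (2 * pi * y $ j)"
      using assms by (simp add: torus_embedding_def vec_eq_iff)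
    hence "cos (2 * pi * x $ j - 2 * pi * y $ j) = 1"
      by (simp add: complex_eq_iff cos_diff)
    then obtain n :: int where "2 * pi * x $ j - 2 * pi * y $ j = of_int n * 2 * pi"
      unfolding cos_one_2pi_int by blast
    hence "2 * pi * (x $ j - y $ j) = 2 * pi * of_int n" by (simp add: algebra_simps)
    thus ?thesis by simp
  qed
  thus ?thesis by (simp add: int_vec_def)
qed

lemma continuous_on_torus_embedding: "continuous_on S torus_embedding"
  unfolding torus_embedding_def cis_conv_exp by (intro continuous_intros)

text \<open>The real coordinates of the embedding are combinations of the waves with frequencies
  \<open>axis j 1\<close> and its negative, by cos = (e + e^-1) / 2 and sin = (e - e^-1) / (2 i). As
  multipliers form an algebra, induction over the polynomial does the rest.\<close>

lemma multiplier_polynomial: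
  assumes "real_polynomial_function q"
  shows "multiplier (\<lambda>x::real^'n. of_real (q (torus_embedding x)))"
  using assms
proof induction
  case (linear q)
  interpret bounded_linear q by fact
  have eq: "of_real (q (torus_embedding x)) = (\<Sum>b\<in>Basis. complex_of_real (torus_embedding x \<bullet> b) * of_real (q b))" for x
  proof -
    have "q (torus_embedding x) = q (\<Sum>b\<in>Basis. (torus_embedding x \<bullet> b) *\<^sub>R b)"
      by (simp add: euclidean_representation)
    thus ?thesis by (simp add: sum scaleR)
  qed
  have w: "multiplier (wave (axis j 1))" "multiplier (wave (- axis j 1))" for j :: 'n
    by (auto intro!: multiplier_wave int_vec_minus int_vec_axis)
  have "multiplier (\<lambda>x::real^'n. complex_of_real (torus_embedding x \<bullet> b))" if "b \<in> Basis" for b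
  proof -
    from that obtain j u where b: "b = axis j u" "u = 1 \<or> u = \<i>"
      by (auto simp: Basis_vec_def Basis_complex_def)
    have e: "wave (axis j 1) x = cis (2 * pi * x $ j)" "wave (- axis j 1) x = cis (- (2 * pi * x $ j))" for x :: "real^'n"
      by (auto simp: wave_def inner_axis inner_commute[of "axis j 1"])
    have "(\<lambda>x::real^'n. complex_of_real (torus_embedding x \<bullet> axis j 1)) =
          (\<lambda>x. (wave (axis j 1) x + wave (- axis j 1) x) * (1 / 2))"
      by (rule ext) (simp add: e inner_axis torus_embedding_def complex_eq_iff inner_complex_def)
    hence 1: "multiplier (\<lambda>x::real^'n. complex_of_real (torus_embedding x \<bullet> axis j 1))"
      by (simp only:) (intro multiplier_mult multiplier_add multiplier_const w)
    have "(\<lambda>x::real^'n. complex_of_real (torus_embedding x \<bullet> axis j \<i>)) =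
          (\<lambda>x. (wave (axis j 1) x + wave (- axis j 1) x * (-1)) * (- \<i> / 2))"
      by (rule ext) (simp add: e inner_axis torus_embedding_def complex_eq_iff inner_complex_def)
    hence 2: "multiplier (\<lambda>x::real^'n. complex_of_real (torus_embedding x \<bullet> axis j \<i>))"
      by (simp only:) (intro multiplier_mult multiplier_add multiplier_const w)
    from 1 2 b show ?thesis by auto
  qed
  thus ?case unfolding eq by (intro multiplier_sum multiplier_mult multiplier_const) auto
next
  case (const c)
  thus ?case by (rule multiplier_const)
next
  case (add f g)
  thus ?case by (simp add: multiplier_add)
next
  case (mult f g)
  thus ?case by (simp add: multiplier_mult)
qed

text \<open>A periodic u factors as \<open>w\<close> after \<open>torus_embedding\<close>, since
  points with the same image differ by an integer vector; Stone-Weierstrass applies to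
  \<open>w\<close> on the compact image of the cube.\<close>

lemma periodic_approximation:
  fixes u :: "real ^ 'n \<Rightarrow> real"
  assumes cont: "continuous_on UNIV u" and per: "\<And>x m. m \<in> int_vec \<Longrightarrow> u (x + m) = u x" and "\<epsilon> > 0"
  shows "\<exists>q. real_polynomial_function q \<and> (\<forall>x\<in>cbox 0 1. \<bar>u x - q (torus_embedding x)\<bar> < \<epsilon>)"
proof -
  let ?E = "torus_embedding :: real^'n \<Rightarrow> complex^'n"
  define K where "K = (cbox 0 1 :: (real^'n) set)"
  define w where "w v = u (SOME x. ?E x = v)" for v
  have w: "w (?E x) = u x" for x
  proof -
    define y where "y = (SOME y. ?E y = ?E x)"
    have "?E y = ?E x" unfolding y_def by (rule someI) simp
    hence "y - x \<in> int_vec" by (rule torus_embedding_eq_imp)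
    from per[OF this, of x] show ?thesis by (simp add: w_def y_def)
  qed
  have compact: "compact (?E ` K)"
    unfolding K_def by (intro compact_continuous_image continuous_on_torus_embedding compact_cbox)
  \<comment> \<open>Continuity of the factor: the preimage of a closed set under \<open>w\<close> is
    the image of a compact set, hence closed.\<close>
  have "continuous_on (?E ` K) w"
    unfolding continuous_on_closed_vimage[OF compact_imp_closed[OF compact]]
  proof (intro allI impI)
    fix B :: "real set" assume "closed B"
    have "w -` B \<inter> ?E ` K = ?E ` (K \<inter> u -` B)" using w by auto
    moreover have "closed (u -` B)"
      using \<open>closed B\<close> cont by (simp add: closed_vimage continuous_on_eq_continuous_at)
    hence "compact (?E ` (K \<inter> u -` B))"
      unfolding K_def by (intro compact_continuous_image continuous_on_torus_embedding compact_Int_closed compact_cbox)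
    ultimately show "closed (w -` B \<inter> ?E ` K)" by (simp add: compact_imp_closed)
  qed
  from Stone_Weierstrass_real_polynomial_function[OF compact this \<open>\<epsilon> > 0\<close>]
  obtain q where "real_polynomial_function q" "\<And>v. v \<in> ?E ` K \<Longrightarrow> \<bar>w v - q v\<bar> < \<epsilon>" by blast
  hence "\<bar>u x - q (?E x)\<bar> < \<epsilon>" if "x \<in> cbox 0 1" for x
    using that w[of x] unfolding K_def by (metis imageI)
  thus ?thesis using \<open>real_polynomial_function q\<close> by blast
qed

text \<open>Vanishing coefficients make the integral of D P zero for every trigonometric polynomial
  P, so the integral of |D|^2 equals that of D (cnj D - P). This is as small as desired when P
  approximates the conjugate of D uniformly, and continuity turns a vanishing mean square into D =
  0.\<close>

lemma zero_coeffs_imp_zero: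
  fixes D :: "real ^ 'n \<Rightarrow> complex"
  assumes D: "zero_coeffs D"
  shows "D x = 0"
proof -
  have cont: "continuous_on UNIV D" and per: "\<And>x m. m \<in> int_vec \<Longrightarrow> D (x + m) = D x"
    using D by (auto simp: zero_coeffs_def)
  have "compact (D ` cbox 0 1)"
    by (intro compact_continuous_image continuous_on_subset[OF cont]) auto
  then obtain B where B: "B > 0" "\<And>x. x \<in> cbox 0 1 \<Longrightarrow> norm (D x) \<le> B"
    using compact_imp_bounded bounded_pos by (metis image_eqI)
  note cube = integral_unit_cube and int_cube = integrable_indicator_unit_cube
  define S where "S = (\<integral>x. indicator unit_cube x *\<^sub>R (norm (D x))\<^sup>2 \<partial>lborel)"
  have int2: "integrable lborel (\<lambda>x. indicator unit_cube x *\<^sub>R (D x * cnj (D x)))"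
    by (intro integrable_unit_cube continuous_intros cont)
  have S: "complex_of_real S = (\<integral>x. indicator unit_cube x *\<^sub>R (D x * cnj (D x)) \<partial>lborel)"
    unfolding S_def integral_complex_of_real[symmetric]
    by (intro Bochner_Integration.integral_cong) (simp_all only: real_scaleR_def of_real_mult scaleR_conv_of_real complex_norm_square)
  have intS: "integrable lborel (\<lambda>x. indicator unit_cube x *\<^sub>R (norm (D x))\<^sup>2)"
  proof -
    have "(\<lambda>x. Re (indicator unit_cube x *\<^sub>R (D x * cnj (D x)))) = (\<lambda>x. indicator unit_cube x *\<^sub>R (norm (D x))\<^sup>2)"
      by (rule ext) (simp add: cmod_power2 flip: power2_eq_square)
    thus ?thesis using integrable_Re[OF int2] by simp
  qed
  have small: "S \<le> \<epsilon>" if "\<epsilon> > 0" for \<epsilon>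
  proof -
    \<comment> \<open>Real and imaginary part are each approximated within d, and |D| \<le> B, which
      makes the total error at most 2 B d = \<epsilon>.\<close>
    define d where "d = \<epsilon> / (2 * B)"
    have d: "d > 0" using that B by (simp add: d_def)
    have "continuous_on UNIV (\<lambda>x. Re (D x))" "continuous_on UNIV (\<lambda>x. Im (D x))"
      by (intro continuous_intros cont)+
    note approx = periodic_approximation[OF this(1) _ d] periodic_approximation[OF this(2) _ d]
    obtain p where p: "real_polynomial_function p" "\<And>x. x \<in> cbox 0 1 \<Longrightarrow> \<bar>Re (D x) - p (torus_embedding x)\<bar> < d"
      using approx(1) per by metis
    obtain q where q: "real_polynomial_function q" "\<And>x. x \<in> cbox 0 1 \<Longrightarrow> \<bar>Im (D x) - q (torus_embedding x)\<bar> < d"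
      using approx(2) per by metis
    \<comment> \<open>The factor -i makes P approximate the conjugate of D.\<close>
    define P where "P x = of_real (p (torus_embedding x)) + of_real (q (torus_embedding x)) * (-\<i>)" for x
    have "multiplier P"
      unfolding P_def by (intro multiplier_add multiplier_mult multiplier_const multiplier_polynomial p q)
    hence DP: "zero_coeffs (\<lambda>x. D x * P x)" using D by (simp add: multiplier_def)
    have intDP: "integrable lborel (\<lambda>x. indicator unit_cube x *\<^sub>R (D x * P x))"
      using DP by (intro integrable_unit_cube) (simp add: zero_coeffs_def)
    have "(\<integral>x. indicator unit_cube x *\<^sub>R (D x * P x) \<partial>lborel) = 0"
      using DP int_vec_0 by (force simp: zero_coeffs_def)
    hence "of_real S = (\<integral>x. indicator unit_cube x *\<^sub>R (D x * cnj (D x)) \<partial>lborel) - (\<integral>x. indicator unit_cube x *\<^sub>R (D x * P x) \<partial>lborel)"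
      using S by simp
    also have "\<dots> = (\<integral>x. indicator unit_cube x *\<^sub>R (D x * cnj (D x)) - indicator unit_cube x *\<^sub>R (D x * P x) \<partial>lborel)"
      by (rule Bochner_Integration.integral_diff[OF int2 intDP, symmetric])
    finally have "S \<le> norm \<dots>" by (metis abs_ge_self norm_of_real)
    also have "\<dots> \<le> (\<integral>x. norm (indicator unit_cube x *\<^sub>R (D x * cnj (D x)) - indicator unit_cube x *\<^sub>R (D x * P x)) \<partial>lborel)"
      by (rule integral_norm_bound)
    also have "\<dots> \<le> (\<integral>x. indicator unit_cube x * \<epsilon> \<partial>(lborel :: (real^'n) measure))"
    proof (rule integral_mono)
      show "integrable lborel (\<lambda>x. norm (indicator unit_cube x *\<^sub>R (D x * cnj (D x)) - indicator unit_cube x *\<^sub>R (D x * P x)))"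
        by (intro integrable_norm Bochner_Integration.integrable_diff int2 intDP)
      show "integrable lborel (\<lambda>x::real^'n. indicator unit_cube x * \<epsilon>)"
        by (intro integrable_mult_left integrable_indicator_unit_cube)
      fix x :: "real^'n"
      show "norm (indicator unit_cube x *\<^sub>R (D x * cnj (D x)) - indicator unit_cube x *\<^sub>R (D x * P x)) \<le> indicator unit_cube x * \<epsilon>"
      proof (cases "x \<in> unit_cube")
        case True
        hence x: "x \<in> cbox 0 1" using unit_cube_subset by auto
        have "norm (cnj (D x) - P x) \<le> \<bar>Re (cnj (D x) - P x)\<bar> + \<bar>Im (cnj (D x) - P x)\<bar>" by (rule cmod_le)
        also have "\<dots> \<le> d + d" using p(2)[OF x] q(2)[OF x] by (simp add: P_def abs_minus_commute)
        finally have "norm (D x) * norm (cnj (D x) - P x) \<le> B * (d + d)"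
          using B x by (intro mult_mono) auto
        also have "\<dots> = \<epsilon>" using B by (simp add: d_def)
        finally show ?thesis using True by (simp add: norm_mult[symmetric] algebra_simps)
      qed simp
    qed
    also have "\<dots> = (\<integral>x. indicator unit_cube x \<partial>(lborel :: (real^'n) measure)) * \<epsilon>"
      by (rule integral_mult_left_zero)
    also have "\<dots> = \<epsilon>" unfolding cube by simp
    finally show ?thesis .
  qed
  have S0: "S \<le> 0"
  proof (rule field_le_epsilon)
    fix \<epsilon> :: real assume "0 < \<epsilon>"
    from small[OF this] show "S \<le> 0 + \<epsilon>" by (simp only: add_0)
  qed
  \<comment> \<open>The half-open cube is traded for the open box inside it, whose integral agrees
    with the one over the closed box; there a nonnegative continuous function with integral 0
    vanishes. Periodicity covers the other points.\<close>
  let ?f = "\<lambda>x. (norm (D x))\<^sup>2"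
  have contf: "continuous_on T ?f" for T
    by (intro continuous_intros continuous_on_subset[OF cont]) auto
  have "integrable lborel (\<lambda>x. indicator (cbox 0 1) x *\<^sub>R ?f x)"
    by (intro borel_integrable_compact contf) auto
  hence "integrable lborel (\<lambda>x. indicator (box 0 1) x *\<^sub>R (indicator (cbox 0 1) x *\<^sub>R ?f x))"
    by (rule integrable_mult_indicator[rotated]) simp
  also have "(\<lambda>x. indicator (box 0 1) x *\<^sub>R (indicator (cbox 0 1) x *\<^sub>R ?f x)) = (\<lambda>x. indicator (box 0 1) x *\<^sub>R ?f x)"
    using box_subset_cbox by (auto simp: indicator_def fun_eq_iff)
  finally have intb: "set_integrable lborel (box 0 1) ?f" by (simp add: set_integrable_def)
  have "(\<integral>x. indicator (box 0 1) x *\<^sub>R ?f x \<partial>lborel) \<le> S"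
    unfolding S_def using intb intS
    by (intro integral_mono) (auto simp: set_integrable_def indicator_def unit_cube_def mem_box_cart less_imp_le)
  with S0 have "(LINT x:box 0 1|lborel. ?f x) \<le> 0" by (simp add: set_lebesgue_integral_def)
  moreover have "(LINT x:box 0 1|lborel. ?f x) \<ge> 0"
    unfolding set_lebesgue_integral_def by (intro integral_nonneg_AE) auto
  ultimately have "(LINT x:box 0 1|lborel. ?f x) = 0" by simp
  moreover have "(?f has_integral (LINT x:box 0 1|lborel. ?f x)) (box 0 1)"
    using set_borel_integral_eq_integral[OF intb] by (simp add: integrable_integral)
  ultimately have "(?f has_integral 0) (cbox 0 1)"
    by (simp add: has_integral_open_interval)
  moreover have "box 0 1 \<noteq> ({} :: (real^'n) set)" by (simp add: box_ne_empty cart_eq_inner_axis[symmetric] Basis_vec_real)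
  ultimately have zero: "D x = 0" if "x \<in> cbox 0 1" for x
    using has_integral_0_cbox_imp_0[of 0 1 ?f x] contf that by simp
  define F :: "real^'n" where "F = (\<chi> j. of_int \<lfloor>x $ j\<rfloor>)"
  have "x - F \<in> cbox 0 1"
    unfolding mem_box_cart F_def by (auto) (linarith+)
  hence "D (x - F) = 0" by (rule zero)
  moreover have "F \<in> int_vec" by (simp add: F_def int_vec_def)
  ultimately show ?thesis using per[of F "x - F"] by simp
qed

text \<open>The Weierstrass M-test on each ball; the majorant may depend on the radius, and the
  balls around 0 exhaust the space.\<close>

lemma continuous_on_infsum:
  fixes f :: "'i \<Rightarrow> 'a::real_normed_vector \<Rightarrow> complex"
  assumes cont: "\<And>i. i \<in> I \<Longrightarrow> continuous_on UNIV (f i)"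
    and bound: "\<And>R. \<exists>M. M summable_on I \<and> (\<forall>i\<in>I. \<forall>x. norm x \<le> R \<longrightarrow> norm (f i x) \<le> M i)"
  shows "continuous_on UNIV (\<lambda>x. \<Sum>\<^sub>\<infinity>i\<in>I. f i x)"
proof -
  have "continuous_on (ball 0 R) (\<lambda>x. \<Sum>\<^sub>\<infinity>i\<in>I. f i x)" for R
  proof -
    obtain M where M: "M summable_on I" "\<And>i x. i \<in> I \<Longrightarrow> norm x \<le> R \<Longrightarrow> norm (f i x) \<le> M i"
      using bound[of R] by blast
    have "uniform_limit (ball 0 R) (\<lambda>X x. \<Sum>i\<in>X. f i x) (\<lambda>x. \<Sum>\<^sub>\<infinity>i\<in>I. f i x) (finite_subsets_at_top I)"
      by (rule Weierstrass_m_test_general[OF _ M(1)]) (auto intro!: M(2))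
    moreover have "\<forall>\<^sub>F X in finite_subsets_at_top I. continuous_on (ball 0 R) (\<lambda>x. \<Sum>i\<in>X. f i x)"
      by (rule eventually_finite_subsets_at_top_weakI)
         (auto intro!: continuous_on_sum intro: continuous_on_subset[OF cont])
    ultimately show ?thesis
      by (intro uniform_limit_theorem[where F="finite_subsets_at_top I"]) auto
  qed
  hence "continuous_on (\<Union>R\<in>UNIV. ball (0::'a) R) (\<lambda>x. \<Sum>\<^sub>\<infinity>i\<in>I. f i x)"
    by (intro continuous_on_open_UN) auto
  moreover have "(\<Union>R\<in>UNIV. ball (0::'a) R) = UNIV"
    by (auto intro: gt_ex)
  ultimately show ?thesis by simp
qed

section \<open>Periodisation of functions on the whole space\<close>

lemma unit_cube_norm_le: "x \<in> unit_cube \<Longrightarrow> norm (x :: real^'n) \<le> CARD('n)"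
proof -
  assume "x \<in> unit_cube"
  hence "\<bar>x $ j\<bar> \<le> 1" for j by (auto simp: unit_cube_def less_imp_le)
  hence "(\<Sum>j\<in>UNIV. \<bar>x $ j\<bar>) \<le> (\<Sum>j\<in>(UNIV::'n set). 1)" by (intro sum_mono) auto
  with norm_le_l1_cart[of x] show ?thesis by simp
qed

text \<open>The majorant is uniform for shifts x in a bounded set. This single condition gives
  continuity of the periodisation of g as well as integrability of g.\<close>

definition periodisable :: "(real ^ 'n \<Rightarrow> complex) \<Rightarrow> bool" where
  "periodisable g \<longleftrightarrow> continuous_on UNIV g \<and>
     (\<forall>R. \<exists>M. M summable_on int_vec \<and> (\<forall>m\<in>int_vec. \<forall>x. norm x \<le> R \<longrightarrow> norm (g (m + x)) \<le> M m))"

text \<open>The unit cube lies in the ball of radius d, so the majorant bounds the integrals over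
  all translated cubes, and unfolding makes g integrable on the whole space.\<close>

lemma
  fixes g :: "real ^ 'n \<Rightarrow> complex"
  assumes "periodisable g"
  shows periodisable_measurable: "g \<in> borel_measurable borel"
    and periodisable_cube: "integrable lborel (\<lambda>x. indicator unit_cube x *\<^sub>R g (m + x))"
    and periodisable_summable_cube:
      "(\<lambda>m. \<integral>x. norm (indicator unit_cube x *\<^sub>R g (m + x)) \<partial>lborel) summable_on int_vec"
    and periodisable_integrable: "integrable lborel g"
proof -
  have cont: "continuous_on UNIV g" using assms by (simp add: periodisable_def)
  show meas: "g \<in> borel_measurable borel" by (rule borel_measurable_continuous_onI[OF cont])
  show int: "integrable lborel (\<lambda>x. indicator unit_cube x *\<^sub>R g (m + x))" for m
    by (intro integrable_unit_cube continuous_on_compose2[OF cont] continuous_intros) auto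
  obtain M where M: "M summable_on int_vec" "\<And>m x. m \<in> int_vec \<Longrightarrow> norm x \<le> CARD('n) \<Longrightarrow> norm (g (m + x)) \<le> M m"
    using assms unfolding periodisable_def by meson
  show sum: "(\<lambda>m. \<integral>x. norm (indicator unit_cube x *\<^sub>R g (m + x)) \<partial>lborel) summable_on int_vec"
  proof (rule summable_on_comparison_test[OF M(1)])
    fix m :: "real^'n" assume m: "m \<in> int_vec"
    have "(\<integral>x. norm (indicator unit_cube x *\<^sub>R g (m + x)) \<partial>lborel) \<le> (\<integral>x. indicator unit_cube x * M m \<partial>(lborel :: (real^'n) measure))"
    proof (rule integral_mono)
      show "integrable lborel (\<lambda>x::real^'n. indicator unit_cube x * M m)"
        by (intro integrable_mult_left integrable_indicator_unit_cube)
      show "norm (indicator unit_cube x *\<^sub>R g (m + x)) \<le> indicator unit_cube x * M m" for x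
        using M(2)[OF m unit_cube_norm_le, of x] by (auto simp: indicator_def)
    qed (intro integrable_norm int)
    also have "\<dots> = M m" by (simp only: integral_mult_left_zero integral_unit_cube mult_1)
    finally show "(\<integral>x. norm (indicator unit_cube x *\<^sub>R g (m + x)) \<partial>lborel) \<le> M m" .
  qed simp
  show "integrable lborel g"
    by (rule integrable_unfold[OF meas int sum])
qed

lemma periodisable_mult_wave:
  assumes "periodisable g"
  shows "periodisable (\<lambda>x. g x * wave k x)"
  using assms by (auto simp: periodisable_def norm_mult intro!: continuous_on_mult continuous_on_wave)

text \<open>Both sides are continuous periodic functions with the same Fourier coefficients.\<close>
theorem poisson_summation:
  fixes g :: "real ^ 'n \<Rightarrow> complex"
  assumes g: "periodisable g"
    and sum: "(\<lambda>n. norm (\<integral>x. g x * wave (- n) x \<partial>lborel)) summable_on int_vec"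
  shows "(\<Sum>\<^sub>\<infinity>m\<in>int_vec. g (m + \<xi>)) = (\<Sum>\<^sub>\<infinity>n\<in>int_vec. (\<integral>x. g x * wave (- n) x \<partial>lborel) * wave n \<xi>)"
proof -
  define c where "c n = (\<integral>x. g x * wave (- n) x \<partial>lborel)" for n
  define G where "G x = (\<Sum>\<^sub>\<infinity>m\<in>int_vec. g (m + x))" for x
  define H where "H x = (\<Sum>\<^sub>\<infinity>n\<in>int_vec. c n * wave n x)" for x
  have contg: "continuous_on UNIV g" using g by (simp add: periodisable_def)
  have contG: "continuous_on UNIV G"
    unfolding G_def using g
    by (intro continuous_on_infsum continuous_on_compose2[OF contg] continuous_intros)
       (auto simp: periodisable_def)
  have contH: "continuous_on UNIV H"
    unfolding H_def
  proof (rule continuous_on_infsum)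
    show "continuous_on UNIV (\<lambda>x. c n * wave n x)" for n by (intro continuous_intros)
    show "\<exists>M. M summable_on int_vec \<and> (\<forall>n\<in>int_vec. \<forall>x. norm x \<le> R \<longrightarrow> norm (c n * wave n x) \<le> M n)" for R
      using sum by (intro exI[of _ "\<lambda>n. norm (c n)"]) (auto simp: c_def norm_mult)
  qed
  have perG: "G (x + k) = G x" if "k \<in> int_vec" for x k
  proof -
    have "bij_betw (\<lambda>m. m + k) int_vec int_vec"
      by (rule bij_betwI[where g="\<lambda>m. m - k"]) (use that in \<open>auto intro: int_vec_add int_vec_diff\<close>)
    from infsum_reindex_bij_betw[OF this, of "\<lambda>m. g (m + x)"] show ?thesis
      by (simp add: G_def add_ac)
  qed
  have perH: "H (x + k) = H x" if "k \<in> int_vec" for x k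
    unfolding H_def using that by (intro infsum_cong) (simp add: wave_add_right wave_int)
  \<comment> \<open>Unfolding: \<open>wave k\<close> is periodic for integer k, so integrating the
    periodised g against it over one cube amounts to integrating g against it over the whole
    space.\<close>
  have coeffG: "(\<integral>x. indicator unit_cube x *\<^sub>R (G x * wave k x) \<partial>lborel) = c (- k)" if k: "k \<in> int_vec" for k
  proof -
    note g' = periodisable_mult_wave[OF g, of k]
    have shift: "g (m + x) * wave k (m + x) = g (m + x) * wave k x" if "m \<in> int_vec" for m x
      using wave_int[OF k that] by (simp add: wave_add_right)
    have "c (- k) = (\<Sum>\<^sub>\<infinity>m\<in>int_vec. \<integral>x. indicator unit_cube x *\<^sub>R (g (m + x) * wave k (m + x)) \<partial>lborel)"
      unfolding c_def minus_minus
      by (rule integral_unfold[OF periodisable_measurable[OF g'] periodisable_cube[OF g'] periodisable_summable_cube[OF g']])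
    also have "\<dots> = (\<integral>x. (\<Sum>\<^sub>\<infinity>m\<in>int_vec. indicator unit_cube x *\<^sub>R (g (m + x) * wave k (m + x))) \<partial>lborel)"
      by (rule integral_infsum[OF sigma_finite_lborel countable_int_vec periodisable_cube[OF g']
            periodisable_summable_cube[OF g'], symmetric])
    also have "\<dots> = (\<integral>x. indicator unit_cube x *\<^sub>R (G x * wave k x) \<partial>lborel)"
    proof (rule Bochner_Integration.integral_cong[OF refl])
      fix x
      have "(\<Sum>\<^sub>\<infinity>m\<in>int_vec. indicator unit_cube x *\<^sub>R (g (m + x) * wave k (m + x))) =
            (\<Sum>\<^sub>\<infinity>m\<in>int_vec. g (m + x) * (indicator unit_cube x *\<^sub>R wave k x))"
        by (intro infsum_cong) (simp add: shift)
      also have "\<dots> = G x * (indicator unit_cube x *\<^sub>R wave k x)"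
        unfolding G_def by (rule infsum_cmult_left')
      finally show "(\<Sum>\<^sub>\<infinity>m\<in>int_vec. indicator unit_cube x *\<^sub>R (g (m + x) * wave k (m + x))) =
            indicator unit_cube x *\<^sub>R (G x * wave k x)" by simp
    qed
    finally show ?thesis ..
  qed
  \<comment> \<open>Orthogonality of the waves leaves only the term n = - k.\<close>
  have coeffH: "(\<integral>x. indicator unit_cube x *\<^sub>R (H x * wave k x) \<partial>lborel) = c (- k)" if k: "k \<in> int_vec" for k
  proof -
    have pt: "c n * (indicator unit_cube x *\<^sub>R wave (n + k) x) = c n * wave n x * (indicator unit_cube x *\<^sub>R wave k x)" for n x
      by (simp add: wave_add)
    have int: "integrable lborel (\<lambda>x. c n * (indicator unit_cube x *\<^sub>R wave (n + k) x))" for n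
      by (intro integrable_mult_right integrable_unit_cube continuous_intros)
    have "(\<lambda>n. \<integral>x. norm (c n * (indicator unit_cube x *\<^sub>R wave (n + k) x)) \<partial>lborel) = (\<lambda>n. norm (c n))"
    proof
      fix n
      have "(\<integral>x. norm (c n * (indicator unit_cube x *\<^sub>R wave (n + k) x)) \<partial>lborel) =
          (\<integral>x. norm (c n) * indicator unit_cube x \<partial>(lborel :: (real^'n) measure))"
        by (rule Bochner_Integration.integral_cong[OF refl]) (simp add: norm_mult)
      thus "(\<integral>x. norm (c n * (indicator unit_cube x *\<^sub>R wave (n + k) x)) \<partial>lborel) = norm (c n)"
        by (simp only: integral_mult_right_zero integral_unit_cube mult_1_right)
    qed
    hence sm: "(\<lambda>n. \<integral>x. norm (c n * (indicator unit_cube x *\<^sub>R wave (n + k) x)) \<partial>lborel) summable_on int_vec"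
      using sum by (simp add: c_def)
    have "(\<integral>x. indicator unit_cube x *\<^sub>R (H x * wave k x) \<partial>lborel) =
          (\<integral>x. (\<Sum>\<^sub>\<infinity>n\<in>int_vec. c n * (indicator unit_cube x *\<^sub>R wave (n + k) x)) \<partial>lborel)"
    proof (rule Bochner_Integration.integral_cong[OF refl])
      fix x
      show "indicator unit_cube x *\<^sub>R (H x * wave k x) = (\<Sum>\<^sub>\<infinity>n\<in>int_vec. c n * (indicator unit_cube x *\<^sub>R wave (n + k) x))"
        unfolding pt infsum_cmult_left' by (simp add: H_def)
    qed
    also have "\<dots> = (\<Sum>\<^sub>\<infinity>n\<in>int_vec. \<integral>x. c n * (indicator unit_cube x *\<^sub>R wave (n + k) x) \<partial>lborel)"
      by (rule integral_infsum[OF sigma_finite_lborel countable_int_vec int sm])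
    also have "\<dots> = (\<Sum>\<^sub>\<infinity>n\<in>int_vec. c n * (if n + k = 0 then 1 else 0))"
      using k by (intro infsum_cong) (simp only: integral_mult_right_zero integral_wave_unit_cube int_vec_add)
    also have "\<dots> = c (- k)"
    proof (rule infsumI, rule has_sum_finite_neutralI[of "{- k}"])
      show "{- k} \<subseteq> int_vec" using k by (simp add: int_vec_minus)
    qed (auto simp: eq_neg_iff_add_eq_0)
    finally show ?thesis .
  qed
  have "zero_coeffs (\<lambda>x. G x - H x)"
    unfolding zero_coeffs_def
  proof (intro conjI allI ballI)
    show "continuous_on UNIV (\<lambda>x. G x - H x)" by (intro continuous_intros contG contH)
    show "G (x + m) - H (x + m) = G x - H x" if "m \<in> int_vec" for x m
      using that by (simp add: perG perH)
    fix k :: "real^'n" assume k: "k \<in> int_vec"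
    have "(\<integral>x. indicator unit_cube x *\<^sub>R ((G x - H x) * wave k x) \<partial>lborel) =
          (\<integral>x. indicator unit_cube x *\<^sub>R (G x * wave k x) - indicator unit_cube x *\<^sub>R (H x * wave k x) \<partial>lborel)"
      by (intro Bochner_Integration.integral_cong refl) (simp add: algebra_simps)
    also have "\<dots> = c (- k) - c (- k)"
      by (subst Bochner_Integration.integral_diff)
         (auto intro!: integrable_unit_cube continuous_on_mult contG contH continuous_on_wave simp: coeffG[OF k] coeffH[OF k])
    finally show "(\<integral>x. indicator unit_cube x *\<^sub>R ((G x - H x) * wave k x) \<partial>lborel) = 0" by simp
  qed
  from zero_coeffs_imp_zero[OF this, of \<xi>] show ?thesis
    by (simp add: G_def H_def c_def)
qed

section \<open>The Fourier transform of a harmonic polynomial times a Gaussian\<close>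

text \<open>The characteristic function of the standard normal distribution at s, after the
  substitution v = a u with a = sqrt (2 \<pi> t), which turns the normal density into exp (- \<pi> t
  u^2) / sqrt (2 \<pi>). The choice of s makes s a the frequency - 2 \<pi> q.\<close>

lemma
  fixes t q :: real
  assumes t: "t > 0"
  shows integrable_gauss_cis: "integrable lborel (\<lambda>u. of_real (exp (- pi * t * (u * u))) * cis (- 2 * pi * (q * u)))"
    and integral_gauss_cis: "(\<integral>u. of_real (exp (- pi * t * (u * u))) * cis (- 2 * pi * (q * u)) \<partial>lborel) =
      of_real (exp (- pi * (q * q) / t) / sqrt t)"
proof -
  define a where "a = sqrt (2 * pi * t)"
  define s where "s = - 2 * pi * q / a"
  have a: "a > 0" "a\<^sup>2 = 2 * pi * t" "s * a = - 2 * pi * q" using t by (auto simp: a_def s_def)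
  have dens: "std_normal_density (a * u) = exp (- pi * t * (u * u)) / sqrt (2 * pi)" for u
    using a(2) by (simp add: std_normal_density_def power_mult_distrib power2_eq_square field_simps)
  have "integrable lborel (\<lambda>u. std_normal_density (0 + a * u))"
    using a(1) by (intro lborel_integrable_real_affine integrable_normal_density) auto
  hence "integrable lborel (\<lambda>u. sqrt (2 * pi) * (exp (- pi * t * (u * u)) / sqrt (2 * pi)))"
    unfolding add_0 dens by (rule integrable_mult_right)
  hence int: "integrable lborel (\<lambda>u. exp (- pi * t * (u * u)))" by simp
  have cm: "(\<lambda>u. cis (- 2 * pi * (q * u))) \<in> borel_measurable borel"
    unfolding cis_conv_exp by (intro borel_measurable_continuous_onI continuous_intros)
  show "integrable lborel (\<lambda>u. of_real (exp (- pi * t * (u * u))) * cis (- 2 * pi * (q * u)))"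
    by (rule Bochner_Integration.integrable_bound[OF int])
       (use cm in \<open>auto simp: norm_mult\<close>)
  have "of_real (exp (- (s\<^sup>2) / 2)) = char std_normal_distribution s"
    by (simp add: char_std_normal_distribution)
  also have "\<dots> = (\<integral>x. std_normal_density x *\<^sub>R iexp (s * x) \<partial>lborel)"
    unfolding char_def by (rule integral_density) auto
  also have "\<dots> = \<bar>a\<bar> *\<^sub>R (\<integral>u. std_normal_density (0 + a * u) *\<^sub>R iexp (s * (0 + a * u)) \<partial>lborel)"
    using a(1) by (intro lborel_integral_real_affine) auto
  also have "(\<lambda>u. std_normal_density (0 + a * u) *\<^sub>R iexp (s * (0 + a * u))) =
      (\<lambda>u. of_real (1 / sqrt (2 * pi)) * (of_real (exp (- pi * t * (u * u))) * cis (- 2 * pi * (q * u))))"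
  proof
    fix u
    have "s * (0 + a * u) = - 2 * pi * (q * u)"
      using a(3) by (metis add_0 mult.assoc)
    thus "std_normal_density (0 + a * u) *\<^sub>R iexp (s * (0 + a * u)) =
      of_real (1 / sqrt (2 * pi)) * (of_real (exp (- pi * t * (u * u))) * cis (- 2 * pi * (q * u)))"
      unfolding add_0 dens by (simp add: cis_conv_exp scaleR_conv_of_real)
  qed
  also have "\<bar>a\<bar> *\<^sub>R (\<integral>u. of_real (1 / sqrt (2 * pi)) * (of_real (exp (- pi * t * (u * u))) * cis (- 2 * pi * (q * u))) \<partial>lborel) =
      of_real (a * (1 / sqrt (2 * pi))) * (\<integral>u. of_real (exp (- pi * t * (u * u))) * cis (- 2 * pi * (q * u)) \<partial>lborel)"
    unfolding integral_mult_right_zero using a(1) by (simp add: scaleR_conv_of_real)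
  also have "a * (1 / sqrt (2 * pi)) = sqrt t" by (simp add: a_def real_sqrt_mult)
  finally have eq: "of_real (exp (- (s\<^sup>2) / 2)) = of_real (sqrt t) *
    (\<integral>u. of_real (exp (- pi * t * (u * u))) * cis (- 2 * pi * (q * u)) \<partial>lborel)" .
  have "- (s\<^sup>2) / 2 = - pi * (q * q) / t"
    using t a(2) by (simp add: s_def power_divide power_mult_distrib) (simp add: power2_eq_square field_simps)
  with eq have eq': "of_real (exp (- pi * (q * q) / t)) = of_real (sqrt t) *
    (\<integral>u. of_real (exp (- pi * t * (u * u))) * cis (- 2 * pi * (q * u)) \<partial>lborel)" by (simp only:)
  show "(\<integral>u. of_real (exp (- pi * t * (u * u))) * cis (- 2 * pi * (q * u)) \<partial>lborel) =
      of_real (exp (- pi * (q * q) / t) / sqrt t)"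
    unfolding of_real_divide eq' using t by simp
qed

definition gauss :: "real \<Rightarrow> real ^ 'n \<Rightarrow> real" where
  "gauss t u = exp (- pi * t * (u \<bullet> u))"

lemma continuous_on_gauss [continuous_intros]: "continuous_on S (gauss t)"
  unfolding gauss_def by (intro continuous_intros)

lemma integral_gauss_wave:
  fixes q :: "real ^ 'n"
  assumes t: "t > 0"
  shows "(\<integral>u. of_real (gauss t u) * wave (- q) u \<partial>lborel) = of_real (gauss (1 / t) q * (1 / sqrt t) ^ CARD('n))"
proof -
  let ?f = "\<lambda>j v. of_real (exp (- pi * t * (v * v))) * cis (- 2 * pi * (q $ j * v))"
  have "of_real (gauss t u) * wave (- q) u = (\<Prod>j\<in>UNIV. ?f j (u $ j))" for u
  proof -
    have "gauss t u = (\<Prod>j\<in>UNIV. exp (- pi * t * (u $ j * u $ j)))"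
      unfolding gauss_def inner_vec_def sum_distrib_left by (subst exp_sum) simp_all
    moreover have "wave (- q) u = (\<Prod>j\<in>UNIV. cis (- 2 * pi * (q $ j * u $ j)))"
      unfolding wave_def inner_vec_def sum_distrib_left by (subst cis_sum) simp_all
    ultimately show ?thesis by (simp only: of_real_prod prod.distrib)
  qed
  hence "(\<integral>u. of_real (gauss t u) * wave (- q) u \<partial>lborel) = (\<integral>u. (\<Prod>j\<in>UNIV. ?f j (u $ j)) \<partial>lborel)"
    by (simp only:)
  also have "\<dots> = (\<Prod>j\<in>UNIV. \<integral>v. ?f j v \<partial>lborel)"
    by (rule integral_prod_nth[OF integrable_gauss_cis[OF t]])
  also have "\<dots> = (\<Prod>j\<in>UNIV. of_real (exp (- pi * (q $ j * q $ j) / t) * (1 / sqrt t)))"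
    by (intro prod.cong refl) (subst integral_gauss_cis[OF t], simp)
  also have "\<dots> = of_real ((\<Prod>j\<in>UNIV. exp (- pi * (q $ j * q $ j) / t)) * (1 / sqrt t) ^ CARD('n))"
    by (simp only: of_real_prod[symmetric] prod.distrib prod_constant)
  also have "(\<Prod>j\<in>UNIV. exp (- pi * (q $ j * q $ j) / t)) = gauss (1 / t) q"
    unfolding gauss_def inner_vec_def by (subst exp_sum[symmetric]) (simp_all add: sum_distrib_left)
  finally show ?thesis .
qed

section \<open>Rapid decay and summation over lattices\<close>

lemma polynomial_growth:
  fixes p :: "'a::real_normed_vector \<Rightarrow> real"
  assumes "real_polynomial_function p"
  shows "\<exists>C k. C \<ge> 0 \<and> (\<forall>x. \<bar>p x\<bar> \<le> C * (1 + norm x) ^ k)"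
  using assms
proof induction
  case (linear f)
  then obtain K where K: "K > 0" "\<And>x. norm (f x) \<le> norm x * K" using bounded_linear.pos_bounded by blast
  have "\<bar>f x\<bar> \<le> K * (1 + norm x) ^ 1" for x using K(2)[of x] K(1) by (simp add: algebra_simps)
  thus ?case using K(1) by (intro exI[of _ K] exI[of _ 1]) auto
next
  case (const c)
  show ?case by (intro exI[of _ "\<bar>c\<bar>"] exI[of _ 0]) auto
next
  case (add f g)
  then obtain C k D l where *: "C \<ge> 0" "D \<ge> 0" "\<And>x. \<bar>f x\<bar> \<le> C * (1 + norm x) ^ k" "\<And>x. \<bar>g x\<bar> \<le> D * (1 + norm x) ^ l"
    by blast
  have "\<bar>f x + g x\<bar> \<le> (C + D) * (1 + norm x) ^ (k + l)" for x
  proof -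
    have "\<bar>f x + g x\<bar> \<le> C * (1 + norm x) ^ k + D * (1 + norm x) ^ l" using *(3,4)[of x] by linarith
    also have "\<dots> \<le> C * (1 + norm x) ^ (k + l) + D * (1 + norm x) ^ (k + l)"
      using *(1,2) by (intro add_mono mult_left_mono power_increasing) auto
    finally show ?thesis by (simp add: algebra_simps)
  qed
  with *(1,2) show ?case by (intro exI[of _ "C + D"] exI[of _ "k + l"]) auto
next
  case (mult f g)
  then obtain C k D l where *: "C \<ge> 0" "D \<ge> 0" "\<And>x. \<bar>f x\<bar> \<le> C * (1 + norm x) ^ k" "\<And>x. \<bar>g x\<bar> \<le> D * (1 + norm x) ^ l"
    by blast
  have "\<bar>f x * g x\<bar> \<le> (C * D) * (1 + norm x) ^ (k + l)" for x
  proof -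
    have "\<bar>f x * g x\<bar> \<le> (C * (1 + norm x) ^ k) * (D * (1 + norm x) ^ l)"
      unfolding abs_mult using *(1,2) by (intro mult_mono *(3,4)) auto
    thus ?thesis by (simp add: power_add mult_ac)
  qed
  with *(1,2) show ?case by (intro exI[of _ "C * D"] exI[of _ "k + l"]) auto
qed

text \<open>Two elementary bounds: (1 + r)^2 \<le> 2 (1 + r^2), and y^N \<le> N^N e^y from (1 + y /
  N)^N \<le> e^y with y = c (1 + r^2). They control the exponent 2 N, which dominates N because 1 +
  r \<ge> 1.\<close>

lemma exp_neg_square_bound:
  fixes c :: real
  assumes c: "c > 0"
  shows "\<exists>C. \<forall>r\<ge>0. (1 + r) ^ N * exp (- (c * r\<^sup>2)) \<le> C"
proof -
  have main: "(1 + r) ^ (2 * N) * exp (- (c * r\<^sup>2)) \<le> (2 / c) ^ N * (real N ^ N * exp c)" if "r \<ge> 0" "N > 0" for r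
  proof -
    have "(1 + r)\<^sup>2 \<le> 2 * (1 + r\<^sup>2)" using sum_squares_bound[of 1 r] by (simp add: power2_eq_square algebra_simps)
    hence "((1 + r)\<^sup>2) ^ N \<le> (2 * (1 + r\<^sup>2)) ^ N" by (intro power_mono) auto
    also have "(2 * (1 + r\<^sup>2)) = (2 / c) * (c * (1 + r\<^sup>2))" using c by simp
    also have "(\<dots>) ^ N = (2 / c) ^ N * (c * (1 + r\<^sup>2)) ^ N" by (rule power_mult_distrib)
    also have "(c * (1 + r\<^sup>2)) ^ N \<le> real N ^ N * exp (c * (1 + r\<^sup>2))"
    proof -
      have "(c * (1 + r\<^sup>2) / N) ^ N \<le> (1 + c * (1 + r\<^sup>2) / N) ^ N" using c by (intro power_mono) auto
      also have "\<dots> \<le> exp (c * (1 + r\<^sup>2))"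
        using c that(2) by (intro exp_ge_one_plus_x_over_n_power_n) (auto intro: order_trans[of _ 0])
      finally show ?thesis using that(2) by (simp add: power_divide field_simps)
    qed
    finally have "((1 + r)\<^sup>2) ^ N \<le> (2 / c) ^ N * (real N ^ N * exp (c * (1 + r\<^sup>2)))"
      using c by (simp add: mult_left_mono)
    hence "((1 + r)\<^sup>2) ^ N * exp (- (c * r\<^sup>2)) \<le> (2 / c) ^ N * (real N ^ N * exp (c * (1 + r\<^sup>2))) * exp (- (c * r\<^sup>2))"
      by (intro mult_right_mono) auto
    also have "\<dots> = (2 / c) ^ N * (real N ^ N * exp c)"
      by (simp add: exp_add[symmetric] algebra_simps)
    finally show ?thesis by (simp add: power_mult)
  qed
  have "(1 + r) ^ N * exp (- (c * r\<^sup>2)) \<le> max 1 ((2 / c) ^ N * (real N ^ N * exp c))" if "r \<ge> 0" for r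
  proof (cases "N = 0")
    case True
    have "exp (- (c * r\<^sup>2)) \<le> 1" using c by simp
    thus ?thesis unfolding True by (simp only: power_0 mult_1 le_max_iff_disj simp_thms)
  next
    case False
    have "(1 + r) ^ N \<le> (1 + r) ^ (2 * N)" using that by (intro power_increasing) auto
    hence "(1 + r) ^ N * exp (- (c * r\<^sup>2)) \<le> (1 + r) ^ (2 * N) * exp (- (c * r\<^sup>2))" by (intro mult_right_mono) auto
    also have "\<dots> \<le> (2 / c) ^ N * (real N ^ N * exp c)" using main that False by blast
    finally show ?thesis by simp
  qed
  thus ?thesis by blast
qed

text \<open>Schwartz decay without conditions on derivatives; polynomials times Gaussians are the
  instances.\<close>

definition rapid :: "(real ^ 'n \<Rightarrow> complex) \<Rightarrow> bool" where
  "rapid f \<longleftrightarrow> continuous_on UNIV f \<and> (\<forall>N. \<exists>C. \<forall>x. norm (f x) * (1 + norm x) ^ N \<le> C)"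

lemma rapid_polynomial_gauss:
  fixes p :: "real ^ 'n \<Rightarrow> real"
  assumes p: "real_polynomial_function p" and t: "t > 0"
  shows "rapid (\<lambda>u. of_real (p u * gauss t u))"
  unfolding rapid_def
proof (intro conjI allI)
  show "continuous_on UNIV (\<lambda>u. complex_of_real (p u * gauss t u))"
    by (intro continuous_on_of_real continuous_on_mult continuous_on_gauss continuous_on_real_polynomial_function[OF p])
  fix N
  obtain C k where C: "C \<ge> 0" "\<And>x. \<bar>p x\<bar> \<le> C * (1 + norm x) ^ k" using polynomial_growth[OF p] by blast
  obtain B where B: "\<And>r. r \<ge> 0 \<Longrightarrow> (1 + r) ^ (k + N) * exp (- ((pi * t) * r\<^sup>2)) \<le> B"
    using exp_neg_square_bound[of "pi * t" "k + N"] mult_pos_pos[OF pi_gt_zero t] by blast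
  have "norm (complex_of_real (p x * gauss t x)) * (1 + norm x) ^ N \<le> C * B" for x
  proof -
    have g: "gauss t x = exp (- ((pi * t) * (norm x)\<^sup>2))" by (simp add: gauss_def dot_square_norm)
    have "norm (complex_of_real (p x * gauss t x)) * (1 + norm x) ^ N = \<bar>p x\<bar> * (gauss t x * (1 + norm x) ^ N)"
      by (simp add: norm_mult g)
    also have "\<dots> \<le> (C * (1 + norm x) ^ k) * (gauss t x * (1 + norm x) ^ N)"
      by (intro mult_right_mono C(2)) (simp add: g)
    also have "\<dots> = C * ((1 + norm x) ^ (k + N) * exp (- ((pi * t) * (norm x)\<^sup>2)))"
      by (simp add: g power_add)
    also have "\<dots> \<le> C * B" by (intro mult_left_mono B C) auto
    finally show ?thesis .
  qed
  thus "\<exists>C. \<forall>x. norm (complex_of_real (p x * gauss t x)) * (1 + norm x) ^ N \<le> C" by blast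
qed

lemma rapid_powr_bound:
  fixes f :: "real ^ 'n \<Rightarrow> complex"
  assumes "rapid f"
  shows "\<exists>C\<ge>0. \<forall>x. norm (f x) \<le> C * (1 + norm x) powr (- real N)"
proof -
  obtain C where C: "\<And>x. norm (f x) * (1 + norm x) ^ N \<le> C" using assms by (auto simp: rapid_def)
  have "norm (f 0) \<le> C" using C[of 0] by simp
  with norm_ge_zero[of "f 0"] have "C \<ge> 0" by linarith
  moreover have "norm (f x) \<le> C * (1 + norm x) powr (- real N)" for x
  proof -
    have "(1 + norm x) powr (real N) = (1 + norm x) ^ N" by (rule powr_realpow) (simp add: add_pos_nonneg)
    moreover have "(1 + norm x) ^ N > 0" by (simp add: add_pos_nonneg)
    ultimately show ?thesis using C[of x]
      by (metis powr_minus divide_inverse pos_le_divide_eq)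
  qed
  ultimately show ?thesis by blast
qed

lemma rapid_periodisable:
  fixes f :: "real ^ 'n \<Rightarrow> complex" and A :: "real ^ 'n ^ 'n"
  assumes f: "rapid f" and A: "invertible A"
  shows "periodisable (\<lambda>u. f (A *v u))"
  unfolding periodisable_def
proof (intro conjI allI)
  show "continuous_on UNIV (\<lambda>u. f (A *v u))"
  proof (rule continuous_on_compose2[of UNIV f])
    show "continuous_on UNIV f" using f by (simp add: rapid_def)
    show "continuous_on UNIV ((*v) A)"
      by (rule linear_continuous_on[OF matrix_vector_mul_bounded_linear])
  qed simp
  fix R :: real
  \<comment> \<open>With this exponent each coordinate receives (d + 1) / d > 1, so the
    one-dimensional sums converge.\<close>
  let ?N = "CARD('n) + 1"
  obtain C where C: "C \<ge> 0" "\<And>x. norm (f x) \<le> C * (1 + norm x) powr (- real ?N)"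
    using rapid_powr_bound[OF f] by blast
  obtain K where K: "K > 0" "\<And>w. norm (A *v w) \<le> norm w * K"
    using bounded_linear.pos_bounded[OF matrix_vector_mul_bounded_linear[of A]] by auto
  obtain B where B: "B \<ge> 0" "\<And>m v. norm v \<le> \<bar>R\<bar> * K \<Longrightarrow>
    (1 + norm (A *v m + v)) powr (- real ?N) \<le> B * (\<Prod>j\<in>UNIV. (1 + \<bar>m $ j\<bar>) powr (-(real ?N / CARD('n))))"
    using lattice_powr_bound[OF A, of "real ?N" "\<bar>R\<bar> * K"] by auto
  let ?M = "\<lambda>m::real^'n. C * (B * (\<Prod>j\<in>UNIV. (1 + \<bar>m $ j\<bar>) powr (-(real ?N / CARD('n)))))"
  show "\<exists>M. M summable_on int_vec \<and> (\<forall>m\<in>int_vec. \<forall>x. norm x \<le> R \<longrightarrow> norm (f (A *v (m + x))) \<le> M m)"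
  proof (intro exI[of _ ?M] conjI ballI allI impI)
    show "?M summable_on int_vec"
      by (intro summable_on_cmult_right summable_on_int_vec_prod[of "\<lambda>t. (1 + \<bar>t\<bar>) powr (-(real ?N / CARD('n)))"] summable_on_Ints_powr) auto
    fix m x :: "real^'n" assume x: "norm x \<le> R"
    have "norm (A *v x) \<le> norm x * K" by (rule K(2))
    also have "\<dots> \<le> \<bar>R\<bar> * K" using x K(1) by (intro mult_right_mono) auto
    finally have "C * (1 + norm (A *v m + A *v x)) powr (- real ?N) \<le> ?M m"
      by (intro mult_left_mono B C)
    thus "norm (f (A *v (m + x))) \<le> ?M m"
      using C(2)[of "A *v (m + x)"] by (simp add: matrix_vector_right_distrib)
  qed
qed

lemma rapid_summable:
  fixes f :: "real ^ 'n \<Rightarrow> complex" and A :: "real ^ 'n ^ 'n"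
  assumes f: "rapid f" and A: "invertible A"
  shows "(\<lambda>m. norm (f (A *v m + v))) summable_on int_vec"
proof -
  let ?N = "CARD('n) + 1"
  obtain C where C: "C \<ge> 0" "\<And>x. norm (f x) \<le> C * (1 + norm x) powr (- real ?N)"
    using rapid_powr_bound[OF f] by blast
  have "(\<lambda>m. C * (1 + norm (A *v m + v)) powr (- real ?N)) summable_on int_vec"
    using lattice_summable[OF A, of "real ?N" v] by (intro summable_on_cmult_right) simp
  thus ?thesis by (rule summable_on_comparison_test) (use C in auto)
qed

text \<open>Integrability comes from periodisability along the integer lattice, that is, for the
  identity matrix.\<close>

lemma rapid_wave_integrable:
  fixes f :: "real ^ 'n \<Rightarrow> complex"
  assumes "rapid f"
  shows "integrable lborel (\<lambda>u. f u * wave k u)"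
proof -
  have "mat 1 ** mat 1 = (mat 1 :: real^'n^'n)" by (rule matrix_mul_lid)
  hence "invertible (mat 1 :: real^'n^'n)" unfolding invertible_def by blast
  from rapid_periodisable[OF assms this] have "periodisable f" by (simp only: matrix_vector_mul_lid)
  thus ?thesis by (rule periodisable_integrable[OF periodisable_mult_wave])
qed

text \<open>The integral of F (x + e) - F x over x is 0 by translation invariance. The fundamental
  theorem along s in [0, 1] and Fubini turn it into the integral of F'. In this way no boundary
  terms at infinity arise.\<close>

lemma integral_directional_derivative:
  fixes F F' :: "'a::euclidean_space \<Rightarrow> complex"
  assumes F: "integrable lborel F" and F': "integrable lborel F'" and cont: "continuous_on UNIV F'"
    and deriv: "\<And>x s. ((\<lambda>s. F (x + s *\<^sub>R e)) has_vector_derivative F' (x + s *\<^sub>R e)) (at s)"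
  shows "(\<integral>x. F' x \<partial>lborel) = 0"
proof -
  define f where "f = (\<lambda>(s::real, x). indicator {0..1} s *\<^sub>R F' (s *\<^sub>R e + x))"
  have [measurable]: "F' \<in> borel_measurable borel" "F \<in> borel_measurable borel"
    using F F' by auto
  have fm: "f \<in> borel_measurable (lborel \<Otimes>\<^sub>M lborel)"
    unfolding f_def by measurable
  have int: "integrable (lborel \<Otimes>\<^sub>M lborel) f"
  proof (rule lborel_pair.Fubini_integrable[OF fm])
    have "(\<lambda>s. \<integral>x. norm (f (s, x)) \<partial>lborel) = (\<lambda>s. indicator {0..1} s *\<^sub>R (\<integral>x. norm (F' x) \<partial>lborel))"
    proof
      fix s
      show "(\<integral>x. norm (f (s, x)) \<partial>lborel) = indicator {0..1} s *\<^sub>R (\<integral>x. norm (F' x) \<partial>lborel)"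
        using integral_translate[of "\<lambda>x. norm (F' x)" "s *\<^sub>R e"] by (simp add: f_def)
    qed
    thus "integrable lborel (\<lambda>s. \<integral>x. norm (f (s, x)) \<partial>lborel)"
      by (simp only:) (intro borel_integrable_compact continuous_intros, auto)
    show "AE s in lborel. integrable lborel (\<lambda>x. f (s, x))"
      using integrable_translate[of F'] F' by (auto simp: f_def)
  qed
  have "(\<integral>x. (\<integral>s. f (s, x) \<partial>lborel) \<partial>lborel) = (\<integral>s. (\<integral>x. f (s, x) \<partial>lborel) \<partial>lborel)"
    using lborel_pair.Fubini_integral[of "\<lambda>s x. f (s, x)"] int by simp
  also have "(\<lambda>s. \<integral>x. f (s, x) \<partial>lborel) = (\<lambda>s. indicator {0..1} s *\<^sub>R (\<integral>x. F' x \<partial>lborel))"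
    using integral_translate[of F'] by (auto simp: f_def fun_eq_iff)
  also have "(\<integral>s. indicator {0..1::real} s *\<^sub>R (\<integral>x. F' x \<partial>lborel) \<partial>lborel) = (\<integral>x. F' x \<partial>lborel)"
    by simp
  finally have "(\<integral>x. F' x \<partial>lborel) = (\<integral>x. (\<integral>s. f (s, x) \<partial>lborel) \<partial>lborel)" ..
  also have "(\<lambda>x. \<integral>s. f (s, x) \<partial>lborel) = (\<lambda>x. F (e + x) - F x)"
  proof
    fix x
    have "(\<integral>s. indicator {0..1} s *\<^sub>R F' (x + s *\<^sub>R e) \<partial>lborel) = F (x + 1 *\<^sub>R e) - F (x + 0 *\<^sub>R e)"
      by (rule integral_FTC_Icc[where F="\<lambda>s. F (x + s *\<^sub>R e)"])
         (auto intro!: has_vector_derivative_at_within deriv continuous_on_compose2[OF cont] continuous_intros)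
    thus "(\<integral>s. f (s, x) \<partial>lborel) = F (e + x) - F x" by (simp add: f_def add.commute)
  qed
  also have "(\<integral>x. F (e + x) - F x \<partial>lborel) = (\<integral>x. F (e + x) \<partial>lborel) - (\<integral>x. F x \<partial>lborel)"
    using integrable_translate[of F e] F by (intro Bochner_Integration.integral_diff) auto
  also have "\<dots> = 0" using integral_translate[of F e] by simp
  finally show ?thesis .
qed

section \<open>Hecke's identity for harmonic polynomials\<close>

definition gauss_fourier :: "real \<Rightarrow> (real ^ 'n \<Rightarrow> real) \<Rightarrow> real ^ 'n \<Rightarrow> complex" where
  "gauss_fourier t f q = (\<integral>u. of_real (f u * gauss t u) * wave (- q) u \<partial>lborel)"

lemma gauss_DERIV:
  "((\<lambda>s. gauss t (x + s *\<^sub>R axis j 1)) has_field_derivative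
     - 2 * pi * t * (x + s *\<^sub>R axis j 1) $ j * gauss t (x + s *\<^sub>R axis j 1)) (at s)"
proof -
  have eq: "(x + s *\<^sub>R axis j 1) \<bullet> (x + s *\<^sub>R axis j 1) = x \<bullet> x + 2 * s * x $ j + s\<^sup>2" for s
    by (simp add: inner_add_left inner_add_right inner_axis inner_commute[of "axis j 1"] power2_eq_square algebra_simps)
  have nth: "(x + s *\<^sub>R axis j 1) $ j = x $ j + s" by simp
  show ?thesis unfolding gauss_def eq nth
    by (auto intro!: derivative_eq_intros simp: algebra_simps)
qed

lemma wave_has_vector_derivative:
  "((\<lambda>s. wave k (x + s *\<^sub>R axis j 1)) has_vector_derivative
     (2 * pi * \<i> * of_real (k $ j)) * wave k (x + s *\<^sub>R axis j 1)) (at s)"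
proof -
  have eq: "wave k (x + s *\<^sub>R axis j 1) = exp (\<i> * of_real (2 * pi * (k \<bullet> x)) + (2 * pi * \<i> * of_real (k $ j)) * of_real s)" for s
    by (simp add: wave_def cis_conv_exp inner_add_right inner_axis algebra_simps)
  show ?thesis unfolding eq
    by (rule has_vector_derivative_real_field[where f="\<lambda>s. exp (\<i> * of_real (2 * pi * (k \<bullet> x)) + (2 * pi * \<i> * of_real (k $ j)) * s)"])
       (auto intro!: derivative_eq_intros simp: mult.commute)
qed

text \<open>Integration by parts: the integral of the j-th derivative of p times Gaussian times wave
  vanishes, and the product rule splits it into the three transforms.\<close>

lemma gauss_fourier_partial_deriv:
  fixes p :: "real ^ 'n \<Rightarrow> real"
  assumes p: "real_polynomial_function p" and t: "t > 0"
  shows "gauss_fourier t (partial_deriv j p) q =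
     2 * pi * t * gauss_fourier t (\<lambda>u. u $ j * p u) q + 2 * pi * \<i> * of_real (q $ j) * gauss_fourier t p q"
proof -
  note int = rapid_wave_integrable[OF rapid_polynomial_gauss[OF _ t]]
  have i1: "integrable lborel (\<lambda>u. of_real (partial_deriv j p u * gauss t u) * wave (- q) u)"
    by (intro int real_polynomial_function_partial_deriv p)
  have i2: "integrable lborel (\<lambda>u. of_real ((u $ j * p u) * gauss t u) * wave (- q) u)"
    by (intro int rpf_mult real_polynomial_function_nth p)
  have i3: "integrable lborel (\<lambda>u. of_real (p u * gauss t u) * wave (- q) u)"
    by (intro int p)
  define F' where "F' u = of_real (partial_deriv j p u * gauss t u) * wave (- q) u
      - 2 * pi * t * (of_real ((u $ j * p u) * gauss t u) * wave (- q) u)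
      - 2 * pi * \<i> * of_real (q $ j) * (of_real (p u * gauss t u) * wave (- q) u)" for u
  have "(\<integral>u. F' u \<partial>lborel) = 0"
  proof (rule integral_directional_derivative[OF i3])
    show "integrable lborel F'"
      unfolding F'_def by (intro Bochner_Integration.integrable_diff integrable_mult_right i1 i2 i3)
    show "continuous_on UNIV F'"
      unfolding F'_def
      by (intro continuous_intros continuous_on_real_polynomial_function real_polynomial_function_partial_deriv p real_polynomial_function_nth)
    show "((\<lambda>s. of_real (p (x + s *\<^sub>R axis j 1) * gauss t (x + s *\<^sub>R axis j 1)) * wave (- q) (x + s *\<^sub>R axis j 1))
       has_vector_derivative F' (x + s *\<^sub>R axis j 1)) (at s)" for x s
    proof (rule has_vector_derivative_eq_rhs)
      show "((\<lambda>s. of_real (p (x + s *\<^sub>R axis j 1) * gauss t (x + s *\<^sub>R axis j 1)) * wave (- q) (x + s *\<^sub>R axis j 1))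
         has_vector_derivative
         (of_real (p (x + s *\<^sub>R axis j 1) * gauss t (x + s *\<^sub>R axis j 1)) *
           ((2 * pi * \<i> * of_real ((- q) $ j)) * wave (- q) (x + s *\<^sub>R axis j 1)) +
          of_real (partial_deriv j p (x + s *\<^sub>R axis j 1) * gauss t (x + s *\<^sub>R axis j 1) +
            - 2 * pi * t * (x + s *\<^sub>R axis j 1) $ j * gauss t (x + s *\<^sub>R axis j 1) * p (x + s *\<^sub>R axis j 1)) *
          wave (- q) (x + s *\<^sub>R axis j 1))) (at s)"
        by (intro has_vector_derivative_mult wave_has_vector_derivative has_vector_derivative_of_real
             has_real_derivative_iff_has_vector_derivative[THEN iffD1] DERIV_mult partial_deriv_DERIV[OF p] gauss_DERIV)
      show "of_real (p (x + s *\<^sub>R axis j 1) * gauss t (x + s *\<^sub>R axis j 1)) *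
           ((2 * pi * \<i> * of_real ((- q) $ j)) * wave (- q) (x + s *\<^sub>R axis j 1)) +
          of_real (partial_deriv j p (x + s *\<^sub>R axis j 1) * gauss t (x + s *\<^sub>R axis j 1) +
            - 2 * pi * t * (x + s *\<^sub>R axis j 1) $ j * gauss t (x + s *\<^sub>R axis j 1) * p (x + s *\<^sub>R axis j 1)) *
          wave (- q) (x + s *\<^sub>R axis j 1) = F' (x + s *\<^sub>R axis j 1)"
        unfolding F'_def by (simp add: algebra_simps)
    qed
  qed
  moreover have "(\<integral>u. F' u \<partial>lborel) = gauss_fourier t (partial_deriv j p) q
      - 2 * pi * t * gauss_fourier t (\<lambda>u. u $ j * p u) q - 2 * pi * \<i> * of_real (q $ j) * gauss_fourier t p q"
    unfolding F'_def gauss_fourier_def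
    by (subst Bochner_Integration.integral_diff, intro Bochner_Integration.integrable_diff integrable_mult_right i1 i2,
        intro integrable_mult_right i3, subst Bochner_Integration.integral_diff, intro i1, intro integrable_mult_right i2)
       (simp only: integral_mult_right_zero)
  ultimately show ?thesis by (simp add: algebra_simps)
qed

lemma gauss_fourier_sum:
  fixes f :: "'i \<Rightarrow> real ^ 'n \<Rightarrow> real"
  assumes "\<And>i. i \<in> I \<Longrightarrow> real_polynomial_function (f i)" and t: "t > 0"
  shows "gauss_fourier t (\<lambda>u. \<Sum>i\<in>I. f i u) q = (\<Sum>i\<in>I. gauss_fourier t (f i) q)"
  unfolding gauss_fourier_def sum_distrib_right of_real_sum
  by (rule Bochner_Integration.integral_sum) (intro rapid_wave_integrable rapid_polynomial_gauss assms)

text \<open>Euler's identity writes (m + 1) f as \<Sum> u_j \<partial>_j f; integration by parts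
  trades each factor u_j for the frequency q_j and a second partial derivative. The second partials
  add up to the Laplacian of f and drop out, the first partials are harmonic of degree m, and
  Euler's identity at q reassembles f.\<close>

theorem gauss_fourier_harmonic:
  fixes f :: "real ^ 'n \<Rightarrow> real"
  assumes "harmonic_homogeneous m f" and t: "t > 0"
  shows "gauss_fourier t f q = (- \<i> / of_real t) ^ m * of_real (f q * (gauss (1 / t) q * (1 / sqrt t) ^ CARD('n)))"
  using assms(1)
proof (induction m arbitrary: f)
  case 0
  hence "f = (\<lambda>x. f 0)" by (intro homogeneous_0_const) (simp add: harmonic_homogeneous_def)
  then obtain c where c: "f = (\<lambda>x. c)" by blast
  show ?case
    unfolding gauss_fourier_def c of_real_mult mult.assoc integral_mult_right_zero integral_gauss_wave[OF t] by simp
next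
  case (Suc m)
  let ?K = "gauss (1 / t) q * (1 / sqrt t) ^ CARD('n)"
  have f: "real_polynomial_function f" and harm: "\<And>x. laplacian f x = 0" and hom: "homogeneous_of_degree (Suc m) f"
    using Suc.prems by (auto simp: harmonic_homogeneous_def)
  note df = real_polynomial_function_partial_deriv[OF f]
  have "of_nat (Suc m) * gauss_fourier t f q = gauss_fourier t (\<lambda>u. real (Suc m) * f u) q"
    unfolding gauss_fourier_def by (simp only: of_real_mult mult.assoc integral_mult_right_zero of_real_of_nat_eq)
  also have "(\<lambda>u. real (Suc m) * f u) = (\<lambda>u. \<Sum>j\<in>UNIV. u $ j * partial_deriv j f u)"
    using homogeneous_sum_partial_deriv[OF f hom] by (intro ext) simp
  also have "gauss_fourier t \<dots> q = (\<Sum>j\<in>UNIV. gauss_fourier t (\<lambda>u. u $ j * partial_deriv j f u) q)"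
    by (intro gauss_fourier_sum t rpf_mult real_polynomial_function_nth df)
  also have "\<dots> = (\<Sum>j\<in>UNIV. (gauss_fourier t (partial_deriv j (partial_deriv j f)) q
      - 2 * pi * \<i> * of_real (q $ j) * gauss_fourier t (partial_deriv j f) q) / (2 * pi * t))"
  proof (intro sum.cong refl)
    fix j
    have "complex_of_real (2 * pi * t) \<noteq> 0" using t by simp
    thus "gauss_fourier t (\<lambda>u. u $ j * partial_deriv j f u) q = (gauss_fourier t (partial_deriv j (partial_deriv j f)) q
      - 2 * pi * \<i> * of_real (q $ j) * gauss_fourier t (partial_deriv j f) q) / (2 * pi * t)"
      using gauss_fourier_partial_deriv[OF df t, of j j q] by (simp add: field_simps)
  qed
  also have "\<dots> = ((\<Sum>j\<in>UNIV. gauss_fourier t (partial_deriv j (partial_deriv j f)) q)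
      - (\<Sum>j\<in>UNIV. 2 * pi * \<i> * of_real (q $ j) * gauss_fourier t (partial_deriv j f) q)) / (2 * pi * t)"
    by (simp only: sum_divide_distrib[symmetric] sum_subtractf)
  also have "(\<Sum>j\<in>UNIV. gauss_fourier t (partial_deriv j (partial_deriv j f)) q) = gauss_fourier t (laplacian f) q"
    unfolding laplacian_def[abs_def]
    by (intro gauss_fourier_sum[symmetric] t real_polynomial_function_partial_deriv df)
  also have "\<dots> = 0" unfolding gauss_fourier_def harm by simp
  also have "(\<Sum>j\<in>UNIV. 2 * pi * \<i> * of_real (q $ j) * gauss_fourier t (partial_deriv j f) q) =
      (\<Sum>j\<in>UNIV. (2 * pi * \<i> * ((- \<i> / of_real t) ^ m * of_real ?K)) * of_real (q $ j * partial_deriv j f q))"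
    using Suc.IH[OF harmonic_homogeneous_partial_deriv[OF Suc.prems]]
    by (intro sum.cong refl) simp
  also have "\<dots> = (2 * pi * \<i> * ((- \<i> / of_real t) ^ m * of_real ?K)) * of_real (real (Suc m) * f q)"
    unfolding sum_distrib_left[symmetric] of_real_sum[symmetric] homogeneous_sum_partial_deriv[OF f hom] ..
  also have "(0 - (2 * pi * \<i> * ((- \<i> / of_real t) ^ m * of_real ?K)) * of_real (real (Suc m) * f q)) / (2 * pi * t) =
      of_nat (Suc m) * ((- \<i> / of_real t) ^ Suc m * of_real (f q * ?K))"
    using t by (simp add: field_simps)
  finally show ?case by (simp only: mult_cancel_left of_nat_eq_0_iff nat.distinct simp_thms)
qed

section \<open>Mellin transforms of theta sums\<close>

text \<open>The Gamma integral and the one-dimensional change of variables are facts about the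
  completed measure; this lemma and the next pass to it and back.\<close>

lemma set_integrable_lborel_imp_lebesgue:
  fixes f :: "'a::euclidean_space \<Rightarrow> 'b::euclidean_space"
  assumes "set_integrable lborel E f"
  shows "f absolutely_integrable_on E"
  using assms unfolding set_integrable_def by (rule integrable_completion[THEN iffD2, rotated]) (use assms in \<open>auto simp: set_integrable_def\<close>)

lemma set_integrable_lebesgue_imp_lborel:
  fixes f :: "'a::euclidean_space \<Rightarrow> 'b::euclidean_space"
  assumes "f absolutely_integrable_on E" "(\<lambda>x. indicator E x *\<^sub>R f x) \<in> borel_measurable borel"
  shows "set_integrable lborel E f"
  using assms unfolding set_integrable_def by (subst (asm) integrable_completion) auto

text \<open>The integrand of Gamma s times c^(-s) on the positive half-line; over [1, \<infinity>)
  with c = \<pi> |z|^2 it gives the Crandall function of index 2 s.\<close>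

definition mellin_kernel :: "complex \<Rightarrow> real \<Rightarrow> real \<Rightarrow> complex" where
  "mellin_kernel s c u = of_real u powr (s - 1) * of_real (exp (- (c * u)))"

lemma mellin_kernel_1: "mellin_kernel s 1 = (\<lambda>t. of_real t powr (s - 1) / of_real (exp t))"
  by (simp add: mellin_kernel_def fun_eq_iff exp_minus divide_inverse)

lemma measurable_of_real_powr [measurable]:
  "(\<lambda>u. complex_of_real u powr s) \<in> borel_measurable borel"
proof -
  have "(\<lambda>u. if u = 0 then 0 else exp (s * Ln (complex_of_real u))) \<in> borel_measurable borel"
    by measurable
  thus ?thesis by (simp add: powr_def cong: if_cong)
qed

lemma measurable_mellin_kernel [measurable]: "mellin_kernel s c \<in> borel_measurable borel"
  unfolding mellin_kernel_def by measurable

lemma norm_mellin_kernel: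
  "u > 0 \<Longrightarrow> norm (mellin_kernel s c u) = u powr (Re s - 1) * exp (- (c * u))"
  by (simp add: mellin_kernel_def norm_mult norm_powr_real_powr)

lemma mellin_kernel_of_real:
  "u > 0 \<Longrightarrow> mellin_kernel (of_real \<sigma>) c u = of_real (u powr (\<sigma> - 1) * exp (- (c * u)))"
  by (simp add: mellin_kernel_def powr_of_real[symmetric])

lemma mellin_kernel_scale:
  assumes "c > 0" "u > 0"
  shows "mellin_kernel s 1 (c * u) = of_real c powr (s - 1) * mellin_kernel s c u"
proof -
  have "complex_of_real (c * u) powr (s - 1) = of_real c powr (s - 1) * of_real u powr (s - 1)"
    using assms by (simp add: powr_times_real)
  thus ?thesis by (simp add: mellin_kernel_def)
qed

text \<open>The substitution t = c u. It serves the half-line as well as the tail from c, where the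
  incomplete Gamma function lives.\<close>

lemma integral_mellin_kernel_scale:
  assumes c: "c > 0" and E: "E \<subseteq> {0<..}" and E': "\<And>u. c * u \<in> E' \<longleftrightarrow> u \<in> E"
  shows "(LINT t:E'|lborel. mellin_kernel s 1 t) = of_real c powr s * (LINT u:E|lborel. mellin_kernel s c u)"
proof -
  have "(LINT t:E'|lborel. mellin_kernel s 1 t) =
      \<bar>c\<bar> *\<^sub>R (\<integral>u. indicator E' (0 + c * u) *\<^sub>R mellin_kernel s 1 (0 + c * u) \<partial>lborel)"
    unfolding set_lebesgue_integral_def using c by (intro lborel_integral_real_affine) auto
  also have "(\<lambda>u. indicator E' (0 + c * u) *\<^sub>R mellin_kernel s 1 (0 + c * u)) =
      (\<lambda>u. of_real c powr (s - 1) * (indicator E u *\<^sub>R mellin_kernel s c u))"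
  proof
    fix u
    show "indicator E' (0 + c * u) *\<^sub>R mellin_kernel s 1 (0 + c * u) =
      of_real c powr (s - 1) * (indicator E u *\<^sub>R mellin_kernel s c u)"
    proof (cases "u \<in> E")
      case True
      hence u: "u > 0" "c * u \<in> E'" using E E' by auto
      thus ?thesis using True mellin_kernel_scale[OF c u(1), of s] by simp
    next
      case False
      thus ?thesis using E'[of u] by simp
    qed
  qed
  also have "\<bar>c\<bar> *\<^sub>R (\<integral>u. of_real c powr (s - 1) * (indicator E u *\<^sub>R mellin_kernel s c u) \<partial>lborel) =
     (of_real c * of_real c powr (s - 1)) * (LINT u:E|lborel. mellin_kernel s c u)"
    using c unfolding set_lebesgue_integral_def integral_mult_right_zero by (simp add: scaleR_conv_of_real)
  also have "of_real c * of_real c powr (s - 1) = complex_of_real c powr s"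
    using c by (simp add: powr_diff)
  finally show ?thesis .
qed

lemma
  assumes s: "Re s > 0" and c: "c > 0"
  shows set_integrable_mellin_kernel: "set_integrable lborel {0<..} (mellin_kernel s c)"
    and integral_mellin_kernel: "(LINT u:{0<..}|lborel. mellin_kernel s c u) = Gamma s * of_real c powr (- s)"
proof -
  have int: "set_integrable lborel {0<..} (mellin_kernel s c)" if "c > 0" for c
  proof -
    have "mellin_kernel s c = (\<lambda>t. of_real t powr (s - 1) / of_real (exp (c * t)))"
      by (simp add: mellin_kernel_def fun_eq_iff exp_minus divide_inverse)
    hence "mellin_kernel s c absolutely_integrable_on {0<..}"
      using absolutely_integrable_Gamma_integral[OF s that] by simp
    thus ?thesis by (rule set_integrable_lebesgue_imp_lborel) auto
  qed
  show "set_integrable lborel {0<..} (mellin_kernel s c)" by (rule int[OF c])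
  have "integral {0<..} (mellin_kernel s 1) = Gamma s"
    using Gamma_integral_complex'[OF s] unfolding mellin_kernel_1 by (rule integral_unique)
  hence "(LINT u:{0<..}|lborel. mellin_kernel s 1 u) = Gamma s"
    using set_borel_integral_eq_integral(2)[OF int[of 1]] by simp
  moreover have "(LINT u:{0<..}|lborel. mellin_kernel s 1 u) =
      of_real c powr s * (LINT u:{0<..}|lborel. mellin_kernel s c u)"
    by (rule integral_mellin_kernel_scale[OF c]) (use c in \<open>auto simp: zero_less_mult_iff\<close>)
  ultimately show "(LINT u:{0<..}|lborel. mellin_kernel s c u) = Gamma s * of_real c powr (- s)"
    using c by (simp add: powr_minus field_simps)
qed

text \<open>All convergence questions on \<open>E\<close> are reduced to the full Mellin transform at \<open>\<sigma>\<close>.\<close>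
definition mellin_dominated :: "real set \<Rightarrow> complex \<Rightarrow> real \<Rightarrow> bool" where
  "mellin_dominated E s \<sigma> \<longleftrightarrow> E \<in> sets borel \<and> E \<subseteq> {0<..} \<and> \<sigma> > 0 \<and>
     (\<forall>u\<in>E. u powr (Re s - 1) \<le> u powr (\<sigma> - 1))"

lemma mellin_dominated_full: "Re s > 0 \<Longrightarrow> mellin_dominated {0<..} s (Re s)"
  by (simp add: mellin_dominated_def)

lemma mellin_dominated_tail: "\<sigma> > 0 \<Longrightarrow> Re s \<le> \<sigma> \<Longrightarrow> mellin_dominated {1..} s \<sigma>"
  by (auto simp: mellin_dominated_def intro!: powr_mono)

text \<open>On E the kernel is bounded by the real kernel with exponent \<sigma>, whose integral
  over the half-line is known. The power c^(-\<sigma>) in the bound, with c proportional to |z|^2,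
  later makes the lattice sum converge.\<close>

lemma
  assumes E: "mellin_dominated E s \<sigma>" and c: "c > 0"
  shows mellin_dominated_integrable: "set_integrable lborel E (mellin_kernel s c)"
    and mellin_dominated_bound:
      "(\<integral>u. norm (indicator E u *\<^sub>R mellin_kernel s c u) \<partial>lborel) \<le> Gamma \<sigma> * c powr (- \<sigma>)"
proof -
  have E': "E \<in> sets borel" "E \<subseteq> {0<..}" "\<sigma> > 0" and le: "\<And>u. u \<in> E \<Longrightarrow> u powr (Re s - 1) \<le> u powr (\<sigma> - 1)"
    using E by (auto simp: mellin_dominated_def)
  let ?g = "\<lambda>u. indicator {0<..} u *\<^sub>R (u powr (\<sigma> - 1) * exp (- (c * u)))"
  have eq: "complex_of_real (?g u) = indicator {0<..} u *\<^sub>R mellin_kernel (of_real \<sigma>) c u" for u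
    using mellin_kernel_of_real[of u \<sigma> c] by (cases "u > 0") auto
  have \<sigma>: "Re (complex_of_real \<sigma>) > 0" using E' by simp
  have "integrable lborel (\<lambda>u. complex_of_real (?g u))"
    unfolding eq using set_integrable_mellin_kernel[OF \<sigma> c] by (simp add: set_integrable_def)
  from integrable_Re[OF this] have gint: "integrable lborel ?g" by (simp only: Re_complex_of_real)
  have "complex_of_real (\<integral>u. ?g u \<partial>lborel) = (\<integral>u. complex_of_real (?g u) \<partial>lborel)"
    by (rule integral_complex_of_real[symmetric])
  also have "\<dots> = Gamma (of_real \<sigma>) * of_real c powr (- of_real \<sigma>)"
    unfolding eq using integral_mellin_kernel[OF \<sigma> c] by (simp add: set_lebesgue_integral_def)
  also have "\<dots> = of_real (Gamma \<sigma> * c powr (- \<sigma>))"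
    using c by (simp add: Gamma_complex_of_real powr_of_real[symmetric])
  finally have gval: "(\<integral>u. ?g u \<partial>lborel) = Gamma \<sigma> * c powr (- \<sigma>)" by (simp only: of_real_eq_iff)
  have bound: "norm (indicator E u *\<^sub>R mellin_kernel s c u) \<le> ?g u" for u
  proof (cases "u \<in> E")
    case True
    thus ?thesis using E'(2) le[OF True] by (auto simp: norm_mellin_kernel)
  qed auto
  show int: "set_integrable lborel E (mellin_kernel s c)"
    unfolding set_integrable_def
  proof (rule Bochner_Integration.integrable_bound[OF gint])
    show "(\<lambda>u. indicator E u *\<^sub>R mellin_kernel s c u) \<in> borel_measurable lborel"
      using E'(1) by measurable
    show "AE u in lborel. norm (indicator E u *\<^sub>R mellin_kernel s c u) \<le> norm (?g u)"
      using bound by (auto intro!: AE_I2 order_trans[OF bound] simp del: norm_scaleR)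
  qed
  have "(\<integral>u. norm (indicator E u *\<^sub>R mellin_kernel s c u) \<partial>lborel) \<le> (\<integral>u. ?g u \<partial>lborel)"
    by (rule integral_mono[OF integrable_norm[OF int[unfolded set_integrable_def]] gint bound])
  thus "(\<integral>u. norm (indicator E u *\<^sub>R mellin_kernel s c u) \<partial>lborel) \<le> Gamma \<sigma> * c powr (- \<sigma>)"
    unfolding gval .
qed

text \<open>The origin is left out: its term is constant in u and has no Mellin transform on the
  half-line, so it is carried separately.\<close>

definition theta_sum :: "(real ^ 'n) set \<Rightarrow> (real ^ 'n \<Rightarrow> complex) \<Rightarrow> real \<Rightarrow> real \<Rightarrow> complex" where
  "theta_sum S w a u = (\<Sum>\<^sub>\<infinity>z\<in>S - {0}. w z * of_real (exp (- (a * (z \<bullet> z) * u))))"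

text \<open>For c = a |z|^2 the domination bound is a constant times |z|^(m - 2 \<sigma>), which is
  summable over the nonzero points because 2 \<sigma> - m > d. All three claims then follow from the
  exchange of sum and integral.\<close>

lemma
  fixes S :: "(real ^ 'n) set"
  assumes S: "countable S" "zeta_summable S" and C: "\<And>z. norm (w z) \<le> C * norm z ^ m" and a: "a > 0"
    and E: "mellin_dominated E s \<sigma>" and \<sigma>: "2 * \<sigma> > CARD('n) + m"
  shows mellin_theta_summable:
      "(\<lambda>z. norm (w z * (LINT u:E|lborel. mellin_kernel s (a * (z \<bullet> z)) u))) summable_on (S - {0})"
    and mellin_theta_integrable:
      "set_integrable lborel E (\<lambda>u. of_real u powr (s - 1) * theta_sum S w a u)"
    and mellin_theta_integral:
      "(LINT u:E|lborel. of_real u powr (s - 1) * theta_sum S w a u) =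
       (\<Sum>\<^sub>\<infinity>z\<in>S - {0}. w z * (LINT u:E|lborel. mellin_kernel s (a * (z \<bullet> z)) u))"
proof -
  define f where "f z u = w z * (indicator E u *\<^sub>R mellin_kernel s (a * (z \<bullet> z)) u)" for z u
  have pos: "a * (z \<bullet> z) > 0" if "z \<in> S - {0}" for z using that a by simp
  have int: "integrable lborel (f z)" if "z \<in> S - {0}" for z
    unfolding f_def using mellin_dominated_integrable[OF E pos[OF that]]
    by (intro integrable_mult_right) (simp add: set_integrable_def)
  have "\<sigma> > 0" using E by (simp add: mellin_dominated_def)
  have Csum: "(\<lambda>z. (C * Gamma \<sigma> * a powr (- \<sigma>)) * norm z powr (- (2 * \<sigma> - m))) summable_on (S - {0})"
  proof (rule summable_on_cmult_right)
    have "real CARD('n) < 2 * \<sigma> - m" using \<sigma> by linarith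
    from S(2)[unfolded zeta_summable_def, rule_format, OF this]
    show "(\<lambda>z. norm z powr (- (2 * \<sigma> - m))) summable_on (S - {0})" .
  qed
  have fsum: "(\<lambda>z. \<integral>u. norm (f z u) \<partial>lborel) summable_on (S - {0})"
  proof (rule summable_on_comparison_test[OF Csum])
    fix z assume z: "z \<in> S - {0}"
    hence nz: "norm z > 0" by simp
    have "(\<integral>u. norm (f z u) \<partial>lborel) = norm (w z) * (\<integral>u. norm (indicator E u *\<^sub>R mellin_kernel s (a * (z \<bullet> z)) u) \<partial>lborel)"
      unfolding f_def norm_mult by (rule integral_mult_right_zero)
    also have "\<dots> \<le> (C * norm z ^ m) * (Gamma \<sigma> * (a * (z \<bullet> z)) powr (- \<sigma>))"
    proof (rule mult_mono[OF C mellin_dominated_bound[OF E pos[OF z]]])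
      show "0 \<le> C * norm z ^ m" using C[of z] norm_ge_zero order_trans by blast
    qed simp
    also have "(a * (z \<bullet> z)) powr (- \<sigma>) = a powr (- \<sigma>) * norm z powr (- (2 * \<sigma>))"
    proof -
      have "z \<bullet> z = norm z powr 2" using nz by (simp add: dot_square_norm powr_numeral)
      hence "(z \<bullet> z) powr (- \<sigma>) = (norm z powr 2) powr (- \<sigma>)" by (simp only:)
      also have "\<dots> = norm z powr (- (2 * \<sigma>))" by (simp only: powr_powr mult_minus_right)
      finally show ?thesis using a by (simp add: powr_mult)
    qed
    also have "(C * norm z ^ m) * (Gamma \<sigma> * (a powr (- \<sigma>) * norm z powr (- (2 * \<sigma>)))) =
        (C * Gamma \<sigma> * a powr (- \<sigma>)) * (norm z ^ m * norm z powr (- (2 * \<sigma>)))" by (simp only: mult_ac)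
    also have "norm z ^ m * norm z powr (- (2 * \<sigma>)) = norm z powr (- (2 * \<sigma> - m))"
      using nz by (subst powr_realpow[OF nz, symmetric], subst powr_add[symmetric]) simp
    finally show "(\<integral>u. norm (f z u) \<partial>lborel) \<le> (C * Gamma \<sigma> * a powr (- \<sigma>)) * norm z powr (- (2 * \<sigma> - m))" .
  qed simp
  have fint: "(\<integral>u. f z u \<partial>lborel) = w z * (LINT u:E|lborel. mellin_kernel s (a * (z \<bullet> z)) u)" for z
    unfolding f_def set_lebesgue_integral_def by (rule integral_mult_right_zero)
  show "(\<lambda>z. norm (w z * (LINT u:E|lborel. mellin_kernel s (a * (z \<bullet> z)) u))) summable_on (S - {0})"
    unfolding fint[symmetric]
    by (rule summable_on_comparison_test[OF fsum]) (auto intro: integral_norm_bound)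
  have cnt: "countable (S - {0})" using S(1) by simp
  have pt: "(\<Sum>\<^sub>\<infinity>z\<in>S - {0}. f z u) = indicator E u *\<^sub>R (of_real u powr (s - 1) * theta_sum S w a u)" for u
  proof -
    have "(\<Sum>\<^sub>\<infinity>z\<in>S - {0}. f z u) =
      (\<Sum>\<^sub>\<infinity>z\<in>S - {0}. (of_real (indicator E u) * of_real u powr (s - 1)) * (w z * of_real (exp (- (a * (z \<bullet> z) * u)))))"
      by (intro infsum_cong) (simp add: f_def mellin_kernel_def scaleR_conv_of_real)
    also have "\<dots> = (of_real (indicator E u) * of_real u powr (s - 1)) * theta_sum S w a u"
      unfolding theta_sum_def by (rule infsum_cmult_right')
    finally show ?thesis by (simp add: scaleR_conv_of_real)
  qed
  show "set_integrable lborel E (\<lambda>u. of_real u powr (s - 1) * theta_sum S w a u)"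
    using integrable_infsum[OF sigma_finite_lborel cnt int fsum] by (simp only: pt set_integrable_def)
  show "(LINT u:E|lborel. of_real u powr (s - 1) * theta_sum S w a u) =
       (\<Sum>\<^sub>\<infinity>z\<in>S - {0}. w z * (LINT u:E|lborel. mellin_kernel s (a * (z \<bullet> z)) u))"
    using integral_infsum[OF sigma_finite_lborel cnt int fsum] by (simp only: pt fint set_lebesgue_integral_def)
qed

text \<open>Expanding \<open>u powr w = exp (w * ln u)\<close> under the integral gives an everywhere convergent power series in \<open>w\<close>.\<close>
lemma holomorphic_mellin_tail:
  fixes G :: "real \<Rightarrow> complex"
  assumes int: "\<And>r::real. set_integrable lborel {1..} (\<lambda>u. of_real u powr (of_real r) * G u)"
  shows "(\<lambda>w. LINT u:{1..}|lborel. of_real u powr w * G u) holomorphic_on UNIV"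
proof -
  define H where "H u = indicator {1..} u *\<^sub>R G u" for u
  have "indicator {1..} u *\<^sub>R (of_real u powr (of_real 0) * G u) = H u" for u
    by (auto simp: H_def indicator_def)
  hence "integrable lborel H" using int[of 0] by (simp add: set_integrable_def)
  hence [measurable]: "H \<in> borel_measurable borel" by auto
  have H0: "H u = 0" if "u < 1" for u using that by (simp add: H_def)
  have intH: "integrable lborel (\<lambda>u. u powr r * norm (H u))" for r
  proof -
    have "norm (indicator {1..} u *\<^sub>R (of_real u powr (of_real r) * G u)) = u powr r * norm (H u)" for u
      by (cases "u \<ge> 1") (auto simp: H_def norm_mult norm_powr_real_powr)
    thus ?thesis using integrable_norm[OF int[of r, unfolded set_integrable_def]] by simp
  qed
  define c where "c k = (\<integral>u. of_real (ln u ^ k / fact k) * H u \<partial>lborel)" for k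
  have sums: "(\<lambda>k. c k * (w - 0) ^ k) sums (LINT u:{1..}|lborel. of_real u powr w * G u)" for w
  proof -
    define f where "f k u = w ^ k * (of_real (ln u ^ k / fact k) * H u)" for k u
    have nf: "norm (f k u) = (norm w * ln u) ^ k / fact k * norm (H u)" for k u
    proof (cases "u < 1")
      case False
      hence "\<bar>ln u ^ k / fact k\<bar> = ln u ^ k / fact k" by (intro abs_of_nonneg) simp
      thus ?thesis by (simp only: f_def norm_mult norm_power norm_of_real power_mult_distrib) simp
    qed (simp add: f_def H0)
    \<comment> \<open>For u \<ge> 1 the terms are nonnegative and sum to exp (|w| ln u) = u^|w|.
      This one majorant covers all partial sums, which gives both integrability and summability in
      k.\<close>
    have fin: "(\<Sum>k\<in>F. norm (f k u)) \<le> u powr (norm w) * norm (H u)" if "finite F" for F u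
    proof (cases "u < 1")
      case False
      hence ln: "norm w * ln u \<ge> 0" by simp
      have "(\<Sum>k\<in>F. (norm w * ln u) ^ k / fact k) \<le> exp (norm w * ln u)"
      proof -
        have "(\<Sum>k\<in>F. (norm w * ln u) ^ k /\<^sub>R fact k) \<le> (\<Sum>k. (norm w * ln u) ^ k /\<^sub>R fact k)"
          using ln by (intro sum_le_suminf summable_exp_generic that) auto
        thus ?thesis by (simp add: exp_def divide_inverse mult.commute)
      qed
      also have "\<dots> = u powr (norm w)" using False by (simp add: powr_def)
      finally show ?thesis unfolding nf sum_distrib_right[symmetric] by (intro mult_right_mono) auto
    qed (simp add: nf H0)
    have fint: "integrable lborel (f k)" for k
    proof (rule Bochner_Integration.integrable_bound[OF intH[of "norm w"]])
      show "AE u in lborel. norm (f k u) \<le> norm (u powr (norm w) * norm (H u))"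
        using fin[of "{k}"] by (auto intro!: AE_I2 order_trans[OF _ abs_ge_self])
    qed (simp add: f_def[abs_def])
    have fsum: "(\<lambda>k. \<integral>u. norm (f k u) \<partial>lborel) summable_on UNIV"
    proof (rule nonneg_bdd_above_summable_on)
      show "bdd_above (sum (\<lambda>k. \<integral>u. norm (f k u) \<partial>lborel) ` {F. F \<subseteq> UNIV \<and> finite F})"
      proof (rule bdd_aboveI2)
        fix F :: "nat set" assume "F \<in> {F. F \<subseteq> UNIV \<and> finite F}"
        hence F: "finite F" by simp
        have "(\<Sum>k\<in>F. \<integral>u. norm (f k u) \<partial>lborel) = (\<integral>u. (\<Sum>k\<in>F. norm (f k u)) \<partial>lborel)"
          by (rule Bochner_Integration.integral_sum[symmetric]) (intro integrable_norm fint)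
        also have "\<dots> \<le> (\<integral>u. u powr (norm w) * norm (H u) \<partial>lborel)"
          by (rule integral_mono[OF _ intH fin[OF F]]) (intro Bochner_Integration.integrable_sum integrable_norm fint)
        finally show "(\<Sum>k\<in>F. \<integral>u. norm (f k u) \<partial>lborel) \<le> (\<integral>u. u powr (norm w) * norm (H u) \<partial>lborel)" .
      qed
    qed simp
    have pt: "(\<Sum>\<^sub>\<infinity>k. f k u) = indicator {1..} u *\<^sub>R (of_real u powr w * G u)" for u
    proof (cases "u < 1")
      case True
      thus ?thesis by (simp add: f_def H0)
    next
      case False
      let ?x = "w * of_real (ln u)"
      have "((\<lambda>k. ?x ^ k /\<^sub>R fact k) has_sum exp ?x) UNIV"
        by (rule norm_summable_imp_has_sum[OF summable_norm_exp exp_converges])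
      hence "((\<lambda>k. ?x ^ k /\<^sub>R fact k * H u) has_sum (exp ?x * H u)) UNIV"
        by (rule has_sum_cmult_left)
      moreover have "f k u = ?x ^ k /\<^sub>R fact k * H u" for k
        by (simp add: f_def power_mult_distrib scaleR_conv_of_real divide_inverse mult_ac)
      moreover have "exp ?x = of_real u powr w" using False by (simp add: powr_def Ln_of_real)
      ultimately have "((\<lambda>k. f k u) has_sum (of_real u powr w * H u)) UNIV" by simp
      from infsumI[OF this] show ?thesis using False by (simp add: H_def)
    qed
    have eq: "(\<integral>u. f k u \<partial>lborel) = c k * (w - 0) ^ k" for k
      unfolding f_def c_def integral_mult_right_zero by simp
    have sm: "(\<lambda>k. \<integral>u. f k u \<partial>lborel) summable_on UNIV"
      by (rule abs_summable_summable, rule summable_on_comparison_test[OF fsum]) (auto intro: integral_norm_bound)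
    have "(\<integral>u. (\<Sum>\<^sub>\<infinity>k. f k u) \<partial>lborel) = (\<Sum>\<^sub>\<infinity>k. \<integral>u. f k u \<partial>lborel)"
      by (rule integral_infsum[OF sigma_finite_lborel _ fint fsum]) simp
    with has_sum_infsum[OF sm] have "((\<lambda>k. \<integral>u. f k u \<partial>lborel) has_sum (\<integral>u. (\<Sum>\<^sub>\<infinity>k. f k u) \<partial>lborel)) UNIV" by simp
    from has_sum_imp_sums[OF this] show ?thesis
      by (simp only: eq pt set_lebesgue_integral_def)
  qed
  have "(\<lambda>w. LINT u:{1..}|lborel. of_real u powr w * G u) holomorphic_on ball 0 r" for r
    by (rule power_series_holomorphic[OF sums])
  hence "(\<lambda>w. LINT u:{1..}|lborel. of_real u powr w * G u) field_differentiable at x" for x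
    by (rule holomorphic_on_imp_differentiable_at[where s="ball 0 (norm x + 1)"]) auto
  thus ?thesis by (simp add: holomorphic_on_def)
qed

text \<open>The change of variables gives integrability for the completed measure only; Borel
  measurability of f brings it back to \<open>lborel\<close>.\<close>

lemma integral_inverse_substitution:
  fixes f :: "real \<Rightarrow> complex"
  assumes f: "set_integrable lborel {0<..<1} f" and [measurable]: "f \<in> borel_measurable borel"
  shows "set_integrable lborel {1<..} (\<lambda>v. (1 / v\<^sup>2) *\<^sub>R f (1 / v))"
    and "(LINT u:{0<..<1}|lborel. f u) = (LINT v:{1<..}|lborel. (1 / v\<^sup>2) *\<^sub>R f (1 / v))"
proof -
  have img: "(\<lambda>v::real. 1 / v) ` {1<..} = {0<..<1}"
  proof (intro equalityI subsetI)
    fix u :: real assume "u \<in> {0<..<1}"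
    hence "u = 1 / (1 / u)" "1 / u \<in> {1<..}" by (auto simp: field_simps)
    thus "u \<in> (\<lambda>v. 1 / v) ` {1<..}" by blast
  qed (auto simp: field_simps)
  have "(\<lambda>v. \<bar>- 1 / v\<^sup>2\<bar> *\<^sub>R f (1 / v)) absolutely_integrable_on {1<..} \<and>
        integral {1<..} (\<lambda>v. \<bar>- 1 / v\<^sup>2\<bar> *\<^sub>R f (1 / v)) = integral {0<..<1} f \<longleftrightarrow>
        f absolutely_integrable_on (\<lambda>v. 1 / v) ` {1<..} \<and> integral ((\<lambda>v. 1 / v) ` {1<..}) f = integral {0<..<1} f"
    by (rule has_absolute_integral_change_of_variables_real)
       (auto intro!: derivative_eq_intros simp: inj_on_def power2_eq_square)
  hence *: "(\<lambda>v. (1 / v\<^sup>2) *\<^sub>R f (1 / v)) absolutely_integrable_on {1<..}"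
    "integral {1<..} (\<lambda>v. (1 / v\<^sup>2) *\<^sub>R f (1 / v)) = integral {0<..<1} f"
    using set_integrable_lborel_imp_lebesgue[OF f] by (simp_all add: img)
  show 1: "set_integrable lborel {1<..} (\<lambda>v. (1 / v\<^sup>2) *\<^sub>R f (1 / v))"
    by (rule set_integrable_lebesgue_imp_lborel[OF *(1)]) measurable
  show "(LINT u:{0<..<1}|lborel. f u) = (LINT v:{1<..}|lborel. (1 / v\<^sup>2) *\<^sub>R f (1 / v))"
    using set_borel_integral_eq_integral(2)[OF f] set_borel_integral_eq_integral(2)[OF 1] *(2) by simp
qed

text \<open>The substitution t = \<pi> |z|^2 u moves the lower limit of the incomplete Gamma
  integral to 1, and the power that it produces cancels the denominator in
  \<open>upper_crandall\<close>.\<close>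

lemma upper_crandall_eq:
  fixes z :: "real ^ 'n"
  assumes "z \<noteq> 0"
  shows "upper_crandall \<nu> z = (LINT u:{1..}|lborel. mellin_kernel (\<nu> / 2) (pi * (z \<bullet> z)) u)"
proof -
  define c where "c = pi * (z \<bullet> z)"
  have c: "c > 0" using assms by (simp add: c_def)
  let ?s = "\<nu> / 2"
  \<comment> \<open>Any positive exponent not below Re (\<nu> / 2) dominates on the tail; the
    maximum with 1 ensures positivity.\<close>
  have dom: "mellin_dominated {1..} ?s (max 1 (Re ?s))" by (rule mellin_dominated_tail) auto
  note eq = mellin_kernel_1[of ?s]
  have "set_integrable lborel {c..} (mellin_kernel ?s 1)"
  proof -
    have "integrable lborel (\<lambda>u. indicator {c..} (0 + c * u) *\<^sub>R mellin_kernel ?s 1 (0 + c * u))"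
    proof -
      have "(\<lambda>u. indicator {c..} (0 + c * u) *\<^sub>R mellin_kernel ?s 1 (0 + c * u)) =
        (\<lambda>u. of_real c powr (?s - 1) * (indicator {1..} u *\<^sub>R mellin_kernel ?s c u))"
      proof
        fix u :: real
        show "indicator {c..} (0 + c * u) *\<^sub>R mellin_kernel ?s 1 (0 + c * u) =
          of_real c powr (?s - 1) * (indicator {1..} u *\<^sub>R mellin_kernel ?s c u)"
          using c mellin_kernel_scale[OF c, of u ?s] by (cases "u \<ge> 1") auto
      qed
      moreover have "integrable lborel (\<lambda>u. of_real c powr (?s - 1) * (indicator {1..} u *\<^sub>R mellin_kernel ?s c u))"
        using mellin_dominated_integrable[OF dom c] unfolding set_integrable_def by (rule integrable_mult_right)
      ultimately show ?thesis by (simp only:)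
    qed
    thus ?thesis
      using lborel_integrable_real_affine_iff[where c=c and t=0 and f="\<lambda>t. indicator {c..} t *\<^sub>R mellin_kernel ?s 1 t"] c
      unfolding set_integrable_def by blast
  qed
  hence "upper_Gamma ?s c = (LINT t:{c..}|lborel. mellin_kernel ?s 1 t)"
    unfolding upper_Gamma_def eq[symmetric] by (rule set_borel_integral_eq_integral(2)[symmetric])
  also have "\<dots> = of_real c powr ?s * (LINT u:{1..}|lborel. mellin_kernel ?s c u)"
  proof (rule integral_mellin_kernel_scale[OF c])
    show "c * u \<in> {c..} \<longleftrightarrow> u \<in> {1..}" for u using c by simp
  qed auto
  finally show ?thesis using assms c by (simp add: upper_crandall_def c_def)
qed

section \<open>The theta functional equation\<close>

declare transpose_matrix_vector [simp del]

section \<open>The reciprocal lattice and reindexing of lattice sums\<close>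

lemma wave_matrix: "wave k (A *v u) = wave (transpose A *v k) u"
  by (simp add: wave_def dot_lmul_matrix transpose_matrix_vector)

lemma matrix_vector_mult_minus: "(A :: real ^ 'n ^ 'm) *v (- v) = - (A *v v)"
  by (rule linear_neg[OF matrix_vector_mul_linear])

lemma wave_commute: "wave k x = wave x k"
  by (simp add: wave_def inner_commute)

lemma wave_minus_minus: "wave (- k) (- x) = wave k x"
  by (simp add: wave_def)

lemma
  fixes A :: "real ^ 'n ^ 'n"
  assumes "invertible A"
  shows transpose_mult_reciprocal: "transpose A *v (transpose (matrix_inv A) *v n) = n"
    and invertible_reciprocal: "invertible (transpose (matrix_inv A))"
proof -
  have "matrix_inv A ** A = mat 1"
    unfolding matrix_eq using matrix_inv_mult_vector(1)[OF assms] by (simp add: matrix_vector_mul_assoc[symmetric])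
  hence *: "transpose A ** transpose (matrix_inv A) = mat 1"
    by (simp add: matrix_transpose_mul[symmetric])
  thus "transpose A *v (transpose (matrix_inv A) *v n) = n"
    by (simp only: matrix_vector_mul_assoc matrix_vector_mul_lid)
  from * show "invertible (transpose (matrix_inv A))"
    unfolding invertible_def using matrix_left_right_inverse by blast
qed

lemma inj_on_affine:
  fixes A :: "real ^ 'n ^ 'n"
  assumes "invertible A"
  shows "inj_on (\<lambda>m. A *v m + v) X"
  by (rule inj_on_inverseI[where g="\<lambda>w. matrix_inv A *v (w - v)"]) (simp add: matrix_inv_mult_vector[OF assms])

lemma image_lattice_of: "(\<lambda>z. z + v) ` lattice_of A = (\<lambda>m. A *v m + v) ` int_vec"
  by (simp add: lattice_of_int_vec image_image)

lemma infsum_lattice_of: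
  fixes A :: "real ^ 'n ^ 'n"
  assumes "invertible A"
  shows "(\<Sum>\<^sub>\<infinity>z\<in>(\<lambda>z. z + v) ` lattice_of A. F z) = (\<Sum>\<^sub>\<infinity>m\<in>int_vec. F (A *v m + v))"
  unfolding image_lattice_of by (subst infsum_reindex[OF inj_on_affine[OF assms]]) (simp add: o_def)

text \<open>Poisson summation for u \<mapsto> f (A u) times the phase, with f = h times Gaussian.
  The substitution v = A u produces the covolume and moves the frequency n to the dual point A^(-T)
  n + y, where Hecke's identity evaluates the transform.\<close>

theorem theta_functional_equation:
  fixes A :: "real ^ 'n ^ 'n"
  assumes A: "invertible A" and h: "harmonic_homogeneous m h" and t: "t > 0"
  shows "(\<Sum>\<^sub>\<infinity>z\<in>(\<lambda>z. z + (- x)) ` lattice_of A. of_real (h z * gauss t z) * wave (- y) (z + x)) =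
    ((- \<i> / of_real t) ^ m * of_real ((1 / sqrt t) ^ CARD('n) / covolume A)) *
    (\<Sum>\<^sub>\<infinity>p\<in>(\<lambda>p. p + y) ` reciprocal_lattice A. of_real (h p * gauss (1 / t) p) * wave (- x) p)"
proof -
  define B where "B = transpose (matrix_inv A)"
  have B: "invertible B" unfolding B_def by (rule invertible_reciprocal[OF A])
  have AB: "transpose A *v (B *v n) = n" for n unfolding B_def by (rule transpose_mult_reciprocal[OF A])
  have hp: "real_polynomial_function h" using h by (simp add: harmonic_homogeneous_def)
  define f where "f u = complex_of_real (h u * gauss t u)" for u
  define f' where "f' p = complex_of_real (h p * gauss (1 / t) p)" for p
  have f: "rapid f" unfolding f_def by (rule rapid_polynomial_gauss[OF hp t])
  have f': "rapid f'" unfolding f'_def by (rule rapid_polynomial_gauss[OF hp]) (use t in simp)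
  define K where "K = (- \<i> / of_real t) ^ m * of_real ((1 / sqrt t) ^ CARD('n) / covolume A)"
  define g where "g u = f (A *v u) * wave (- (transpose A *v y)) u" for u
  have g: "periodisable g" unfolding g_def by (intro periodisable_mult_wave rapid_periodisable f A)
  have g_eq: "g u = f (A *v u) * wave (- y) (A *v u)" for u
    by (simp add: g_def wave_matrix matrix_vector_mult_minus)
  have detA: "det A \<noteq> 0" using A by (simp add: invertible_det_nz)
  have c: "(\<integral>u. g u * wave (- n) u \<partial>lborel) = K * f' (B *v n + y)" for n
  proof -
    define \<phi> where "\<phi> v = f v * wave (- (B *v n + y)) v" for v
    have "wave (- n) u = wave (- (B *v n)) (A *v u)" for u
      by (simp add: wave_matrix matrix_vector_mult_minus AB)
    hence "g u * wave (- n) u = \<phi> (A *v u)" for u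
      by (simp add: g_eq \<phi>_def wave_add[symmetric] mult.assoc add.commute)
    hence "(\<integral>u. g u * wave (- n) u \<partial>lborel) = (\<integral>u. \<phi> (A *v u) \<partial>lborel)" by simp
    also have "\<dots> = (\<integral>v. \<phi> v \<partial>lborel) / of_real \<bar>det A\<bar>"
      by (rule integral_matrix_vector[OF detA])
         (use rapid_wave_integrable[OF f] in \<open>auto simp: \<phi>_def[abs_def]\<close>)
    also have "(\<integral>v. \<phi> v \<partial>lborel) = gauss_fourier t h (B *v n + y)"
      by (simp add: gauss_fourier_def \<phi>_def f_def)
    also have "\<dots> = (- \<i> / of_real t) ^ m * of_real (h (B *v n + y) * (gauss (1 / t) (B *v n + y) * (1 / sqrt t) ^ CARD('n)))"
      by (rule gauss_fourier_harmonic[OF h t])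
    finally show ?thesis by (simp add: K_def f'_def covolume_def)
  qed
  have sum: "(\<lambda>n. norm (\<integral>u. g u * wave (- n) u \<partial>lborel)) summable_on int_vec"
    unfolding c norm_mult by (intro summable_on_cmult_right rapid_summable f' B)
  \<comment> \<open>The point with A \<xi> = - x, so that summing at m + \<xi> runs over the shifted
    lattice.\<close>
  define \<xi> where "\<xi> = - (matrix_inv A *v x)"
  have A\<xi>: "A *v \<xi> = - x" by (simp add: \<xi>_def matrix_vector_mult_minus matrix_inv_mult_vector(2)[OF A])
  have poisson: "(\<Sum>\<^sub>\<infinity>m\<in>int_vec. g (m + \<xi>)) = (\<Sum>\<^sub>\<infinity>n\<in>int_vec. K * f' (B *v n + y) * wave n \<xi>)"
    using poisson_summation[OF g sum, of \<xi>] unfolding c .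
  have "(\<Sum>\<^sub>\<infinity>z\<in>(\<lambda>z. z + (- x)) ` lattice_of A. f z * wave (- y) (z + x)) =
        (\<Sum>\<^sub>\<infinity>m\<in>int_vec. f (A *v m + (- x)) * wave (- y) (A *v m + (- x) + x))"
    by (rule infsum_lattice_of[OF A])
  also have "\<dots> = (\<Sum>\<^sub>\<infinity>m\<in>int_vec. g (m + \<xi>) * wave (- y) x)"
    by (intro infsum_cong) (simp only: g_eq matrix_vector_right_distrib A\<xi> wave_add_right mult.assoc)
  also have "\<dots> = (\<Sum>\<^sub>\<infinity>m\<in>int_vec. g (m + \<xi>)) * wave (- y) x" by (rule infsum_cmult_left')
  also have "\<dots> = (\<Sum>\<^sub>\<infinity>n\<in>int_vec. K * f' (B *v n + y) * wave n \<xi> * wave (- y) x)"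
    unfolding poisson by (rule infsum_cmult_left'[symmetric])
  also have "\<dots> = (\<Sum>\<^sub>\<infinity>n\<in>int_vec. K * (f' (B *v n + y) * wave (- x) (B *v n + y)))"
  proof (rule infsum_cong)
    fix n
    \<comment> \<open>The transpose of A inverts B, so pairing n with \<xi> equals pairing the dual
      vector B n with A \<xi> = - x.\<close>
    have "wave n \<xi> = wave (B *v n) (- x)"
      unfolding A\<xi>[symmetric] wave_matrix AB ..
    hence "wave n \<xi> * wave (- y) x = wave (- x) (B *v n + y)"
      using wave_minus_minus[of y "- x"] by (simp add: wave_add_right wave_commute[of "- x"])
    thus "K * f' (B *v n + y) * wave n \<xi> * wave (- y) x = K * (f' (B *v n + y) * wave (- x) (B *v n + y))"
      by (simp add: mult.assoc)
  qed
  also have "\<dots> = K * (\<Sum>\<^sub>\<infinity>n\<in>int_vec. f' (B *v n + y) * wave (- x) (B *v n + y))" by (rule infsum_cmult_right')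
  also have "(\<Sum>\<^sub>\<infinity>n\<in>int_vec. f' (B *v n + y) * wave (- x) (B *v n + y)) =
      (\<Sum>\<^sub>\<infinity>p\<in>(\<lambda>p. p + y) ` lattice_of B. f' p * wave (- x) p)"
    by (rule infsum_lattice_of[OF B, symmetric])
  finally show ?thesis by (simp only: f_def f'_def K_def B_def reciprocal_lattice_def)
qed

lemma homogeneous_growth:
  fixes h :: "real ^ 'n \<Rightarrow> real"
  assumes "harmonic_homogeneous m h"
  shows "\<exists>C. \<forall>z. \<bar>h z\<bar> \<le> C * norm z ^ m"
proof -
  have h: "continuous_on UNIV h" and hom: "\<And>c z. h (c *\<^sub>R z) = c ^ m * h z"
    using assms by (auto simp: harmonic_homogeneous_def homogeneous_of_degree_def intro: continuous_on_real_polynomial_function)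
  have "compact (h ` cball 0 1)"
    by (intro compact_continuous_image continuous_on_subset[OF h]) auto
  then obtain C where C: "\<And>z. z \<in> cball 0 1 \<Longrightarrow> norm (h z) \<le> C"
    using compact_imp_bounded bounded_iff by (metis image_eqI)
  have "\<bar>h z\<bar> \<le> C * norm z ^ m" for z
  proof -
    \<comment> \<open>For z = 0 the division gives e = 0, and z = |z| e still holds.\<close>
    define e where "e = (1 / norm z) *\<^sub>R z"
    have z: "z = norm z *\<^sub>R e" by (simp add: e_def)
    have "h z = norm z ^ m * h e" by (subst z, rule hom)
    moreover have "e \<in> cball 0 1" by (simp add: e_def)
    hence "\<bar>h e\<bar> \<le> C" using C[of e] by simp
    ultimately show ?thesis by (simp add: abs_mult mult.commute mult_right_mono)
  qed
  thus ?thesis by blast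
qed

text \<open>Used with q = - s and q = \<open>dual s\<close> for the two constant terms; the value -
  1 / q is where poles come from.\<close>

lemma
  assumes q: "Re q < 0"
  shows set_integrable_powr_tail: "set_integrable lborel {1<..} (\<lambda>v. complex_of_real v powr (q - 1))"
    and integral_powr_tail: "(LINT v:{1<..}|lborel. complex_of_real v powr (q - 1)) = - 1 / q"
proof -
  have q0: "q \<noteq> 0" using q by auto
  have "((\<lambda>v. v powr (Re q - 1)) has_integral - (1 powr (Re q - 1 + 1)) / (Re q - 1 + 1)) {1..}"
    by (rule has_integral_powr_to_inf) (use q in auto)
  hence "(\<lambda>v. v powr (Re q - 1)) integrable_on {1..}" by blast
  hence "(\<lambda>v. v powr (Re q - 1)) absolutely_integrable_on {1..}"
    by (rule nonnegative_absolutely_integrable_1) auto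
  hence "set_integrable lborel {1..} (\<lambda>v. v powr (Re q - 1))"
    by (rule set_integrable_lebesgue_imp_lborel) measurable
  hence int: "integrable lborel (\<lambda>v. indicator {1..} v *\<^sub>R v powr (Re q - 1))" by (simp add: set_integrable_def)
  show si: "set_integrable lborel {1<..} (\<lambda>v. complex_of_real v powr (q - 1))"
    unfolding set_integrable_def
  proof (rule Bochner_Integration.integrable_bound[OF int])
    show "(\<lambda>v. indicator {1<..} v *\<^sub>R complex_of_real v powr (q - 1)) \<in> borel_measurable lborel" by measurable
    show "AE v in lborel. norm (indicator {1<..} v *\<^sub>R complex_of_real v powr (q - 1)) \<le> norm (indicator {1..} v *\<^sub>R v powr (Re q - 1))"
      by (rule AE_I2) (auto simp: indicator_def norm_powr_real_powr)
  qed
  have e: "einterval 1 \<infinity> = {1<..}" by (auto simp: einterval_def one_ereal_def)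
  have "(LBINT v=1..\<infinity>. complex_of_real v powr (q - 1)) = 0 - 1 / q"
  proof (rule interval_integral_FTC_integrable[where F="\<lambda>v. complex_of_real v powr q / q"])
    fix v :: real assume "1 < ereal v"
    hence v: "v > 1" by (simp add: one_ereal_def)
    have "((\<lambda>z. z powr q / q) has_field_derivative complex_of_real v powr (q - 1)) (at (complex_of_real v))"
      using v q0 by (auto intro!: derivative_eq_intros simp: complex_nonpos_Reals_iff)
    thus "((\<lambda>v. complex_of_real v powr q / q) has_vector_derivative complex_of_real v powr (q - 1)) (at v)"
      by (rule has_vector_derivative_real_field)
    show "isCont (\<lambda>v. complex_of_real v powr (q - 1)) v"
      using v by (intro continuous_intros) (auto simp: complex_nonpos_Reals_iff)
  next
    show "set_integrable lborel (einterval 1 \<infinity>) (\<lambda>v. complex_of_real v powr (q - 1))" using si by (simp add: e)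
    have "isCont (\<lambda>v. complex_of_real v powr q / q) 1"
      using q0 by (intro continuous_intros) (auto simp: complex_nonpos_Reals_iff)
    hence "((\<lambda>v. complex_of_real v powr q / q) \<longlongrightarrow> complex_of_real 1 powr q / q) (at_right 1)"
      unfolding isCont_def by (rule filterlim_mono[OF _ order_refl at_le]) auto
    thus "(((\<lambda>v. complex_of_real v powr q / q) \<circ> real_of_ereal) \<longlongrightarrow> 1 / q) (at_right 1)"
      by (simp add: one_ereal_def ereal_tendsto_simps)
    have "((\<lambda>v. v powr (Re q)) \<longlongrightarrow> 0) at_top" by (rule tendsto_neg_powr) (use q in \<open>auto simp: filterlim_ident\<close>)
    hence "((\<lambda>v. v powr (Re q) / norm q) \<longlongrightarrow> 0 / norm q) at_top" by (rule tendsto_divide) (use q0 in auto)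
    hence "((\<lambda>v. norm (complex_of_real v powr q / q)) \<longlongrightarrow> 0) at_top"
      by (simp, elim Lim_transform_eventually) (auto intro!: eventually_mono[OF eventually_gt_at_top[of 0]] simp: norm_divide norm_powr_real_powr)
    hence "((\<lambda>v. complex_of_real v powr q / q) \<longlongrightarrow> 0) at_top" by (rule tendsto_norm_zero_cancel)
    thus "(((\<lambda>v. complex_of_real v powr q / q) \<circ> real_of_ereal) \<longlongrightarrow> 0) (at_left \<infinity>)"
      by (simp add: ereal_tendsto_simps)
  qed (auto simp: one_ereal_def)
  thus "(LINT v:{1<..}|lborel. complex_of_real v powr (q - 1)) = - 1 / q"
    by (simp add: interval_lebesgue_integral_def e one_ereal_def)
qed

lemma
  fixes f :: "real \<Rightarrow> complex"
  assumes "set_integrable lborel {1..} f"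
  shows set_integrable_open_tail: "set_integrable lborel {1<..} f"
    and integral_open_tail: "(LINT v:{1<..}|lborel. f v) = (LINT v:{1..}|lborel. f v)"
proof -
  show 1: "set_integrable lborel {1<..} f"
    by (rule set_integrable_subset[OF assms]) auto
  have "AE v in lborel. indicator {1<..} v *\<^sub>R f v = indicator {1..} v *\<^sub>R f v"
    using AE_lborel_singleton[of "1::real"] by eventually_elim (auto simp: indicator_def)
  thus "(LINT v:{1<..}|lborel. f v) = (LINT v:{1..}|lborel. f v)"
    unfolding set_lebesgue_integral_def using assms 1
    by (intro integral_cong_AE) (auto simp: set_integrable_def)
qed

lemma infsum_split_zero:
  fixes f :: "'a::zero \<Rightarrow> complex"
  assumes "f summable_on (S - {0})"
  shows "f summable_on S" "infsum f S = (if 0 \<in> S then f 0 else 0) + infsum f (S - {0})"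
proof -
  show "f summable_on S"
    using summable_on_union[OF assms summable_on_finite[of "S \<inter> {0}"]]
    by (metis Diff_Int2 Int_commute Un_Diff_Int finite_Int finite.emptyI finite.insertI)
  show "infsum f S = (if 0 \<in> S then f 0 else 0) + infsum f (S - {0})"
  proof (cases "0 \<in> S")
    case True
    hence "S = insert 0 (S - {0})" by auto
    thus ?thesis using infsum_insert[OF assms, of 0] True by (metis Diff_iff insertI1)
  qed auto
qed

section \<open>The completed Dirichlet series of a harmonic component\<close>

lemma rapid_phase_summable:
  fixes f :: "real ^ 'n \<Rightarrow> complex" and A :: "real ^ 'n ^ 'n"
  assumes f: "rapid f" and A: "invertible A" and ph: "\<And>z. norm (ph z) = 1"
  shows "(\<lambda>z. f z * ph z) summable_on (\<lambda>z. z + v) ` lattice_of A"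
proof (rule abs_summable_summable)
  have "(\<lambda>z. norm (f z)) summable_on (\<lambda>m. A *v m + v) ` int_vec"
    using rapid_summable[OF f A, of v] by (subst summable_on_reindex[OF inj_on_affine[OF A]]) (simp add: o_def)
  thus "(\<lambda>z. norm (f z * ph z)) summable_on (\<lambda>z. z + v) ` lattice_of A"
    by (simp add: norm_mult ph image_lattice_of)
qed

lemma of_real_inverse_powr:
  assumes "v > 0"
  shows "complex_of_real (1 / v) powr z = of_real v powr (- z)"
proof -
  have "Ln (complex_of_real (1 / v)) = - Ln (complex_of_real v)"
    using assms by (subst (1 2) Ln_of_real) (simp_all add: ln_div)
  thus ?thesis using assms by (simp add: powr_def)
qed

text \<open>One harmonic component at a time: h stands for h_k, m for |\<alpha>| - 2 k, and the
  variable s below for \<nu> / 2 - k.\<close>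

locale harmonic_theta =
  fixes A :: "real ^ 'n ^ 'n" and x y :: "real ^ 'n" and lam :: real and h :: "real ^ 'n \<Rightarrow> real" and m :: nat
  assumes A: "invertible A" and lam: "lam > 0" and h: "harmonic_homogeneous m h"
begin

definition "S = (\<lambda>z. z + (- x)) ` lattice_of A"
definition "S' = (\<lambda>p. p + y) ` reciprocal_lattice A"
definition "w z = of_real (h z) * wave (- y) (z + x)"
definition "w' p = of_real (h p) * wave (- x) p"
text \<open>With the theta variable t = u / lam^2 the Gaussian weights are exp (- a |z|^2 u) and, on
  the dual side, exp (- a' |p|^2 / u), so the inversion u \<mapsto> 1 / u fixes the splitting point
  u = 1 for every \<open>lam\<close>.\<close>

definition "a = pi / lam\<^sup>2"
definition "a' = pi * lam\<^sup>2"
definition "c = (if 0 \<in> S then w 0 else 0)"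
definition "c' = (if 0 \<in> S' then w' 0 else 0)"
text \<open>The factor of the theta functional equation at t = u / lam^2 without its power of
  u.\<close>

definition "\<kappa> = (- \<i>) ^ m * of_real (lam ^ (2 * m + CARD('n)) / covolume A)"
definition "\<theta> = theta_sum S w a"
definition "\<theta>' = theta_sum S' w' a'"
definition "I s = (LINT u:{1..}|lborel. of_real u powr (s - 1) * \<theta> u)"
definition "J s = (LINT u:{1..}|lborel. of_real u powr (s - 1) * \<theta>' u)"
text \<open>Under u = 1 / v the factor u^(s - 1) du times the theta factor u^(- d/2 - m) becomes
  v^(dual s - 1) dv.\<close>

definition dual :: "complex \<Rightarrow> complex" where "dual s = of_real (CARD('n) / 2 + m) - s"
text \<open>The continuation of the Dirichlet series with terms w z |z|^(-2 s). The direct constant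
  term - c / s times 1 / Gamma s is written as - c / Gamma (s + 1), which is entire and correct at s
  = 0 too.\<close>

definition "R s = of_real a powr s *
   (rGamma s * I s - c * rGamma (s + 1) + rGamma s * \<kappa> * (J (dual s) - c' / dual s))"

lemma a_pos: "a > 0" "a' > 0"
  using lam by (auto simp: a_def a'_def)

lemma S'_lattice: "S' = (\<lambda>p. p + y) ` lattice_of (transpose (matrix_inv A))"
  by (simp add: S'_def reciprocal_lattice_def)

lemma
  shows countable_S: "countable S" and countable_S': "countable S'"
    and zeta_summable_S: "zeta_summable S" and zeta_summable_S': "zeta_summable S'"
  unfolding S_def S'_lattice image_lattice_of
  by (intro countable_image countable_int_vec zeta_summable_coset A invertible_reciprocal)+

lemma growth: "\<exists>C. (\<forall>z. norm (w z) \<le> C * norm z ^ m) \<and> (\<forall>z. norm (w' z) \<le> C * norm z ^ m)"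
  using homogeneous_growth[OF h] by (simp add: w_def w'_def norm_mult)

text \<open>Homogeneity at the origin reads \<open>h 0 = 0 ^ m * h 0\<close>, so only a constant
  component has a dual constant term, and with it a pole.\<close>

lemma c'_nonzero:
  assumes "c' \<noteq> 0"
  shows "m = 0" "0 \<in> S'" "h 0 \<noteq> 0"
proof -
  show "0 \<in> S'" "h 0 \<noteq> 0" using assms by (auto simp: c'_def w'_def split: if_splits)
  have "h (0 *\<^sub>R 0) = 0 ^ m * h 0" using h unfolding harmonic_homogeneous_def homogeneous_of_degree_def by blast
  thus "m = 0" using \<open>h 0 \<noteq> 0\<close> by (cases m) auto
qed

text \<open>The theta functional equation at t = u / lam^2, after the terms of the origin are moved
  out of both sums.\<close>

lemma theta_relation:
  assumes u: "u > 0"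
  shows "\<theta> u = \<kappa> * of_real (u powr (- (CARD('n) / 2 + m))) * (\<theta>' (1 / u) + c') - c"
proof -
  define t where "t = u / lam\<^sup>2"
  have t: "t > 0" using u lam by (simp add: t_def)
  have hp: "real_polynomial_function h" using h by (simp add: harmonic_homogeneous_def)
  let ?f = "\<lambda>z. of_real (h z * gauss t z) * wave (- y) (z + x)"
  let ?f' = "\<lambda>p. of_real (h p * gauss (1 / t) p) * wave (- x) p"
  have f: "?f z = w z * of_real (exp (- (a * (z \<bullet> z) * u)))" for z
  proof -
    have "gauss t z = exp (- (a * (z \<bullet> z) * u))"
      unfolding gauss_def by (rule arg_cong[where f=exp]) (simp add: a_def t_def)
    thus ?thesis by (simp only: w_def of_real_mult mult_ac)
  qed
  have f': "?f' z = w' z * of_real (exp (- (a' * (z \<bullet> z) * (1 / u))))" for z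
  proof -
    have "gauss (1 / t) z = exp (- (a' * (z \<bullet> z) * (1 / u)))"
      unfolding gauss_def by (rule arg_cong[where f=exp]) (simp add: a'_def t_def)
    thus ?thesis by (simp only: w'_def of_real_mult mult_ac)
  qed
  have s1: "?f summable_on S"
    unfolding S_def by (rule rapid_phase_summable[OF rapid_polynomial_gauss[OF hp t] A norm_wave])
  have s2: "?f' summable_on S'"
    unfolding S'_lattice
    by (rule rapid_phase_summable[OF rapid_polynomial_gauss[OF hp] invertible_reciprocal[OF A] norm_wave]) (use t in simp)
  have r1: "?f summable_on (S - {0})" by (rule summable_on_subset_banach[OF s1]) blast
  have r2: "?f' summable_on (S' - {0})" by (rule summable_on_subset_banach[OF s2]) blast
  have e1: "infsum ?f S = c + \<theta> u"
    using infsum_split_zero(2)[OF r1] unfolding f by (simp add: c_def \<theta>_def theta_sum_def)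
  have e2: "infsum ?f' S' = c' + \<theta>' (1 / u)"
    using infsum_split_zero(2)[OF r2] unfolding f' by (simp add: c'_def \<theta>'_def theta_sum_def)
  have "infsum ?f S = ((- \<i> / of_real t) ^ m * of_real ((1 / sqrt t) ^ CARD('n) / covolume A)) * infsum ?f' S'"
    unfolding S_def S'_def by (rule theta_functional_equation[OF A h t])
  also have "(- \<i> / of_real t) ^ m * of_real ((1 / sqrt t) ^ CARD('n) / covolume A) =
      (- \<i>) ^ m * of_real ((1 / t) ^ m * (1 / sqrt t) ^ CARD('n) / covolume A)"
  proof -
    have "- \<i> / of_real t = - \<i> * of_real (1 / t)" by simp
    hence "(- \<i> / of_real t) ^ m = (- \<i>) ^ m * of_real ((1 / t) ^ m)"
      by (simp only: power_mult_distrib of_real_power)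
    thus ?thesis by (simp only: of_real_mult[symmetric] mult.assoc times_divide_eq_right)
  qed
  also have "(1 / t) ^ m * (1 / sqrt t) ^ CARD('n) = lam ^ (2 * m + CARD('n)) * u powr (- (CARD('n) / 2 + m))"
  proof -
    have t1: "1 / t = lam\<^sup>2 * (1 / u)" by (simp add: t_def)
    have t2: "1 / sqrt t = lam * (1 / sqrt u)" using lam by (simp add: t_def real_sqrt_divide)
    have "(1 / t) ^ m * (1 / sqrt t) ^ CARD('n) =
        lam ^ (2 * m + CARD('n)) * ((1 / u) ^ m * (1 / sqrt u) ^ CARD('n))"
    proof -
      have l: "lam ^ (2 * m + CARD('n)) = (lam\<^sup>2) ^ m * lam ^ CARD('n)" by (simp only: power_add power_mult)
      show ?thesis unfolding l t1 t2 by (simp only: power_mult_distrib mult_ac)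
    qed
    moreover have "(1 / sqrt u) ^ CARD('n) = u powr (- (CARD('n) / 2))"
    proof -
      have half: "1 / sqrt u = u powr (- (1 / 2))"
        using u by (simp add: powr_minus_divide powr_half_sqrt)
      have "(1 / sqrt u) ^ CARD('n) = (1 / sqrt u) powr real CARD('n)"
        using u by (intro powr_realpow[symmetric]) simp
      also have "\<dots> = u powr (- (CARD('n) / 2))"
        unfolding half by (simp add: powr_powr)
      finally show ?thesis .
    qed
    moreover have "(1 / u) ^ m = u powr (- real m)"
      using u by (simp add: powr_minus_divide powr_realpow power_one_over)
    ultimately show ?thesis by (simp add: powr_add[symmetric] algebra_simps)
  qed
  finally have "c + \<theta> u = \<kappa> * of_real (u powr (- (CARD('n) / 2 + m))) * (c' + \<theta>' (1 / u))"
    unfolding e1 e2 by (simp add: \<kappa>_def)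
  thus ?thesis by (simp add: algebra_simps)
qed

text \<open>On the tail every positive exponent from Re s upwards dominates; taking it at least d +
  m also satisfies the summability condition 2 \<sigma> > d + m. Hence the tail integrals converge
  for all s.\<close>

lemma tail_dominated: "mellin_dominated {1..} s (max (Re s) (real (CARD('n) + m)))"
proof (rule mellin_dominated_tail)
  have "0 < real (CARD('n) + m)" by (simp only: of_nat_0_less_iff add_gr_0 zero_less_card_finite simp_thms)
  thus "0 < max (Re s) (real (CARD('n) + m))" by linarith
qed linarith

lemma sigma_tail: "real (CARD('n) + m) < 2 * max (Re s) (real (CARD('n) + m))"
proof -
  have "0 < real (CARD('n) + m)" by (simp only: of_nat_0_less_iff add_gr_0 zero_less_card_finite simp_thms)
  moreover have "real (CARD('n) + m) \<le> max (Re s) (real (CARD('n) + m))" by (rule max.cobounded2)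
  moreover have "N < 2 * M" if "0 < N" "N \<le> M" for N M :: real using that by linarith
  ultimately show ?thesis by blast
qed

lemma
  shows tail_integrable: "set_integrable lborel {1..} (\<lambda>u. of_real u powr (s - 1) * \<theta> u)"
    and tail_integrable': "set_integrable lborel {1..} (\<lambda>u. of_real u powr (s - 1) * \<theta>' u)"
    and I_eq: "I s = (\<Sum>\<^sub>\<infinity>z\<in>S - {0}. w z * (LINT u:{1..}|lborel. mellin_kernel s (a * (z \<bullet> z)) u))"
    and J_eq: "J s = (\<Sum>\<^sub>\<infinity>z\<in>S' - {0}. w' z * (LINT u:{1..}|lborel. mellin_kernel s (a' * (z \<bullet> z)) u))"
    and I_summable: "(\<lambda>z. w z * (LINT u:{1..}|lborel. mellin_kernel s (a * (z \<bullet> z)) u)) summable_on (S - {0})"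
    and J_summable: "(\<lambda>z. w' z * (LINT u:{1..}|lborel. mellin_kernel s (a' * (z \<bullet> z)) u)) summable_on (S' - {0})"
proof -
  obtain C where C: "\<And>z. norm (w z) \<le> C * norm z ^ m" "\<And>z. norm (w' z) \<le> C * norm z ^ m" using growth by blast
  note * = countable_S zeta_summable_S C(1) a_pos(1) tail_dominated sigma_tail
  note dual_hyps = countable_S' zeta_summable_S' C(2) a_pos(2) tail_dominated sigma_tail
  show "set_integrable lborel {1..} (\<lambda>u. of_real u powr (s - 1) * \<theta> u)"
    unfolding \<theta>_def by (rule mellin_theta_integrable[OF *])
  show "set_integrable lborel {1..} (\<lambda>u. of_real u powr (s - 1) * \<theta>' u)"
    unfolding \<theta>'_def by (rule mellin_theta_integrable[OF dual_hyps])
  show "I s = (\<Sum>\<^sub>\<infinity>z\<in>S - {0}. w z * (LINT u:{1..}|lborel. mellin_kernel s (a * (z \<bullet> z)) u))"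
    unfolding I_def \<theta>_def by (rule mellin_theta_integral[OF *])
  show "J s = (\<Sum>\<^sub>\<infinity>z\<in>S' - {0}. w' z * (LINT u:{1..}|lborel. mellin_kernel s (a' * (z \<bullet> z)) u))"
    unfolding J_def \<theta>'_def by (rule mellin_theta_integral[OF dual_hyps])
  show "(\<lambda>z. w z * (LINT u:{1..}|lborel. mellin_kernel s (a * (z \<bullet> z)) u)) summable_on (S - {0})"
    by (rule abs_summable_summable[OF mellin_theta_summable[OF *]])
  show "(\<lambda>z. w' z * (LINT u:{1..}|lborel. mellin_kernel s (a' * (z \<bullet> z)) u)) summable_on (S' - {0})"
    by (rule abs_summable_summable[OF mellin_theta_summable[OF dual_hyps]])
qed

text \<open>Both tails converge for every real exponent, as \<open>holomorphic_mellin_tail\<close>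
  demands; the shift by 1 accounts for the power u^(s - 1).\<close>

lemma holomorphic_I: "I holomorphic_on UNIV" and holomorphic_J: "J holomorphic_on UNIV"
proof -
  have "set_integrable lborel {1..} (\<lambda>u. of_real u powr (of_real r) * \<theta> u)" for r :: real
    using tail_integrable[of "of_real (r + 1)"] by simp
  note h1 = holomorphic_mellin_tail[OF this]
  have "set_integrable lborel {1..} (\<lambda>u. of_real u powr (of_real r) * \<theta>' u)" for r :: real
    using tail_integrable'[of "of_real (r + 1)"] by simp
  note h2 = holomorphic_mellin_tail[OF this]
  have sub: "(\<lambda>s::complex. s - 1) holomorphic_on UNIV" by (intro holomorphic_intros)
  show "I holomorphic_on UNIV"
    unfolding I_def[abs_def] using holomorphic_on_compose_gen[OF sub h1] by (simp add: o_def)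
  show "J holomorphic_on UNIV"
    unfolding J_def[abs_def] using holomorphic_on_compose_gen[OF sub h2] by (simp add: o_def)
qed

text \<open>For m > 0 the hypothesis would not force Re (dual s) < 0, but then c' = 0 and there is
  nothing to integrate; for m = 0 the two conditions coincide.\<close>

lemma constant_term_tail:
  assumes s: "2 * Re s > CARD('n) + m"
  shows "set_integrable lborel {1<..} (\<lambda>v. (\<kappa> * c') * complex_of_real v powr (dual s - 1))"
    and "(LINT v:{1<..}|lborel. (\<kappa> * c') * complex_of_real v powr (dual s - 1)) = - \<kappa> * c' / dual s"
proof -
  have "set_integrable lborel {1<..} (\<lambda>v. (\<kappa> * c') * complex_of_real v powr (dual s - 1)) \<and>
    (LINT v:{1<..}|lborel. (\<kappa> * c') * complex_of_real v powr (dual s - 1)) = - \<kappa> * c' / dual s"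
  proof (cases "c' = 0")
    case True
    thus ?thesis by (simp add: set_integrable_def set_lebesgue_integral_def)
  next
    case False
    have "Re (dual s) = CARD('n) / 2 + m - Re s" by (simp add: dual_def)
    with c'_nonzero(1)[OF False] s have "Re (dual s) < 0" by linarith
    from set_integrable_powr_tail[OF this] integral_powr_tail[OF this] show ?thesis
      by (simp add: set_integrable_mult_right)
  qed
  thus "set_integrable lborel {1<..} (\<lambda>v. (\<kappa> * c') * complex_of_real v powr (dual s - 1))"
    "(LINT v:{1<..}|lborel. (\<kappa> * c') * complex_of_real v powr (dual s - 1)) = - \<kappa> * c' / dual s" by auto
qed

lemma mellin_identity:
  assumes s: "2 * Re s > CARD('n) + m"
  shows "(LINT u:{0<..}|lborel. of_real u powr (s - 1) * \<theta> u) = I s - c / s + \<kappa> * (J (dual s) - c' / dual s)"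
proof -
  have "real CARD('n) \<ge> 0" "real m \<ge> 0" by simp_all
  with s have Re: "Re s > 0" by linarith
  obtain C where C: "\<And>z. norm (w z) \<le> C * norm z ^ m" using growth by blast
  let ?g = "\<lambda>u. of_real u powr (s - 1) * \<theta> u"
  have int: "set_integrable lborel {0<..} ?g"
    unfolding \<theta>_def
    by (rule mellin_theta_integrable[OF countable_S zeta_summable_S C a_pos(1) mellin_dominated_full[OF Re] s])
  \<comment> \<open>Cutting off at 0 gives a function measurable on the whole line, which the
    substitution requires; the integrand is controlled only for positive arguments.\<close>
  define F where "F u = indicator {0<..} u *\<^sub>R ?g u" for u :: real
  have [measurable]: "F \<in> borel_measurable borel"
    using int by (auto simp: F_def[abs_def] set_integrable_def)
  have int1: "set_integrable lborel {0<..<1} ?g" by (rule set_integrable_subset[OF int]) auto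
  have F: "indicator {0<..<1} u *\<^sub>R ?g u = indicator {0<..<1} u *\<^sub>R F u" for u
    by (auto simp: F_def indicator_def)
  have intF: "set_integrable lborel {0<..<1} F"
    using int1 unfolding set_integrable_def F .
  have "(LINT u:{0<..}|lborel. ?g u) = (LINT u:{0<..<1} \<union> {1..}|lborel. ?g u)"
  proof -
    have "{0<..} = {0<..<1} \<union> {1::real..}" by auto
    thus ?thesis by simp
  qed
  also have "\<dots> = (LINT u:{0<..<1}|lborel. ?g u) + (LINT u:{1..}|lborel. ?g u)"
    by (rule set_integral_Un[OF _ int1 tail_integrable]) auto
  also have "(LINT u:{1..}|lborel. ?g u) = I s" by (simp add: I_def)
  also have "(LINT u:{0<..<1}|lborel. ?g u) = (LINT u:{0<..<1}|lborel. F u)"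
    unfolding set_lebesgue_integral_def F ..
  also have "\<dots> = (LINT v:{1<..}|lborel. (1 / v\<^sup>2) *\<^sub>R F (1 / v))"
    by (rule integral_inverse_substitution(2)[OF intF]) measurable
  also have "\<dots> = (LINT v:{1<..}|lborel. \<kappa> * (of_real v powr (dual s - 1) * \<theta>' v) +
      (\<kappa> * c') * of_real v powr (dual s - 1) - c * of_real v powr (- s - 1))"
  proof (rule set_lebesgue_integral_cong)
    show "\<forall>v. v \<in> {1<..} \<longrightarrow> (1 / v\<^sup>2) *\<^sub>R F (1 / v) = \<kappa> * (of_real v powr (dual s - 1) * \<theta>' v) +
      (\<kappa> * c') * of_real v powr (dual s - 1) - c * of_real v powr (- s - 1)"
    proof (intro allI impI)
      fix v :: real assume "v \<in> {1<..}"
      hence v: "v > 0" by simp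
      let ?V = "\<lambda>z. complex_of_real v powr z"
      have mul: "?V p * ?V q = ?V (p + q)" for p q by (simp add: powr_add)
      have V2: "complex_of_real (1 / v\<^sup>2) = ?V (- 2)"
        using v by (simp add: powr_minus divide_inverse)
      have V3: "complex_of_real ((1 / v) powr (- (CARD('n) / 2 + m))) = ?V (of_real (CARD('n) / 2 + m))"
      proof -
        have "(1 / v) powr (- X) = v powr X" for X
          using v by (simp add: powr_divide powr_minus)
        hence "(1 / v) powr (- (CARD('n) / 2 + m)) = v powr (CARD('n) / 2 + m)" .
        thus ?thesis using v by (simp only: powr_of_real[symmetric] less_imp_le)
      qed
      \<comment> \<open>Pure algebra: after inversion the theta relation splits the integrand into a
        dual theta part and two pure powers of v, which integrate to the pole terms.\<close>
      have expand: "p * (q * (k * r * (t + b') - b)) = k * ((p * q * r) * t) + (k * b') * (p * q * r) - b * (p * q)"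
        for p q r k t b b' :: complex by (simp add: algebra_simps)
      have "(1 / v\<^sup>2) *\<^sub>R F (1 / v) = ?V (- 2) * (?V (- (s - 1)) * \<theta> (1 / v))"
        unfolding scaleR_conv_of_real V2 using v by (simp add: F_def of_real_inverse_powr del: of_real_divide)
      also have "\<theta> (1 / v) = \<kappa> * ?V (of_real (CARD('n) / 2 + m)) * (\<theta>' v + c') - c"
        using theta_relation[of "1 / v"] v unfolding V3 by (simp only: divide_divide_eq_right mult_1 div_by_1 zero_less_divide_1_iff)
      also have "?V (- 2) * (?V (- (s - 1)) * (\<kappa> * ?V (of_real (CARD('n) / 2 + m)) * (\<theta>' v + c') - c)) =
        \<kappa> * ((?V (- 2) * ?V (- (s - 1)) * ?V (of_real (CARD('n) / 2 + m))) * \<theta>' v) +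
        (\<kappa> * c') * (?V (- 2) * ?V (- (s - 1)) * ?V (of_real (CARD('n) / 2 + m))) -
        c * (?V (- 2) * ?V (- (s - 1)))" by (rule expand)
      also have "?V (- 2) * ?V (- (s - 1)) * ?V (of_real (CARD('n) / 2 + m)) = ?V (dual s - 1)"
        unfolding mul dual_def by (simp add: algebra_simps)
      also have "?V (- 2) * ?V (- (s - 1)) = ?V (- s - 1)"
        unfolding mul by (rule arg_cong[where f="?V"]) (simp add: complex_eq_iff)
      finally show "(1 / v\<^sup>2) *\<^sub>R F (1 / v) = \<kappa> * (?V (dual s - 1) * \<theta>' v) +
        (\<kappa> * c') * ?V (dual s - 1) - c * ?V (- s - 1)" .
    qed
  qed auto
  also have "\<dots> = \<kappa> * J (dual s) + (- \<kappa> * c' / dual s) - c * (- 1 / (- s))"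
  proof -
    have i1: "set_integrable lborel {1<..} (\<lambda>v. \<kappa> * (of_real v powr (dual s - 1) * \<theta>' v))"
      by (intro set_integrable_mult_right set_integrable_open_tail tail_integrable')
    have v1: "(LINT v:{1<..}|lborel. \<kappa> * (of_real v powr (dual s - 1) * \<theta>' v)) = \<kappa> * J (dual s)"
      by (simp add: integral_open_tail[OF tail_integrable'] J_def)
    have ms: "Re (- s) < 0" using Re by simp
    have i3: "set_integrable lborel {1<..} (\<lambda>v. c * of_real v powr (- s - 1))"
      by (intro set_integrable_mult_right set_integrable_powr_tail ms)
    have v3: "(LINT v:{1<..}|lborel. c * of_real v powr (- s - 1)) = c * (- 1 / (- s))"
      using integral_powr_tail[OF ms] by simp
    show ?thesis
      using set_integral_diff(2)[OF set_integral_add(1)[OF i1 constant_term_tail(1)[OF s]] i3]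
        set_integral_add(2)[OF i1 constant_term_tail(1)[OF s]]
      by (simp only: v1 v3 constant_term_tail(2)[OF s])
  qed
  finally show ?thesis by (simp add: algebra_simps)
qed

lemma rGamma_div: "s \<noteq> 0 \<Longrightarrow> rGamma s * (b / s) = b * rGamma (s + 1)" for s b :: complex
  using rGamma_plus1[of s] by (simp add: field_simps)

text \<open>Term by term the Mellin transform is Gamma s times (a |z|^2)^(-s); multiplication by a^s
  / Gamma s leaves |z|^(-2 s), and \<open>mellin_identity\<close> evaluates the sum.\<close>

lemma dirichlet_has_sum:
  assumes s: "2 * Re s > CARD('n) + m"
  shows "((\<lambda>z. w z * of_real (norm z) powr (- (2 * s))) has_sum R s) (S - {0})"
proof -
  have "real CARD('n) \<ge> 0" "real m \<ge> 0" by simp_all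
  with s have Re: "Re s > 0" by linarith
  hence s0: "s \<noteq> 0" by auto
  obtain C where C: "\<And>z. norm (w z) \<le> C * norm z ^ m" using growth by blast
  note * = countable_S zeta_summable_S C a_pos(1) mellin_dominated_full[OF Re] s
  let ?K = "\<lambda>z. w z * (LINT u:{0<..}|lborel. mellin_kernel s (a * (z \<bullet> z)) u)"
  let ?Y = "I s - c / s + \<kappa> * (J (dual s) - c' / dual s)"
  have "infsum ?K (S - {0}) = ?Y"
    using mellin_theta_integral[OF *] mellin_identity[OF s] by (simp only: \<theta>_def)
  hence "(?K has_sum ?Y) (S - {0})"
    using has_sum_infsum[OF abs_summable_summable[OF mellin_theta_summable[OF *]]] by simp
  hence "((\<lambda>z. (rGamma s * of_real a powr s) * ?K z) has_sum ((rGamma s * of_real a powr s) * ?Y)) (S - {0})"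
    by (rule has_sum_cmult_right)
  also have "(rGamma s * of_real a powr s) * ?Y = R s"
    unfolding R_def rGamma_div[OF s0, symmetric] by (simp add: algebra_simps)
  finally show ?thesis
  proof (rule has_sum_cong[THEN iffD1, rotated])
    fix z assume "z \<in> S - {0}"
    hence z: "z \<noteq> 0" by simp
    hence zz: "a * (z \<bullet> z) > 0" using a_pos by simp
    have "of_real (a * (z \<bullet> z)) powr (- s) = of_real a powr (- s) * complex_of_real (z \<bullet> z) powr (- s)"
      using a_pos by (simp add: powr_times_real)
    also have "complex_of_real (z \<bullet> z) powr (- s) = of_real (norm z) powr (- (2 * s))"
      unfolding dot_square_norm using z by (simp add: powr_def Ln_of_real ln_realpow mult_ac flip: of_real_power)
    finally have "?K z = w z * (Gamma s * (of_real a powr (- s) * of_real (norm z) powr (- (2 * s))))"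
      using integral_mellin_kernel[OF Re zz] by simp
    moreover have "rGamma s * Gamma s = 1"
    proof -
      have "s \<notin> \<int>\<^sub>\<le>\<^sub>0" using Re by (auto elim!: nonpos_Ints_cases)
      thus ?thesis by (simp add: Gamma_def rGamma_eq_zero_iff)
    qed
    moreover have regroup: "(r * p) * (b * (g * (p' * n))) = (r * g) * ((p * p') * (b * n))" for r p b g p' n :: complex
      by (simp only: mult_ac)
    moreover have "complex_of_real a powr s * of_real a powr (- s) = 1"
      using a_pos by (simp add: powr_minus)
    ultimately show "(rGamma s * of_real a powr s) * ?K z = w z * of_real (norm z) powr (- (2 * s))"
      using regroup[of "rGamma s" "of_real a powr s" "w z" "Gamma s" "of_real a powr (- s)" "of_real (norm z) powr (- (2 * s))"]
      by (simp only: mult_1)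
  qed
qed

section \<open>Identification of the tail integrals with sums of Crandall functions\<close>

lemma upper_crandall_S:
  assumes "z \<noteq> 0"
  shows "upper_crandall (2 * s) (z /\<^sub>R lam) = (LINT u:{1..}|lborel. mellin_kernel s (a * (z \<bullet> z)) u)"
    "upper_crandall (2 * s) (lam *\<^sub>R z) = (LINT u:{1..}|lborel. mellin_kernel s (a' * (z \<bullet> z)) u)"
proof -
  have E: "pi * ((z /\<^sub>R lam) \<bullet> (z /\<^sub>R lam)) = a * (z \<bullet> z)" "pi * ((lam *\<^sub>R z) \<bullet> (lam *\<^sub>R z)) = a' * (z \<bullet> z)"
    by (simp_all add: a_def a'_def power2_eq_square divide_inverse)
  have nz: "z /\<^sub>R lam \<noteq> 0" "lam *\<^sub>R z \<noteq> 0" "2 * s / 2 = s" using assms lam by auto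
  from upper_crandall_eq[OF nz(1), of "2 * s"] upper_crandall_eq[OF nz(2), of "2 * s"]
  show "upper_crandall (2 * s) (z /\<^sub>R lam) = (LINT u:{1..}|lborel. mellin_kernel s (a * (z \<bullet> z)) u)"
    "upper_crandall (2 * s) (lam *\<^sub>R z) = (LINT u:{1..}|lborel. mellin_kernel s (a' * (z \<bullet> z)) u)"
    unfolding E nz(3) by simp_all
qed

lemma crandall_sum_S:
  shows "(\<lambda>z. of_real (h z) * upper_crandall (2 * s) (z /\<^sub>R lam) * wave (- y) (z + x)) summable_on S" (is "?f summable_on S")
    and "(\<Sum>\<^sub>\<infinity>z\<in>S. of_real (h z) * upper_crandall_over_Gamma (2 * s) (z /\<^sub>R lam) * wave (- y) (z + x)) =
      rGamma s * I s - c * rGamma (s + 1)" (is "infsum ?g S = _")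
proof -
  let ?k = "\<lambda>z. w z * (LINT u:{1..}|lborel. mellin_kernel s (a * (z \<bullet> z)) u)"
  have f: "?f z = ?k z" and g: "?g z = rGamma s * ?k z" if "z \<in> S - {0}" for z
    using that lam upper_crandall_S(1)[of z s] by (auto simp: upper_crandall_over_Gamma_def w_def)
  have "?f summable_on (S - {0})"
    using I_summable[of s] summable_on_cong[of "S - {0}" ?f ?k] f by blast
  thus "?f summable_on S" by (rule infsum_split_zero(1))
  have gs: "?g summable_on (S - {0})"
    using summable_on_cmult_right[OF I_summable[of s], of "rGamma s"] summable_on_cong[of "S - {0}" ?g "\<lambda>z. rGamma s * ?k z"] g
    by blast
  have "infsum ?g (S - {0}) = (\<Sum>\<^sub>\<infinity>z\<in>S - {0}. rGamma s * ?k z)" by (rule infsum_cong[OF g])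
  also have "\<dots> = rGamma s * I s" unfolding I_eq by (rule infsum_cmult_right')
  finally have gi: "infsum ?g (S - {0}) = rGamma s * I s" .
  \<comment> \<open>At the origin the Crandall value -2 / (2 s) times 1 / Gamma s is - 1 / Gamma (s
    + 1); at s = 0 the definition supplies the limit -1 of the same expression.\<close>
  have "upper_crandall_over_Gamma (2 * s) (0 :: real^'n) = - rGamma (s + 1)"
  proof (cases "s = 0")
    case False
    thus ?thesis using rGamma_div[of s 1] by (simp add: upper_crandall_over_Gamma_def upper_crandall_def mult.commute)
  qed (simp add: upper_crandall_over_Gamma_def)
  hence "?g 0 = - (w 0 * rGamma (s + 1))" by (simp add: w_def)
  thus "infsum ?g S = rGamma s * I s - c * rGamma (s + 1)"
    unfolding infsum_split_zero(2)[OF gs] gi by (simp add: c_def)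
qed

lemma crandall_sum_S':
  shows "(\<lambda>p. of_real (h p) * upper_crandall (2 * s) (lam *\<^sub>R p) * wave (- x) p) summable_on S'" (is "?f summable_on S'")
    and "(\<Sum>\<^sub>\<infinity>p\<in>S'. of_real (h p) * upper_crandall (2 * s) (lam *\<^sub>R p) * wave (- x) p) = J s - c' / s"
proof -
  let ?k = "\<lambda>z. w' z * (LINT u:{1..}|lborel. mellin_kernel s (a' * (z \<bullet> z)) u)"
  have f: "?f z = ?k z" if "z \<in> S' - {0}" for z
    using that lam upper_crandall_S(2)[of z s] by (auto simp: w'_def)
  have fs: "?f summable_on (S' - {0})"
    using J_summable[of s] summable_on_cong[of "S' - {0}" ?f ?k] f by blast
  thus "?f summable_on S'" by (rule infsum_split_zero(1))
  have "infsum ?f (S' - {0}) = J s" unfolding J_eq by (rule infsum_cong[OF f])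
  \<comment> \<open>For s = 0 both sides are 0 because division by zero gives 0.\<close>
  moreover have "?f 0 = - (w' 0 / s)" by (simp add: upper_crandall_def w'_def)
  ultimately show "infsum ?f S' = J s - c' / s"
    unfolding infsum_split_zero(2)[OF fs] by (simp add: c'_def)
qed

text \<open>Apart from c' / dual s, everything in \<open>R\<close> is entire.\<close>

lemma analytic_R:
  assumes "c' = 0 \<or> dual s \<noteq> 0"
  shows "R analytic_on {s}"
proof -
  have IJ: "I analytic_on X" "J analytic_on X" for X
    using holomorphic_I holomorphic_J analytic_on_open[OF open_UNIV] analytic_on_subset by blast+
  have d: "dual analytic_on X" for X unfolding dual_def[abs_def] by (intro analytic_intros)
  have Jd: "(\<lambda>s. J (dual s)) analytic_on {s}"
    using analytic_on_compose[OF d IJ(2)] by (simp add: o_def)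
  have q: "(\<lambda>s. c' / dual s) analytic_on {s}"
    using assms by (cases "c' = 0") (auto intro!: analytic_intros d)
  have aR: "complex_of_real a \<notin> \<real>\<^sub>\<le>\<^sub>0" using a_pos by (auto simp: complex_nonpos_Reals_iff)
  show ?thesis
    unfolding R_def[abs_def] by (intro analytic_intros IJ Jd q analytic_rGamma aR)
qed

lemma meromorphic_R: "R meromorphic_on UNIV"
proof -
  have IJ: "I analytic_on UNIV" "J analytic_on UNIV"
    using holomorphic_I holomorphic_J analytic_on_open[OF open_UNIV] by blast+
  have d: "dual analytic_on UNIV" unfolding dual_def[abs_def] by (intro analytic_intros)
  have Jd: "(\<lambda>s. J (dual s)) analytic_on UNIV"
    using analytic_on_compose[OF d analytic_on_subset[OF IJ(2)]] by (simp add: o_def)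
  have aR: "complex_of_real a \<notin> \<real>\<^sub>\<le>\<^sub>0" using a_pos by (auto simp: complex_nonpos_Reals_iff)
  have p: "(\<lambda>s. of_real a powr s) analytic_on UNIV" by (intro analytic_intros aR)
  have g: "(\<lambda>s. rGamma (s + 1)) analytic_on UNIV" "rGamma analytic_on UNIV"
    by (intro analytic_intros analytic_rGamma)+
  show ?thesis
    unfolding R_def[abs_def]
    by (intro meromorphic_on_mult meromorphic_on_add meromorphic_on_diff meromorphic_on_divide
          meromorphic_on_const analytic_on_imp_meromorphic_on IJ d Jd p g)
qed

end

section \<open>The anisotropic Epstein zeta function\<close>

text \<open>The difference F - G may have wrong values at isolated points, so the identity theorem
  is applied to its normal form, which vanishes on a half-plane and hence everywhere. Thus F and G
  agree near each point except possibly at it; there the normal form fixes the value as the limit,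
  or as 0 at a pole, and poles are shared.\<close>

lemma nicely_meromorphic_eqI:
  assumes F: "F nicely_meromorphic_on UNIV" and G: "G nicely_meromorphic_on UNIV"
    and eq: "\<And>z. Re z > r \<Longrightarrow> F z = G z"
  shows "F = G"
proof
  define D where "D = remove_sings (\<lambda>z. F z - G z)"
  have mero: "(\<lambda>z. F z - G z) meromorphic_on UNIV"
    using F G by (intro meromorphic_on_diff) (auto simp: nicely_meromorphic_on_def)
  have D: "D nicely_meromorphic_on UNIV" unfolding D_def by (rule remove_sings_nicely_meromorphic[OF mero])
  have openH: "open {z. Re z > r}" by (rule open_halfspace_Re_gt)
  have "D z = 0" if "z \<in> {z. Re z > r}" for z
  proof -
    have "eventually (\<lambda>w. w \<in> {z. Re z > r}) (at z)"
      using openH that by (rule eventually_at_in_open')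
    hence "eventually (\<lambda>w. F w - G w = 0) (at z)" by eventually_elim (simp add: eq)
    hence "(\<lambda>w. F w - G w) \<midarrow>z\<rightarrow> 0" by (rule tendsto_eventually)
    thus ?thesis unfolding D_def by (rule remove_sings_eqI)
  qed
  hence const: "D constant_on {z. Re z > r}" unfolding constant_on_def by blast
  have z0: "complex_of_real (r + 1) \<in> {z. Re z > r}" by simp
  have "D constant_on UNIV"
    by (rule constant_on_extend_nicely_meromorphic_on[OF D const openH]) (use z0 in blast)+
  then obtain d where d: "\<And>z. D z = d" by (auto simp: constant_on_def)
  with z0 \<open>\<And>z. z \<in> {z. Re z > r} \<Longrightarrow> D z = 0\<close> have D0: "D z = 0" for z by metis
  fix z
  have "isolated_singularity_at (\<lambda>z. F z - G z) z"
    using mero by (meson UNIV_I meromorphic_on_isolated_singularity meromorphic_on_subset subset_UNIV)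
  from eventually_remove_sings_eq_at[OF this] have ev: "eventually (\<lambda>w. F w = G w) (at z)"
    by eventually_elim (use D0 in \<open>simp add: D_def\<close>)
  have pole: "is_pole F z \<longleftrightarrow> is_pole G z" by (rule is_pole_cong[OF ev refl])
  have FG: "is_pole F z \<and> F z = 0 \<or> F \<midarrow>z\<rightarrow> F z" "is_pole G z \<and> G z = 0 \<or> G \<midarrow>z\<rightarrow> G z"
    using F G by (auto simp: nicely_meromorphic_on_def)
  show "F z = G z"
  proof (cases "is_pole F z")
    case True
    have "\<not> F \<midarrow>z\<rightarrow> F z" "\<not> G \<midarrow>z\<rightarrow> G z"
      using True pole not_tendsto_and_filterlim_at_infinity[of "at z"] by (auto simp: is_pole_def)
    thus ?thesis using FG by simp
  next
    case False
    hence "F \<midarrow>z\<rightarrow> F z" "G \<midarrow>z\<rightarrow> G z" using FG pole by auto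
    moreover have "F \<midarrow>z\<rightarrow> G z" using ev tendsto_cong[OF ev] \<open>G \<midarrow>z\<rightarrow> G z\<close> by simp
    ultimately show ?thesis using LIM_unique by blast
  qed
qed

lemma epstein_zeta_eqI:
  assumes F: "is_epstein_continuation L \<alpha> x y F"
  shows "epstein_zeta L \<nu> \<alpha> x y = F \<nu>"
proof -
  have "(THE F. is_epstein_continuation L \<alpha> x y F) = F"
  proof (rule the_equality)
    show "is_epstein_continuation L \<alpha> x y F" by (rule F)
    fix G assume G: "is_epstein_continuation L \<alpha> x y G"
    show "G = F"
      by (rule nicely_meromorphic_eqI[where r="real (CARD('a) + mi_abs \<alpha>)"])
         (use F G in \<open>auto simp: is_epstein_continuation_def intro: has_sum_unique\<close>)
  qed
  thus ?thesis by (simp add: epstein_zeta_def)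
qed

section \<open>Assembling the harmonic components\<close>

lemma exp_eq_wave: "exp (- 2 * of_real pi * \<i> * of_real (y \<bullet> z)) = wave (- y) z"
  by (simp add: wave_def cis_conv_exp mult_ac)

lemma has_sum_finite_sum:
  fixes f :: "'k \<Rightarrow> 'a \<Rightarrow> complex"
  assumes "finite K" "\<And>k. k \<in> K \<Longrightarrow> (f k has_sum s k) X"
  shows "((\<lambda>z. \<Sum>k\<in>K. f k z) has_sum (\<Sum>k\<in>K. s k)) X"
  using assms by (induction K rule: finite_induct) (auto intro!: has_sum_add)

theorem theorem3p5:
  fixes A :: "real ^ 'n ^ 'n" and \<alpha> :: "nat ^ 'n" and x y :: "real ^ 'n"
    and \<nu> :: complex and lam :: real
  assumes "invertible A"
    and "y \<in> reciprocal_lattice A \<and> (\<forall>j. even (\<alpha> $ j)) \<longrightarrow> \<nu> \<noteq> of_nat (CARD('n) + mi_abs \<alpha>)"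
    and "lam > 0"
  shows "(\<forall>k \<le> mi_abs \<alpha> div 2.
            (\<lambda>z. of_real (harmonic_part k \<alpha> z)
                   * upper_crandall (\<nu> - 2 * of_nat k) (z /\<^sub>R lam)
                   * exp (- 2 * of_real pi * \<i> * of_real (y \<bullet> (z + x))))
              summable_on ((\<lambda>z. z - x) ` lattice_of A) \<and>
            (\<lambda>p. of_real (harmonic_part k \<alpha> p)
                   * upper_crandall (of_nat CARD('n) - \<nu> + 2 * (of_nat (mi_abs \<alpha>) - of_nat k)) (lam *\<^sub>R p)
                   * exp (- 2 * of_real pi * \<i> * of_real (x \<bullet> p)))
              summable_on ((\<lambda>p. p + y) ` reciprocal_lattice A)) \<and>
         epstein_zeta (lattice_of A) \<nu> \<alpha> x y =
           (\<Sum>k\<le>mi_abs \<alpha> div 2.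
              of_real (pi / lam ^ 2) powr (\<nu> / 2 - of_nat k) *
              ((\<Sum>\<^sub>\<infinity>z\<in>(\<lambda>z. z - x) ` lattice_of A.
                  of_real (harmonic_part k \<alpha> z)
                    * upper_crandall_over_Gamma (\<nu> - 2 * of_nat k) (z /\<^sub>R lam)
                    * exp (- 2 * of_real pi * \<i> * of_real (y \<bullet> (z + x))))
               + rGamma (\<nu> / 2 - of_nat k) * (- 1) ^ k
                   * (of_real (lam ^ (CARD('n) + 2 * mi_abs \<alpha> - 4 * k))
                        / (\<i> ^ mi_abs \<alpha> * of_real (covolume A)))
                   * (\<Sum>\<^sub>\<infinity>p\<in>(\<lambda>p. p + y) ` reciprocal_lattice A.
                        of_real (harmonic_part k \<alpha> p)
                          * upper_crandall (of_nat CARD('n) - \<nu> + 2 * (of_nat (mi_abs \<alpha>) - of_nat k)) (lam *\<^sub>R p)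
                          * exp (- 2 * of_real pi * \<i> * of_real (x \<bullet> p)))))"
proof -
  define N where "N = mi_abs \<alpha>"
  define K where "K = N div 2"
  define H where "H k = (harmonic_part k \<alpha> :: real ^ 'n \<Rightarrow> real)" for k
  define M where "M k = N - 2 * k" for k
  define Rk where "Rk k = harmonic_theta.R A x y lam (H k) (M k)" for k
  \<comment> \<open>The right-hand side as a function of the exponent. It is only a candidate for
    the continuation, since its values at poles need not be 0.\<close>
  define F0 where "F0 \<mu> = (\<Sum>k\<le>K. Rk k (\<mu> / 2 - of_nat k))" for \<mu>
  have loc: "harmonic_theta A lam (H k) (M k)" if "k \<le> K" for k
    using assms(1,3) harmonic_homogeneous_harmonic_part[of k \<alpha>] that
    by (auto simp: harmonic_theta_def H_def M_def K_def N_def)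
  have Mk: "2 * k + M k = N" if "k \<le> K" for k using that by (auto simp: M_def K_def)
  have Mc: "complex_of_real (real (M k)) = of_nat N - 2 * of_nat k" if "k \<le> K" for k
    using Mk[OF that, symmetric] by simp
  have dual: "harmonic_theta.dual TYPE('n) (M k) (\<mu> / 2 - of_nat k) =
      (of_nat CARD('n) - \<mu> + 2 * (of_nat N - of_nat k)) / 2" if "k \<le> K" for k \<mu>
    unfolding harmonic_theta.dual_def[OF loc[OF that]] of_real_add Mc[OF that] by (simp add: field_simps)
  have shift: "(\<lambda>z. z - x) ` lattice_of A = harmonic_theta.S A x" if "k \<le> K" for k
    unfolding harmonic_theta.S_def[OF loc[OF that]] by simp
  have shift': "(\<lambda>p. p + y) ` reciprocal_lattice A = harmonic_theta.S' A y" if "k \<le> K" for k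
    unfolding harmonic_theta.S'_def[OF loc[OF that]] ..

  have meroF0: "F0 meromorphic_on UNIV"
    unfolding F0_def
  proof (rule meromorphic_on_sum)
    fix k assume "k \<in> {..K}"
    hence "Rk k meromorphic_on UNIV" using harmonic_theta.meromorphic_R[OF loc] by (simp add: Rk_def)
    thus "(\<lambda>\<mu>. Rk k (\<mu> / 2 - of_nat k)) meromorphic_on UNIV"
      by (rule meromorphic_on_compose) (auto intro!: analytic_intros)
  qed
  \<comment> \<open>A pole of the k-th summand needs c' \<noteq> 0 and a zero of the dual exponent.
    The first puts y in the reciprocal lattice, makes all exponents even and gives |\<alpha>| = 2 k;
    the second then reads \<mu> = d + |\<alpha>|.\<close>
  have analytic: "F0 analytic_on {\<mu>}"
    if \<mu>: "y \<in> reciprocal_lattice A \<and> (\<forall>j. even (\<alpha> $ j)) \<longrightarrow> \<mu> \<noteq> of_nat (CARD('n) + N)" for \<mu>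
    unfolding F0_def
  proof (rule analytic_on_sum)
    fix k assume "k \<in> {..K}"
    hence k: "k \<le> K" by simp
    interpret harmonic_theta A x y lam "H k" "M k" by (rule loc[OF k])
    have "c' = 0 \<or> dual (\<mu> / 2 - of_nat k) \<noteq> 0"
    proof (rule ccontr)
      assume "\<not> ?thesis"
      hence c': "c' \<noteq> 0" and d: "dual (\<mu> / 2 - of_nat k) = 0" by auto
      note nz = c'_nonzero[OF c']
      from nz(2) obtain p where p: "p \<in> reciprocal_lattice A" "p + y = 0" by (auto simp: S'_def)
      \<comment> \<open>That 0 lies in \<Lambda>* + y says that - y lies in \<Lambda>*, which is
        closed under negation.\<close>
      have "y \<in> reciprocal_lattice A"
      proof -
        from p(1) obtain n where n: "n \<in> int_vec" "p = transpose (matrix_inv A) *v n"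
          by (auto simp: reciprocal_lattice_def lattice_of_int_vec)
        have "y = - p" using p(2) by (simp add: eq_neg_iff_add_eq_0 add.commute)
        hence "y = transpose (matrix_inv A) *v (- n)" by (simp add: n(2) matrix_vector_mult_minus)
        thus ?thesis using int_vec_minus[OF n(1)] by (auto simp: reciprocal_lattice_def lattice_of_int_vec)
      qed
      moreover have "\<forall>j. even (\<alpha> $ j)"
        using nz(3) harmonic_part_0_eq_0[of \<alpha> k] k by (auto simp: H_def K_def N_def)
      moreover have "\<mu> = of_nat (CARD('n) + N)"
      proof -
        have "N = 2 * k" using nz(1) Mk[OF k] by simp
        moreover have "of_nat CARD('n) - \<mu> + 2 * (of_nat N - of_nat k) = 0"
          using d unfolding dual[OF k] by simp
        ultimately show ?thesis by (simp add: algebra_simps)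
      qed
      ultimately show False using \<mu> by blast
    qed
    from analytic_R[OF this] have "Rk k analytic_on {\<mu> / 2 - of_nat k}" by (simp add: Rk_def)
    hence "Rk k \<circ> (\<lambda>\<mu>. \<mu> / 2 - of_nat k) analytic_on {\<mu>}"
      by (intro analytic_on_compose analytic_intros) auto
    thus "(\<lambda>\<mu>. Rk k (\<mu> / 2 - of_nat k)) analytic_on {\<mu>}" by (simp add: o_def)
  qed

  \<comment> \<open>The normal form has value 0 at poles, where F0 may have another one;
    \<open>remove_sings\<close> changes nothing where F0 is analytic.\<close>
  have "is_epstein_continuation (lattice_of A) \<alpha> x y (remove_sings F0)"
    unfolding is_epstein_continuation_def
  proof (intro conjI allI impI)
    show "remove_sings F0 nicely_meromorphic_on UNIV" by (rule remove_sings_nicely_meromorphic[OF meroF0])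
    fix \<mu> :: complex assume \<mu>: "Re \<mu> > real (CARD('n) + mi_abs \<alpha>)"
    have "F0 analytic_on {\<mu>}" using \<mu> by (intro analytic) (auto simp: N_def)
    hence F0: "remove_sings F0 \<mu> = F0 \<mu>" by (rule remove_sings_at_analytic)
    let ?X = "lattice_of A - {x}"
    have "((\<lambda>z. \<Sum>k\<le>K. of_real (H k (z - x)) * wave (- y) z * of_real (norm (z - x)) powr (- (2 * (\<mu> / 2 - of_nat k)))) has_sum F0 \<mu>) ?X"
      unfolding F0_def
    proof (rule has_sum_finite_sum)
      fix k assume "k \<in> {..K}"
      hence k: "k \<le> K" by simp
      interpret harmonic_theta A x y lam "H k" "M k" by (rule loc[OF k])
      \<comment> \<open>The bound 2 Re s > d + m with m = |\<alpha>| - 2 k is the same half-plane Re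
        \<mu> > d + |\<alpha>| for every k.\<close>
      have "Re (\<mu> / 2 - of_nat k) = Re \<mu> / 2 - k" by simp
      moreover have "real (M k) = real N - 2 * real k" using Mk[OF k, symmetric] by simp
      ultimately have "2 * Re (\<mu> / 2 - of_nat k) > CARD('n) + M k"
        using \<mu> by (simp add: N_def)
      from dirichlet_has_sum[OF this]
      have *: "((\<lambda>z. w z * of_real (norm z) powr (- (2 * (\<mu> / 2 - of_nat k)))) has_sum Rk k (\<mu> / 2 - of_nat k)) (S - {0})"
        by (simp add: Rk_def)
      have "S - {0} = (\<lambda>z. z - x) ` ?X" by (auto simp: S_def)
      moreover have "inj_on (\<lambda>z. z - x) ?X" by (auto simp: inj_on_def)
      ultimately show "((\<lambda>z. of_real (H k (z - x)) * wave (- y) z * of_real (norm (z - x)) powr (- (2 * (\<mu> / 2 - of_nat k))))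
          has_sum Rk k (\<mu> / 2 - of_nat k)) ?X"
        using * by (simp add: has_sum_reindex o_def w_def)
    qed simp
    also have "?this \<longleftrightarrow> ((\<lambda>z. exp (- 2 * of_real pi * \<i> * of_real (y \<bullet> z)) *
               (of_real (mi_pow (z - x) \<alpha>) / of_real (norm (z - x)) powr \<mu>)) has_sum F0 \<mu>) ?X"
    proof (rule has_sum_cong)
      fix z assume "z \<in> ?X"
      hence r: "norm (z - x) > 0" by simp
      have "mi_pow (z - x) \<alpha> = (\<Sum>k\<le>K. norm (z - x) ^ (2 * k) * H k (z - x))"
        using harmonic_decomposition_harmonic_part[of \<alpha>] unfolding harmonic_decomposition_alt K_def N_def H_def by blast
      hence "of_real (mi_pow (z - x) \<alpha>) = (\<Sum>k\<le>K. complex_of_real (norm (z - x)) ^ (2 * k) * of_real (H k (z - x)))"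
        by (simp only: of_real_sum of_real_mult of_real_power)
      hence "exp (- 2 * of_real pi * \<i> * of_real (y \<bullet> z)) * (of_real (mi_pow (z - x) \<alpha>) / of_real (norm (z - x)) powr \<mu>) =
          (\<Sum>k\<le>K. wave (- y) z * (complex_of_real (norm (z - x)) ^ (2 * k) * of_real (H k (z - x)) / of_real (norm (z - x)) powr \<mu>))"
        unfolding exp_eq_wave by (simp only: sum_divide_distrib sum_distrib_left)
      also have "\<dots> = (\<Sum>k\<le>K. of_real (H k (z - x)) * wave (- y) z * of_real (norm (z - x)) powr (- (2 * (\<mu> / 2 - of_nat k))))"
      proof (rule sum.cong[OF refl])
        fix k
        \<comment> \<open>Here r^(-2 s) = r^(2 k) / r^\<mu> for r = |z - x|: the factor r^(2 k) of
          the decomposition is exactly the shift of the exponent.\<close>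
        have "- (2 * (\<mu> / 2 - of_nat k)) = of_nat (2 * k) - \<mu>" by simp
        hence "complex_of_real (norm (z - x)) powr (- (2 * (\<mu> / 2 - of_nat k))) =
            complex_of_real (norm (z - x)) ^ (2 * k) / of_real (norm (z - x)) powr \<mu>"
          using r by (simp only: powr_diff) (subst powr_nat', auto)
        thus "wave (- y) z * (complex_of_real (norm (z - x)) ^ (2 * k) * of_real (H k (z - x)) / of_real (norm (z - x)) powr \<mu>) =
          of_real (H k (z - x)) * wave (- y) z * of_real (norm (z - x)) powr (- (2 * (\<mu> / 2 - of_nat k)))"
          by (simp only: times_divide_eq_right times_divide_eq_left mult_ac)
      qed
      finally show "(\<Sum>k\<le>K. of_real (H k (z - x)) * wave (- y) z * of_real (norm (z - x)) powr (- (2 * (\<mu> / 2 - of_nat k)))) =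
        exp (- 2 * of_real pi * \<i> * of_real (y \<bullet> z)) * (of_real (mi_pow (z - x) \<alpha>) / of_real (norm (z - x)) powr \<mu>)" ..
    qed
    finally show "((\<lambda>z. exp (- 2 * of_real pi * \<i> * of_real (y \<bullet> z)) *
               (of_real (mi_pow (z - x) \<alpha>) / of_real (norm (z - x)) powr \<mu>)) has_sum remove_sings F0 \<mu>) ?X"
      unfolding F0 .
  qed
  \<comment> \<open>The hypothesis on \<nu> makes F0 analytic there, so its normal form takes the
    value F0 \<nu>.\<close>
  hence zeta: "epstein_zeta (lattice_of A) \<nu> \<alpha> x y = F0 \<nu>"
    using epstein_zeta_eqI analytic[of \<nu>] assms(2) remove_sings_at_analytic unfolding N_def by metis

  have terms: "(\<lambda>z. of_real (H k z) * upper_crandall (\<nu> - 2 * of_nat k) (z /\<^sub>R lam)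
                   * exp (- 2 * of_real pi * \<i> * of_real (y \<bullet> (z + x))))
              summable_on ((\<lambda>z. z - x) ` lattice_of A) \<and>
            (\<lambda>p. of_real (H k p) * upper_crandall (of_nat CARD('n) - \<nu> + 2 * (of_nat N - of_nat k)) (lam *\<^sub>R p)
                   * exp (- 2 * of_real pi * \<i> * of_real (x \<bullet> p)))
              summable_on ((\<lambda>p. p + y) ` reciprocal_lattice A) \<and>
        Rk k (\<nu> / 2 - of_nat k) = of_real (pi / lam ^ 2) powr (\<nu> / 2 - of_nat k) *
              ((\<Sum>\<^sub>\<infinity>z\<in>(\<lambda>z. z - x) ` lattice_of A.
                  of_real (H k z) * upper_crandall_over_Gamma (\<nu> - 2 * of_nat k) (z /\<^sub>R lam)
                    * exp (- 2 * of_real pi * \<i> * of_real (y \<bullet> (z + x))))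
               + rGamma (\<nu> / 2 - of_nat k) * (- 1) ^ k
                   * (of_real (lam ^ (CARD('n) + 2 * N - 4 * k)) / (\<i> ^ N * of_real (covolume A)))
                   * (\<Sum>\<^sub>\<infinity>p\<in>(\<lambda>p. p + y) ` reciprocal_lattice A.
                        of_real (H k p) * upper_crandall (of_nat CARD('n) - \<nu> + 2 * (of_nat N - of_nat k)) (lam *\<^sub>R p)
                          * exp (- 2 * of_real pi * \<i> * of_real (x \<bullet> p))))"
    if k: "k \<le> K" for k
  proof -
    interpret harmonic_theta A x y lam "H k" "M k" by (rule loc[OF k])
    let ?s = "\<nu> / 2 - of_nat k"
    have e1: "\<nu> - 2 * of_nat k = 2 * ?s" by simp
    have e2: "of_nat CARD('n) - \<nu> + 2 * (of_nat N - of_nat k) = 2 * dual ?s"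
      unfolding dual[OF k] by simp
    \<comment> \<open>With |\<alpha>| = 2 k + m one has i^|\<alpha>| = (-1)^k i^m, hence (-1)^k /
      i^|\<alpha>| = (-i)^m, and the exponent d + 2 |\<alpha>| - 4 k is d + 2 m.\<close>
    have \<kappa>: "(- 1) ^ k * (of_real (lam ^ (CARD('n) + 2 * N - 4 * k)) / (\<i> ^ N * of_real (covolume A))) = \<kappa>"
    proof -
      have "CARD('n) + 2 * N - 4 * k = 2 * M k + CARD('n)" using Mk[OF k, symmetric] by simp
      moreover have "\<i> ^ N = (- 1) ^ k * \<i> ^ M k"
        unfolding Mk[OF k, symmetric] by (simp add: power_add power_mult)
      moreover have "(- \<i>) ^ M k * \<i> ^ M k = 1" by (simp add: power_mult_distrib[symmetric])
      hence "(- \<i>) ^ M k = 1 / \<i> ^ M k" by (simp add: field_simps)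
      ultimately show ?thesis by (simp add: \<kappa>_def)
    qed
    have "Rk k ?s = of_real (pi / lam\<^sup>2) powr ?s *
      ((rGamma ?s * I ?s - c * rGamma (?s + 1)) + rGamma ?s * \<kappa> * (J (dual ?s) - c' / dual ?s))"
      unfolding Rk_def R_def a_def by simp
    thus ?thesis
      unfolding exp_eq_wave shift[OF k] shift'[OF k] e1 e2 crandall_sum_S(2) crandall_sum_S'(2) mult.assoc[of _ "(- 1) ^ k"] \<kappa>
      using crandall_sum_S(1) crandall_sum_S'(1) by blast
  qed
  show ?thesis
    unfolding zeta F0_def using terms unfolding H_def K_def N_def by simp
qed

end
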